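(* Let $P\subset\mathbb{R}^n$ be a convex polytope and $\ell$ a linear function nonconstant on every edge of $P$, such that for every vertex $v$ both $F^-(v)$ and $F^+(v)$ are faces of $P$ and the partition $O^-$ is a stratification. Then the following are equivalent: (1) the monotone path polytope $\mathrm{CH}_\ell(P)$ is simple; (2) for every directed edge $v\to w$ of $P$, the number of triangular 2-faces of $P$ with vertex set $\{v,w,x\}$, where $v\to x$ and $x\to w$ are directed edges, equals $\dim\big(F^-(w)\cap F^+(v)\big)-1$; (3) for every directed edge $v\to w$ of $P$, the face $F^-(w)\cap F^+(v)$ is simple along the edge $v\to w$, i.e. the star of $v\to w$ in $F^-(w)\cap F^+(v)$ is simple; (4) for every positive-dimensional face $F$ of $P$ with minimal vertex $v$ and maximal vertex $w$, the star of $F$ within the face $F^+(v)\cap F^-(w)$ is simple.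
   Context: Edges are oriented in the direction of increasing $\ell$; $v\to w$ denotes a directed edge. For a vertex $v$, $O^-(v)$ (resp. $O^+(v)$) is the union of relative interiors of faces $G$ of $P$ such that $\ell|_G$ attains its maximum (resp. minimum) at $v$; $F^\pm(v)$ is the closure of $O^\pm(v)$. $O^-$ is a stratification if $O^-(u)\cap F^-(v)\ne\emptyset$ implies $O^-(u)\subset F^-(v)$. Minimal/maximal vertex of a face: where $\ell$ is minimal/maximal on it. For a face $F$ of a polytope $Q$, the star of $F$ in $Q$ is simple if the interval $[F,Q]$ of the face lattice of $Q$ is Boolean, equivalently the number of faces of $Q$ containing $F$ as a facet equals $\dim Q-\dim F$. Monotone path polytope: with $[a,b]=\ell(P)$, $\mathrm{CH}_\ell(P)=\{\frac{1}{b-a}\int_a^b\gamma(t)\,dt : \gamma:[a,b]\to P \text{ continuous}, \ell(\gamma(t))=t\}$ (a point if $P$ is a point). *)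

theory Defs
  imports "HOL-Analysis.Analysis"
begin

definition directed_edge ::
  "'a::euclidean_space set \<Rightarrow> ('a \<Rightarrow> real) \<Rightarrow> 'a \<Rightarrow> 'a \<Rightarrow> bool" where
  "directed_edge P l v w \<longleftrightarrow> closed_segment v w edge_of P \<and> l v < l w"

definition O_minus ::
  "'a::euclidean_space set \<Rightarrow> ('a \<Rightarrow> real) \<Rightarrow> 'a \<Rightarrow> 'a set" where
  "O_minus P l v = \<Union> {rel_interior G | G. G face_of P \<and> is_arg_max l (\<lambda>x. x \<in> G) v}"

definition O_plus ::
  "'a::euclidean_space set \<Rightarrow> ('a \<Rightarrow> real) \<Rightarrow> 'a \<Rightarrow> 'a set" where
  "O_plus P l v = \<Union> {rel_interior G | G. G face_of P \<and> is_arg_min l (\<lambda>x. x \<in> G) v}"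

definition F_minus ::
  "'a::euclidean_space set \<Rightarrow> ('a \<Rightarrow> real) \<Rightarrow> 'a \<Rightarrow> 'a set" where
  "F_minus P l v = closure (O_minus P l v)"

definition F_plus ::
  "'a::euclidean_space set \<Rightarrow> ('a \<Rightarrow> real) \<Rightarrow> 'a \<Rightarrow> 'a set" where
  "F_plus P l v = closure (O_plus P l v)"

definition O_minus_stratification ::
  "'a::euclidean_space set \<Rightarrow> ('a \<Rightarrow> real) \<Rightarrow> bool" where
  "O_minus_stratification P l \<longleftrightarrow>
     (\<forall>u v. u extreme_point_of P \<longrightarrow> v extreme_point_of P \<longrightarrow>
        O_minus P l u \<inter> F_minus P l v \<noteq> {} \<longrightarrow> O_minus P l u \<subseteq> F_minus P l v)"

definition minimal_vertex :: "('a::euclidean_space \<Rightarrow> real) \<Rightarrow> 'a set \<Rightarrow> 'a \<Rightarrow> bool" where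
  "minimal_vertex l F v \<longleftrightarrow> v extreme_point_of F \<and> is_arg_min l (\<lambda>x. x \<in> F) v"

definition maximal_vertex :: "('a::euclidean_space \<Rightarrow> real) \<Rightarrow> 'a set \<Rightarrow> 'a \<Rightarrow> bool" where
  "maximal_vertex l F v \<longleftrightarrow> v extreme_point_of F \<and> is_arg_max l (\<lambda>x. x \<in> F) v"

definition face_interval :: "'a::euclidean_space set \<Rightarrow> 'a set \<Rightarrow> 'a set set" where
  "face_interval F Q = {G. G face_of Q \<and> F \<subseteq> G}"

text \<open>A finite poset of sets, ordered by inclusion, is Boolean if it is isomorphic to the
  lattice of all subsets of a finite set.\<close>

definition boolean_poset :: "'b set set \<Rightarrow> bool" where
  "boolean_poset L \<longleftrightarrow>
     (\<exists>(A::nat set) f. finite A \<and> bij_betw f L (Pow A) \<and>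
        (\<forall>G\<in>L. \<forall>H\<in>L. G \<subseteq> H \<longleftrightarrow> f G \<subseteq> f H))"

definition simple_star :: "'a::euclidean_space set \<Rightarrow> 'a set \<Rightarrow> bool" where
  "simple_star F Q \<longleftrightarrow> boolean_poset (face_interval F Q)"

definition simple_polytope :: "'a::euclidean_space set \<Rightarrow> bool" where
  "simple_polytope Q \<longleftrightarrow> polytope Q \<and> (\<forall>v. v extreme_point_of Q \<longrightarrow> simple_star {v} Q)"

text \<open>If \<open>P\<close> is a point, its monotone path polytope is taken to be that point; the integral
  mean over the degenerate interval would give the origin instead. The empty set is
  treated in the same way.\<close>

definition monotone_path_polytope ::
  "'a::euclidean_space set \<Rightarrow> ('a \<Rightarrow> real) \<Rightarrow> 'a set" where
  "monotone_path_polytope P l =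
     (if \<exists>p. P \<subseteq> {p} then P
      else let a = Inf (l ` P); b = Sup (l ` P) in
        {(1 / (b - a)) *\<^sub>R integral {a..b} \<gamma> | \<gamma>.
           continuous_on {a..b} \<gamma> \<and> (\<forall>t\<in>{a..b}. \<gamma> t \<in> P \<and> l (\<gamma> t) = t)})"

definition monotone_triangles ::
  "'a::euclidean_space set \<Rightarrow> ('a \<Rightarrow> real) \<Rightarrow> 'a \<Rightarrow> 'a \<Rightarrow> 'a set set" where
  "monotone_triangles P l v w =
     {T. T face_of P \<and> aff_dim T = 2 \<and>
         (\<exists>x. {y. y extreme_point_of T} = {v, w, x} \<and>
              directed_edge P l v x \<and> directed_edge P l x w)}"

end

theory Submission
  imports Defs
begin

text \<open>
  The hypotheses make \<open>x \<in> F\<^sup>-(y) \<longleftrightarrow> y \<in> F\<^sup>+(x)\<close> a partial order on the vertices, because the top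
  vertex of \<open>F\<^sup>+(x)\<close> is always the top vertex of \<open>P\<close>. Moreover
  \<open>dim F\<^sup>-(v) + dim F\<^sup>+(v) = dim P\<close>, so near a vertex \<open>v\<close> the polytope is the product of the cones of
  \<open>F\<^sup>-(v)\<close> and \<open>F\<^sup>+(v)\<close>. Along a monotone edge path with edges \<open>e\<^sub>i = [v\<^sub>i, w\<^sub>i]\<close> the directions of \<open>P\<close>
  are therefore the direct sum of those of the faces \<open>J\<^sub>i = F\<^sup>-(w\<^sub>i) \<inter> F\<^sup>+(v\<^sub>i)\<close>. Consequently every
  monotone path is the lower path of some linear functional, that is, gives a vertex of the monotone
  path polytope, and the edges of that polytope at this vertex are: one for each inner vertex of the
  path, and one for each 2-face of \<open>J\<^sub>i\<close> containing \<open>e\<^sub>i\<close> (which is a monotone triangle). The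
  \<open>i\<close>-th edge contributes at least \<open>dim J\<^sub>i - 1\<close> such faces, with equality iff \<open>J\<^sub>i\<close> is simple along
  \<open>e\<^sub>i\<close>; summing up, the vertex is simple iff equality holds throughout. For an arbitrary face \<open>F\<close> one
  runs a path inside \<open>F\<close> and distributes the faces covering \<open>F\<close> over the faces covering the \<open>e\<^sub>i\<close>.
\<close>

section \<open>Covering faces and simple stars\<close>

text \<open>Two local-to-global principles replace explicit cones. First, a linear functional
  constant on a face \<open>F\<close> of a polytope is minimal on \<open>F\<close> as soon as it is
  not smaller at one chosen point outside \<open>F\<close> of each face covering \<open>F\<close>.
  Spans, dimensions and simplicity at \<open>F\<close> are thereby read off from the covering faces.
  Second, every edge at a vertex \<open>v\<close> lies in \<open>Fm v\<close> or in
  \<open>Fp v\<close>, so minimality at \<open>v\<close> has to be tested only on these two faces.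

  The monotone path polytope is a priori a set of integrals of arbitrary continuous sections.
  Separation reduces it to finitely many edge paths: for each linear functional, following the
  outgoing edge of least slope gives a path whose mean minimizes the functional. Conversely, to see
  that a given path is a vertex, functionals are prescribed independently on the faces
  \<open>J_i\<close>, with slopes increasing along the path; minimality then spreads from one
  \<open>J_i\<close> to the next until it holds on all of \<open>P\<close>.\<close>

lemma linear_real_eq_inner:
  fixes \<phi> :: "'a::euclidean_space \<Rightarrow> real"
  assumes "linear \<phi>"
  obtains a where "\<phi> = (\<lambda>x. a \<bullet> x)"
proof
  show "\<phi> = (\<lambda>x. (\<Sum>b\<in>Basis. \<phi> b *\<^sub>R b) \<bullet> x)"
  proof
    fix x
    have "\<phi> x = \<phi> (\<Sum>b\<in>Basis. (x \<bullet> b) *\<^sub>R b)"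
      by (simp add: euclidean_representation)
    also have "\<dots> = (\<Sum>b\<in>Basis. (x \<bullet> b) * \<phi> b)"
      by (simp add: linear_sum[OF assms] linear_cmul[OF assms])
    also have "\<dots> = (\<Sum>b\<in>Basis. \<phi> b *\<^sub>R b) \<bullet> x"
      by (simp add: inner_sum_left inner_commute[of x] mult.commute)
    finally show "\<phi> x = (\<Sum>b\<in>Basis. \<phi> b *\<^sub>R b) \<bullet> x" .
  qed
qed

lemma linear_inner_right: "linear (\<lambda>x. a \<bullet> x)"
  by (simp add: bounded_linear.linear bounded_linear_inner_right)

text \<open>Both coefficients are kept general, so functionals used with this rule appear later in
  the shape \<open>1 * \<psi> x + (- s) * l x\<close>.\<close>

lemma linear_combine:
  fixes \<phi> \<psi> :: "'a::real_vector \<Rightarrow> real"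
  assumes "linear \<phi>" "linear \<psi>"
  shows "linear (\<lambda>x. a * \<phi> x + b * \<psi> x)"
  by (rule linearI) (simp_all add: linear_add[OF assms(1)] linear_add[OF assms(2)]
      linear_cmul[OF assms(1)] linear_cmul[OF assms(2)] algebra_simps)

lemma face_of_linear_level:
  fixes \<phi> :: "'a::euclidean_space \<Rightarrow> real"
  assumes "linear \<phi>" "convex Q" "\<And>x. x \<in> Q \<Longrightarrow> c \<le> \<phi> x"
  shows "(Q \<inter> {x. \<phi> x = c}) face_of Q"
proof -
  obtain a where "\<phi> = (\<lambda>x. a \<bullet> x)" using linear_real_eq_inner[OF assms(1)] .
  then show ?thesis using face_of_Int_supporting_hyperplane_ge[of Q c a] assms(2,3) by simp
qed

section \<open>Vertices of a polytope and minima of linear functionals\<close>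

definition vertices :: "'a::euclidean_space set \<Rightarrow> 'a set" where
  "vertices P = {v. v extreme_point_of P}"

lemma vertices_face: "F face_of P \<Longrightarrow> vertices F = vertices P \<inter> F"
  by (auto simp: vertices_def extreme_point_of_face)

lemma vertices_subset: "vertices P \<subseteq> P"
  by (auto simp: vertices_def extreme_point_of_def)

lemma finite_vertices: "polytope P \<Longrightarrow> finite (vertices P)"
  unfolding vertices_def by (simp add: finite_polyhedron_extreme_points polytope_imp_polyhedron)

lemma polytope_hull_vertices: "polytope P \<Longrightarrow> P = convex hull (vertices P)"
  unfolding vertices_def
  by (simp add: Krein_Milman_Minkowski polytope_imp_compact polytope_imp_convex)

lemma polytope_vertices_subsetD:
  "polytope P \<Longrightarrow> convex C \<Longrightarrow> vertices P \<subseteq> C \<Longrightarrow> P \<subseteq> C"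
  by (metis polytope_hull_vertices subset_hull)

lemma linear_ge_on_polytope:
  fixes \<phi> :: "'a::euclidean_space \<Rightarrow> real"
  assumes "linear \<phi>" "polytope Q" "\<And>v. v \<in> vertices Q \<Longrightarrow> c \<le> \<phi> v" "x \<in> Q"
  shows "c \<le> \<phi> x"
proof -
  obtain a where a: "\<phi> = (\<lambda>x. a \<bullet> x)" using linear_real_eq_inner[OF assms(1)] .
  have "Q \<subseteq> {x. a \<bullet> x \<ge> c}"
    by (rule polytope_vertices_subsetD[OF assms(2)]) (use assms(3) a convex_halfspace_ge in auto)
  then show ?thesis using a assms(4) by auto
qed

section \<open>Direction spaces of affine hulls\<close>

definition dirspace :: "'a::euclidean_space set \<Rightarrow> 'a set" where
  "dirspace S = span {x - y |x y. x \<in> S \<and> y \<in> S}"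

lemma subspace_dirspace [simp]: "subspace (dirspace S)"
  by (simp add: dirspace_def)

lemma dirspace_diff: "x \<in> S \<Longrightarrow> y \<in> S \<Longrightarrow> x - y \<in> dirspace S"
  unfolding dirspace_def by (rule span_base) auto

lemma dirspace_mono: "S \<subseteq> T \<Longrightarrow> dirspace S \<subseteq> dirspace T"
  unfolding dirspace_def by (rule span_mono) auto

lemma dirspace_subset:
  assumes "f \<in> S" "subspace W" "\<And>x. x \<in> S \<Longrightarrow> x - f \<in> W"
  shows "dirspace S \<subseteq> W"
  unfolding dirspace_def
proof (rule span_minimal[OF _ assms(2)], clarsimp)
  fix x y assume "x \<in> S" "y \<in> S"
  then show "x - y \<in> W"
    using subspace_diff[OF assms(2) assms(3)[of x] assms(3)[of y]] by simp
qed

lemma dirspace_eq_span: "f \<in> S \<Longrightarrow> dirspace S = span ((\<lambda>x. x - f) ` S)"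
  by (intro subset_antisym dirspace_subset span_minimal)
     (auto intro: span_base dirspace_diff)

lemma aff_dim_dirspace: "f \<in> S \<Longrightarrow> aff_dim S = int (dim (dirspace S))"
  by (metis aff_dim_eq_dim_subtract dim_span dirspace_eq_span hull_inc)

lemma linear_zero_dirspace:
  fixes \<phi> :: "'a::euclidean_space \<Rightarrow> real"
  assumes "linear \<phi>" "\<And>x y. x \<in> S \<Longrightarrow> y \<in> S \<Longrightarrow> \<phi> x = \<phi> y" "u \<in> dirspace S"
  shows "\<phi> u = 0"
proof -
  have "dirspace S \<subseteq> {x. \<phi> x = 0}"
    unfolding dirspace_def
  proof (rule span_minimal)
    show "subspace {x. \<phi> x = 0}" using assms(1) by (rule linear_subspace_kernel)
    show "{x - y |x y. x \<in> S \<and> y \<in> S} \<subseteq> {x. \<phi> x = 0}"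
    proof clarify
      fix x y assume "x \<in> S" "y \<in> S"
      then show "\<phi> (x - y) = 0" using assms(2)[of x y] by (simp add: linear_diff[OF assms(1)])
    qed
  qed
  then show ?thesis using assms(3) by auto
qed

section \<open>Covering faces and the cone of a polytope along a face\<close>

definition covers :: "'a::euclidean_space set \<Rightarrow> 'a set \<Rightarrow> 'a set set" where
  "covers F Q = {G. G face_of Q \<and> F \<subseteq> G \<and> aff_dim G = aff_dim F + 1}"

lemma finite_covers: "polytope Q \<Longrightarrow> finite (covers F Q)"
  using finite_polytope_faces[of Q] by (auto simp: covers_def intro: finite_subset[rotated])

lemma covers_face: "G face_of Q \<Longrightarrow> covers F G = {H \<in> covers F Q. H \<subseteq> G}"
  by (auto simp: covers_def face_of_face)

text \<open>Such a point generates, modulo the directions of \<open>F\<close>, the ray that the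
  cover \<open>G\<close> contributes to the cone of \<open>Q\<close> along \<open>F\<close>; these
  points are the \<open>q G\<close> of the lemmas below.\<close>

lemma covers_nonempty_diff: "G \<in> covers F Q \<Longrightarrow> \<exists>x. x \<in> G - F"
proof (rule ccontr)
  assume G: "G \<in> covers F Q" and "\<nexists>x. x \<in> G - F"
  then have "G = F" by (auto simp: covers_def)
  then show False using G by (simp add: covers_def)
qed

lemma face_eqI:
  assumes "polytope Q" "G face_of Q" "aff_dim Q \<le> aff_dim G"
  shows "G = Q"
  using face_of_aff_dim_lt[OF polytope_imp_convex[OF assms(1)] assms(2)] assms(3) by force

text \<open>\<open>G \<inter> H\<close> is a face of \<open>G\<close> strictly above
  \<open>F\<close>, and no dimension lies strictly between those of \<open>F\<close> and
  \<open>G\<close>. A single point outside \<open>F\<close> therefore decides containment.\<close>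

lemma cover_subset_face:
  assumes Q: "polytope Q" and F: "F face_of Q" and G: "G \<in> covers F Q"
    and H: "H face_of Q" "F \<subseteq> H" and x: "x \<in> G" "x \<in> H" "x \<notin> F"
  shows "G \<subseteq> H"
proof -
  have Gf: "G face_of Q" "F \<subseteq> G" "aff_dim G = aff_dim F + 1" using G by (auto simp: covers_def)
  have poly: "polytope G" "polytope (G \<inter> H)"
    using Gf H(1) Q face_of_Int face_of_polytope_polytope by blast+
  have GH: "(G \<inter> H) face_of G" by (meson face_of_Int Gf(1) H(1) face_of_face Int_lower1)
  have "F face_of (G \<inter> H)"
    using face_of_subset[OF F, of "G \<inter> H"] Gf H face_of_imp_subset by blast
  then have "aff_dim F < aff_dim (G \<inter> H)"
    using face_of_aff_dim_lt[OF polytope_imp_convex[OF poly(2)]] x by blast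
  then have "G \<inter> H = G" using face_eqI[OF poly(1) GH] Gf(3) by auto
  then show ?thesis by auto
qed

lemma exposing_functional:
  fixes Q :: "'a::euclidean_space set"
  assumes "polytope Q" "F face_of Q"
  obtains g :: "'a \<Rightarrow> real" and c where "linear g" "\<And>x. x \<in> F \<Longrightarrow> g x = c"
    "\<And>x. x \<in> Q \<Longrightarrow> x \<notin> F \<Longrightarrow> c < g x"
proof -
  have "F exposed_face_of Q"
    using exposed_face_of_polyhedron assms polytope_imp_polyhedron by blast
  then obtain a b where ab: "Q \<subseteq> {x. a \<bullet> x \<le> b}" "F = Q \<inter> {x. a \<bullet> x = b}"
    by (auto simp: exposed_face_of_def)
  show ?thesis
  proof (rule that[of "\<lambda>x. (-a) \<bullet> x" "-b"])
    show "linear (\<lambda>x. (-a) \<bullet> x)" by (rule linear_inner_right)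
  qed (use ab in force)+
qed

text \<open>Rotating a functional \<phi> that is constant on \<open>F\<close> towards the functional
  \<open>g\<close> exposing \<open>F\<close>, one stops at the least multiple \<open>c\<close> of
  \<open>g\<close> that makes the sum minimal on \<open>F\<close>; there some vertex outside
  \<open>F\<close> joins the minimal face. The multiple may be negative.\<close>

lemma tilt_to_larger_face:
  fixes \<phi> g :: "'a::euclidean_space \<Rightarrow> real"
  assumes Q: "polytope Q" and F: "F face_of Q" "F \<noteq> Q" and f: "f \<in> F"
    and g: "linear g" "\<And>x. x \<in> F \<Longrightarrow> g x = g f" "\<And>x. x \<in> Q \<Longrightarrow> x \<notin> F \<Longrightarrow> g f < g x"
    and \<phi>: "linear \<phi>" "\<And>x. x \<in> F \<Longrightarrow> \<phi> x = \<phi> f"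
  obtains c where "\<And>x. x \<in> Q \<Longrightarrow> \<phi> f \<le> \<phi> x + c * (g x - g f)"
    "\<exists>x\<in>Q - F. \<phi> x + c * (g x - g f) = \<phi> f"
proof -
  let ?V = "vertices Q - F"
  have ne: "?V \<noteq> {}"
  proof
    assume "?V = {}"
    then have "Q \<subseteq> F"
      using polytope_vertices_subsetD[OF Q face_of_imp_convex[OF F(1)]] by auto
    then show False using F face_of_imp_subset by blast
  qed
  have fin: "finite ?V" using finite_vertices[OF Q] by simp
  \<comment> \<open>\<open>?h v\<close> is the least multiple for which the tilted functional does
    not fall below its value on \<open>F\<close> at the vertex \<open>v\<close>; the maximum serves
    all vertices outside \<open>F\<close> and is sharp at one of them.\<close>
  let ?h = "\<lambda>v. (\<phi> f - \<phi> v) / (g v - g f)"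
  define c where "c = Max (?h ` ?V)"
  have cge: "?h v \<le> c" if "v \<in> ?V" for v
    unfolding c_def using fin that by simp
  have "c \<in> ?h ` ?V" unfolding c_def using fin ne by (intro Max_in) auto
  then obtain v0 where v0: "v0 \<in> ?V" "?h v0 = c" by auto
  have pos: "0 < g v - g f" if "v \<in> ?V" for v
    using that g(3) vertices_subset[of Q] by auto
  let ?p = "\<lambda>x. 1 * \<phi> x + c * g x"
  have lin: "linear ?p" by (rule linear_combine[OF \<phi>(1) g(1)])
  show ?thesis
  proof (rule that[of c])
    fix x assume "x \<in> Q"
    have "\<phi> f + c * g f \<le> ?p v" if "v \<in> vertices Q" for v
    proof (cases "v \<in> F")
      case True
      then show ?thesis using g(2) \<phi>(2) by simp
    next
      case False
      then have "v \<in> ?V" using that by simp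
      from cge[OF this] pos[OF this] have "\<phi> f - \<phi> v \<le> c * (g v - g f)"
        by (simp add: pos_divide_le_eq)
      then show ?thesis by (simp add: algebra_simps)
    qed
    from linear_ge_on_polytope[OF lin Q this \<open>x \<in> Q\<close>]
    show "\<phi> f \<le> \<phi> x + c * (g x - g f)" by (simp add: algebra_simps)
  next
    have "\<phi> v0 + c * (g v0 - g f) = \<phi> f"
      using v0(2) pos[OF v0(1)] by (simp add: field_simps)
    then show "\<exists>x\<in>Q - F. \<phi> x + c * (g x - g f) = \<phi> f"
      using v0(1) vertices_subset[of Q] by auto
  qed
qed

text \<open>A smallest face \<open>G\<close> above \<open>F\<close> that jumped by two dimensions
  would leave room for a direction orthogonal to \<open>F\<close> and to one further point
  \<open>p\<close>. Tilting this functional produces a face of \<open>G\<close> strictly above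
  \<open>F\<close>; minimality makes it equal to \<open>G\<close>, so the functional would have to
  be constant on \<open>G\<close>.\<close>

lemma covers_nonempty:
  fixes Q :: "'a::euclidean_space set"
  assumes Q: "polytope Q" and F: "F face_of Q" "F \<noteq> Q" "F \<noteq> {}"
  shows "covers F Q \<noteq> {}"
proof -
  obtain f where f: "f \<in> F" using F by auto
  let ?A = "{G. G face_of Q \<and> F \<subset> G}"
  have finA: "finite ?A" using finite_polytope_faces[OF Q] by (auto intro: finite_subset[rotated])
  have "Q \<in> ?A"
    using F polytope_imp_convex[OF Q] face_of_imp_subset by (auto simp: face_of_refl)
  then have neA: "?A \<noteq> {}" by blast
  define G where "G = arg_min_on aff_dim ?A"
  have "G \<in> ?A" unfolding G_def by (rule arg_min_if_finite(1)[OF finA neA])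
  moreover have "aff_dim G \<le> aff_dim H" if "H \<in> ?A" for H
    unfolding G_def by (rule arg_min_least[OF finA neA that])
  ultimately have G: "G \<in> ?A" "\<And>H. H \<in> ?A \<Longrightarrow> aff_dim G \<le> aff_dim H" by blast+
  have Gf: "G face_of Q" "F \<subset> G" using G by auto
  have Gp: "polytope G" using Gf Q face_of_polytope_polytope by blast
  have FG: "F face_of G" using face_of_subset[OF F(1)] Gf face_of_imp_subset by blast
  have lt: "aff_dim F < aff_dim G"
    using face_of_aff_dim_lt[OF polytope_imp_convex[OF Gp] FG] Gf by blast
  have "\<not> aff_dim F + 1 < aff_dim G"
  proof
    assume big: "aff_dim F + 1 < aff_dim G"
    \<comment> \<open>The extra point \<open>p\<close> kills the multiple \<open>k\<close> at the
      end: the tilted functional is constant on \<open>G\<close>, and \<open>a\<close> does not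
      distinguish \<open>p\<close> from \<open>f\<close>, while \<open>g\<close> does.\<close>
    obtain p where p: "p \<in> G" "p \<notin> F" using Gf by auto
    let ?S = "insert (p - f) (dirspace F)"
    have "dim ?S \<le> dim (dirspace F) + 1" by (simp add: dim_insert)
    then have "dim ?S < dim (dirspace G)"
      using big aff_dim_dirspace[OF f] aff_dim_dirspace[OF p(1)] by linarith
    moreover have "?S \<subseteq> dirspace G"
      using dirspace_mono[of F G] Gf dirspace_diff[of p G f] p f by auto
    ultimately have "span ?S \<noteq> span (dirspace G)" "span ?S \<subseteq> span (dirspace G)"
      by (metis dim_span less_irrefl, simp add: span_mono)
    then have "span ?S \<subset> span (dirspace G)" by blast
    then obtain a where a: "a \<noteq> 0" "a \<in> span (dirspace G)"
      "\<And>y. y \<in> span ?S \<Longrightarrow> orthogonal a y"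
      using orthogonal_to_subspace_exists_gen by blast
    have aG: "a \<in> dirspace G" using a(2) by (metis span_eq_iff subspace_dirspace)
    have aF: "a \<bullet> x = a \<bullet> f" if "x \<in> F" for x
    proof -
      have "x - f \<in> span ?S" using dirspace_diff[OF that f] by (auto intro: span_base)
      from a(3)[OF this] show ?thesis by (simp add: orthogonal_def inner_diff_right)
    qed
    have "orthogonal a (p - f)" using a(3) by (auto intro: span_base)
    then have ap: "a \<bullet> p = a \<bullet> f" by (simp add: orthogonal_def inner_diff_right)
    obtain g :: "'a \<Rightarrow> real" and c where g: "linear g" "\<And>x. x \<in> F \<Longrightarrow> g x = c"
      "\<And>x. x \<in> G \<Longrightarrow> x \<notin> F \<Longrightarrow> c < g x"
      using exposing_functional[OF Gp FG] by blast
    have c: "c = g f" using g(2) f by auto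
    obtain k where k: "\<And>x. x \<in> G \<Longrightarrow> a \<bullet> f \<le> a \<bullet> x + k * (g x - g f)"
      "\<exists>x\<in>G - F. a \<bullet> x + k * (g x - g f) = a \<bullet> f"
      by (rule tilt_to_larger_face[OF Gp FG _ f g(1) _ _ linear_inner_right[of a] aF])
        (use g Gf c in auto)
    let ?p = "\<lambda>x. 1 * (a \<bullet> x) + k * g x"
    let ?H = "G \<inter> {x. ?p x = ?p f}"
    have HG: "?H face_of G"
      by (rule face_of_linear_level[OF linear_combine[OF linear_inner_right g(1)]
            polytope_imp_convex[OF Gp]]) (use k(1) in \<open>auto simp: algebra_simps\<close>)
    have "F \<subseteq> ?H" using Gf aF g(2) c by auto
    moreover have "?H \<noteq> F" using k(2) by (auto simp: algebra_simps)
    ultimately have "?H \<in> ?A" using HG Gf face_of_trans by blast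
    then have "?H = G" using face_eqI[OF Gp HG] G(2) by auto
    then have all: "?p x = ?p f" if "x \<in> G" for x using that by blast
    from all[OF p(1)] ap have "k * (g p - g f) = 0" by (simp add: algebra_simps)
    moreover have "g p - g f > 0" using g(3) p c by auto
    ultimately have "k = 0" by simp
    then have "a \<bullet> x = a \<bullet> y" if "x \<in> G" "y \<in> G" for x y
      using all[OF that(1)] all[OF that(2)] by simp
    then have "a \<bullet> a = 0"
      using linear_zero_dirspace[OF linear_inner_right[of a] _ aG] by blast
    then show False using a(1) by simp
  qed
  then have "G \<in> covers F Q" using lt Gf by (auto simp: covers_def)
  then show ?thesis by auto
qed

text \<open>This is the dual form of the statement that the cone of \<open>Q\<close> along
  \<open>F\<close> is generated by the covers. If \<phi> dropped below its value on
  \<open>F\<close>, a strictly positive multiple of \<open>g\<close> would be needed to restore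
  minimality; the new minimal face contains a cover, at whose point \<open>q G\<close> a nonnegative
  and a positive increment would add up to zero.\<close>

lemma linear_ge_from_covers:
  fixes Q :: "'a::euclidean_space set" and \<phi> :: "'a \<Rightarrow> real"
  assumes Q: "polytope Q" and F: "F face_of Q" and f: "f \<in> F"
    and q: "\<And>G. G \<in> covers F Q \<Longrightarrow> q G \<in> G - F"
    and \<phi>: "linear \<phi>" "\<And>x. x \<in> F \<Longrightarrow> \<phi> x = \<phi> f"
    and \<phi>q: "\<And>G. G \<in> covers F Q \<Longrightarrow> \<phi> f \<le> \<phi> (q G)"
    and x: "x \<in> Q"
  shows "\<phi> f \<le> \<phi> x"
proof (rule ccontr)
  assume neg: "\<not> \<phi> f \<le> \<phi> x"
  then have xF: "x \<notin> F" using \<phi>(2) by force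
  obtain g :: "'a \<Rightarrow> real" and d where g: "linear g" "\<And>x. x \<in> F \<Longrightarrow> g x = d"
    "\<And>x. x \<in> Q \<Longrightarrow> x \<notin> F \<Longrightarrow> d < g x"
    using exposing_functional[OF Q F] by blast
  have d: "d = g f" using g(2) f by auto
  obtain c where c: "\<And>x. x \<in> Q \<Longrightarrow> \<phi> f \<le> \<phi> x + c * (g x - g f)"
    "\<exists>x\<in>Q - F. \<phi> x + c * (g x - g f) = \<phi> f"
    by (rule tilt_to_larger_face[OF Q F _ f g(1) _ _ \<phi>]) (use g d x xF in auto)
  have "c * (g x - g f) > 0" using c(1)[OF x] neg by simp
  then have cpos: "c > 0" using g(3)[OF x xF] d by (simp add: zero_less_mult_iff)
  let ?p = "\<lambda>x. 1 * \<phi> x + c * g x"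
  let ?H = "Q \<inter> {x. ?p x = ?p f}"
  have HQ: "?H face_of Q"
    by (rule face_of_linear_level[OF linear_combine[OF \<phi>(1) g(1)]
          polytope_imp_convex[OF Q]]) (use c(1) in \<open>auto simp: algebra_simps\<close>)
  have FH: "F \<subseteq> ?H" using face_of_imp_subset[OF F] \<phi>(2) g(2) d by auto
  have "F face_of ?H" using face_of_subset[OF F FH] by auto
  moreover have "?H \<noteq> F" using c(2) by (auto simp: algebra_simps)
  ultimately obtain G where G: "G \<in> covers F ?H"
    using covers_nonempty[OF face_of_polytope_polytope[OF Q HQ]] f by blast
  then have GQ: "G \<in> covers F Q" and GH: "G \<subseteq> ?H" using covers_face[OF HQ] by blast+
  from q[OF GQ] GH have qG: "q G \<in> ?H" "q G \<notin> F" by auto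
  have "c * (g (q G) - g f) > 0" using cpos g(3)[of "q G"] qG d by auto
  then show False using qG \<phi>q[OF GQ] by (auto simp: algebra_simps)
qed

text \<open>For a direction \<open>a\<close> of \<open>Q\<close> orthogonal to
  \<open>W \<inter> dirspace Q\<close>, \<open>linear_ge_from_covers\<close> applies to both
  \<open>a\<close> and \<open>-a\<close>, so the functional is constant on \<open>Q\<close> and
  \<open>a = 0\<close>.\<close>

lemma dirspace_subset_covers:
  fixes Q :: "'a::euclidean_space set"
  assumes Q: "polytope Q" and F: "F face_of Q" and f: "f \<in> F"
    and q: "\<And>G. G \<in> covers F Q \<Longrightarrow> q G \<in> G - F"
    and W: "subspace W" "dirspace F \<subseteq> W" "\<And>G. G \<in> covers F Q \<Longrightarrow> q G - f \<in> W"
  shows "dirspace Q \<subseteq> W"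
proof (rule ccontr)
  assume no: "\<not> dirspace Q \<subseteq> W"
  let ?I = "W \<inter> dirspace Q"
  have sI: "span ?I = ?I" "span (dirspace Q) = dirspace Q"
    using W(1) by (simp_all add: subspace_inter)
  have "span ?I \<subset> span (dirspace Q)" unfolding sI using no by auto
  then obtain a where a: "a \<noteq> 0" "a \<in> dirspace Q" "\<And>y. y \<in> ?I \<Longrightarrow> orthogonal a y"
    using orthogonal_to_subspace_exists_gen[of ?I "dirspace Q"] unfolding sI by blast
  have fQ: "f \<in> Q" using f F face_of_imp_subset by blast
  have aF: "a \<bullet> x = a \<bullet> f" if "x \<in> F" for x
  proof -
    have "x - f \<in> ?I" using dirspace_diff[OF that f] W(2) dirspace_mono[OF face_of_imp_subset[OF F]]
      by auto
    from a(3)[OF this] show ?thesis by (simp add: orthogonal_def inner_diff_right)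
  qed
  have aq: "a \<bullet> q G = a \<bullet> f" if "G \<in> covers F Q" for G
  proof -
    have "q G \<in> Q" using q[OF that] that by (auto simp: covers_def dest: face_of_imp_subset)
    then have "q G - f \<in> ?I" using dirspace_diff[of "q G" Q f] W(3)[OF that] fQ by auto
    from a(3)[OF this] show ?thesis by (simp add: orthogonal_def inner_diff_right)
  qed
  have 1: "a \<bullet> f \<le> a \<bullet> x" if "x \<in> Q" for x
    using linear_ge_from_covers[OF Q F f q linear_inner_right aF] aq that by simp
  have 2: "(-a) \<bullet> f \<le> (-a) \<bullet> x" if "x \<in> Q" for x
    using linear_ge_from_covers[OF Q F f q linear_inner_right[of "-a"]] aF aq that by simp
  have "a \<bullet> x = a \<bullet> y" if "x \<in> Q" "y \<in> Q" for x y
    using 1[OF that(1)] 2[OF that(1)] 1[OF that(2)] 2[OF that(2)] by simp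
  then have "a \<bullet> a = 0" using linear_zero_dirspace[OF linear_inner_right[of a] _ a(2)] by blast
  then show False using a(1) by simp
qed

lemma dim_insert_image_le:
  fixes S :: "'a::euclidean_space set"
  assumes "finite A"
  shows "dim (S \<union> h ` A) \<le> dim S + card A"
  using assms
proof (induction A rule: finite_induct)
  case (insert x A)
  have "dim (S \<union> h ` insert x A) \<le> dim (S \<union> h ` A) + 1"
    by (simp add: dim_insert)
  then show ?case using insert by simp
qed auto

text \<open>One point from each cover together with the directions of \<open>F\<close> spans the
  directions of \<open>Q\<close>. Equality in this bound is the numerical form of
  simplicity.\<close>

lemma aff_dim_le_covers:
  fixes Q :: "'a::euclidean_space set"
  assumes Q: "polytope Q" and F: "F face_of Q" "F \<noteq> {}"
  shows "aff_dim Q \<le> aff_dim F + int (card (covers F Q))"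
proof -
  obtain f where f: "f \<in> F" using F by auto
  obtain q where q: "\<And>G. G \<in> covers F Q \<Longrightarrow> q G \<in> G - F"
    using covers_nonempty_diff by metis
  let ?B = "dirspace F \<union> (\<lambda>G. q G - f) ` covers F Q"
  have "dirspace Q \<subseteq> span ?B"
    by (rule dirspace_subset_covers[OF Q F(1) f q]) (auto intro: span_base)
  then have "dim (dirspace Q) \<le> dim ?B" by (metis dim_span dim_subset)
  also have "\<dots> \<le> dim (dirspace F) + card (covers F Q)"
    by (rule dim_insert_image_le[OF finite_covers[OF Q]])
  finally show ?thesis
    using aff_dim_dirspace[OF f] aff_dim_dirspace[of f Q] f face_of_imp_subset[OF F(1)]
    by auto
qed

section \<open>Intervals of the face lattice\<close>

lemma face_interval_subsetI:
  fixes Q :: "'a::euclidean_space set"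
  assumes Q: "polytope Q" and F: "F face_of Q" "F \<noteq> {}"
    and H: "H face_of Q" "F \<subseteq> H" and H': "H' face_of Q" "F \<subseteq> H'"
    and sub: "\<And>G. G \<in> covers F Q \<Longrightarrow> G \<subseteq> H \<Longrightarrow> G \<subseteq> H'"
  shows "H \<subseteq> H'"
proof -
  obtain f where f: "f \<in> F" using F by auto
  have Hp: "polytope H" using H Q face_of_polytope_polytope by blast
  have FH: "F face_of H" using face_of_subset[OF F(1)] H face_of_imp_subset by blast
  have IH: "(H \<inter> H') face_of H" by (meson face_of_Int H(1) H'(1) face_of_face Int_lower1)
  obtain q where q: "\<And>G. G \<in> covers F H \<Longrightarrow> q G \<in> G - F"
    using covers_nonempty_diff by metis
  have sub': "G \<subseteq> H \<inter> H'" if "G \<in> covers F H" for G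
    using that sub by (auto simp: covers_face[OF H(1)])
  \<comment> \<open>The covers of \<open>F\<close> below \<open>H\<close> already span the
    directions of \<open>H\<close>, and all of them lie in \<open>H'\<close>; hence
    \<open>H \<inter> H'\<close> has full dimension in \<open>H\<close>.\<close>
  have "dirspace H \<subseteq> dirspace (H \<inter> H')"
  proof (rule dirspace_subset_covers[OF Hp FH f q])
    show "dirspace F \<subseteq> dirspace (H \<inter> H')" by (rule dirspace_mono) (use H H' in auto)
    show "q G - f \<in> dirspace (H \<inter> H')" if "G \<in> covers F H" for G
      using q[OF that] sub'[OF that] f H H' by (intro dirspace_diff) auto
  qed auto
  then have "aff_dim H \<le> aff_dim (H \<inter> H')"
    using aff_dim_dirspace[of f H] aff_dim_dirspace[of f "H \<inter> H'"] f H(2) H'(2)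
      dim_subset[of "dirspace H" "dirspace (H \<inter> H')"] by (metis IntI of_nat_mono subsetD)
  then show ?thesis using face_eqI[OF Hp IH] by auto
qed

text \<open>With the least possible number of covers, their points \<open>q G\<close> are
  independent modulo the directions of \<open>F\<close>, so each has a dual coordinate that is
  minimal on \<open>F\<close>. Intersecting the faces where chosen coordinates are minimal realizes
  every set of covers by a face, and \<open>face_interval_subsetI\<close> makes this an order
  isomorphism.\<close>

lemma simple_star_if_card_covers:
  fixes Q :: "'a::euclidean_space set"
  assumes Q: "polytope Q" and F: "F face_of Q" "F \<noteq> {}"
    and card: "aff_dim Q = aff_dim F + int (card (covers F Q))"
  shows "simple_star F Q"
proof -
  let ?C = "covers F Q"
  obtain f where f: "f \<in> F" using F by auto
  have fQ: "f \<in> Q" using f F face_of_imp_subset by blast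
  have fin: "finite ?C" by (rule finite_covers[OF Q])
  obtain q where q: "\<And>G. G \<in> ?C \<Longrightarrow> q G \<in> G - F"
    using covers_nonempty_diff by metis
  define I where "I H = {G \<in> ?C. G \<subseteq> H}" for H
  have emb: "H \<subseteq> H' \<longleftrightarrow> I H \<subseteq> I H'" if "H \<in> face_interval F Q" "H' \<in> face_interval F Q" for H H'
  proof
    assume "I H \<subseteq> I H'"
    then show "H \<subseteq> H'"
      using face_interval_subsetI[OF Q F, of H H'] that unfolding I_def face_interval_def by blast
  qed (auto simp: I_def)
  define coord :: "'a set \<Rightarrow> ('a \<Rightarrow> real) \<Rightarrow> bool" where
    "coord G \<mu> \<longleftrightarrow> linear \<mu> \<and> (\<forall>x\<in>F. \<mu> x = \<mu> f) \<and> (\<forall>x\<in>Q. \<mu> f \<le> \<mu> x) \<and>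
      (\<forall>H\<in>?C - {G}. \<mu> (q H) = \<mu> f) \<and> \<mu> f < \<mu> (q G)" for G \<mu>
  have lam: "\<exists>\<mu>. coord G \<mu>" if G: "G \<in> ?C" for G
  proof -
    let ?S = "dirspace F \<union> (\<lambda>G. q G - f) ` (?C - {G})"
    have "dim ?S \<le> dim (dirspace F) + card (?C - {G})"
      by (rule dim_insert_image_le) (use fin in simp)
    also have "\<dots> < dim (dirspace F) + card ?C"
      using G fin card_Diff1_less[of ?C G] by linarith
    also have "\<dots> = dim (dirspace Q)"
      using card aff_dim_dirspace[OF f] aff_dim_dirspace[OF fQ] by auto
    finally have "dim ?S < dim (dirspace Q)" .
    have SQ: "?S \<subseteq> dirspace Q"
      using dirspace_mono[OF face_of_imp_subset[OF F(1)]] q fQ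
      by (auto intro!: dirspace_diff simp: covers_def dest: face_of_imp_subset)
    have "span ?S \<noteq> span (dirspace Q)"
      using \<open>dim ?S < dim (dirspace Q)\<close> by (metis dim_span less_irrefl)
    then have "span ?S \<subset> span (dirspace Q)" using span_mono[OF SQ] by blast
    then obtain a where a: "a \<noteq> 0" "a \<in> dirspace Q" "\<And>y. y \<in> span ?S \<Longrightarrow> orthogonal a y"
      using orthogonal_to_subspace_exists_gen[of ?S "dirspace Q"]
      unfolding iffD2[OF span_eq_iff subspace_dirspace[of Q]] by blast
    have aF: "a \<bullet> x = a \<bullet> f" if "x \<in> F" for x
    proof -
      have "x - f \<in> span ?S" using dirspace_diff[OF that f] by (auto intro: span_base)
      from a(3)[OF this] show ?thesis by (simp add: orthogonal_def inner_diff_right)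
    qed
    have aq: "a \<bullet> q H = a \<bullet> f" if "H \<in> ?C - {G}" for H
    proof -
      have "q H - f \<in> span ?S" using that by (auto intro: span_base)
      from a(3)[OF this] show ?thesis by (simp add: orthogonal_def inner_diff_right)
    qed
    have aqG: "a \<bullet> q G \<noteq> a \<bullet> f"
    proof
      assume eq: "a \<bullet> q G = a \<bullet> f"
      have sub: "dirspace Q \<subseteq> {x. a \<bullet> x = 0}"
      proof (rule dirspace_subset_covers[OF Q F(1) f q])
        show "subspace {x. a \<bullet> x = 0}" by (rule subspace_hyperplane)
        show "dirspace F \<subseteq> {x. a \<bullet> x = 0}"
          using a(3) by (auto simp: orthogonal_def intro: span_base)
        show "q H - f \<in> {x. a \<bullet> x = 0}" if "H \<in> covers F Q" for H
          using eq aq[of H] that by (cases "H = G") (auto simp: inner_diff_right)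
      qed auto
      then show False using a(1,2) by auto
    qed
    \<comment> \<open>\<open>a\<close> separates \<open>q G\<close> from \<open>F\<close>, but on an
      unknown side; the sign is chosen so that the coordinate is minimal on
      \<open>F\<close>.\<close>
    define b where "b = (if a \<bullet> q G > a \<bullet> f then a else -a)"
    have b: "b \<bullet> x = b \<bullet> f" if "x \<in> F" for x using aF[OF that] by (simp add: b_def)
    have bq: "b \<bullet> q H = b \<bullet> f" if "H \<in> ?C - {G}" for H using aq[OF that] by (simp add: b_def)
    have bG: "b \<bullet> f < b \<bullet> q G" using aqG by (auto simp: b_def)
    have "b \<bullet> f \<le> b \<bullet> q H" if "H \<in> ?C" for H
      using bq[of H] bG that by (cases "H = G") auto
    then have "b \<bullet> f \<le> b \<bullet> x" if "x \<in> Q" for x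
      using linear_ge_from_covers[OF Q F(1) f q linear_inner_right b] that by blast
    then show ?thesis
      using linear_inner_right[of b] b bq bG unfolding coord_def
      by (intro exI[of _ "\<lambda>x. b \<bullet> x"]) auto
  qed
  then obtain \<mu> where coord: "\<And>G. G \<in> ?C \<Longrightarrow> coord G (\<mu> G)" by metis
  have \<mu>: "linear (\<mu> G)" "x \<in> F \<Longrightarrow> \<mu> G x = \<mu> G f" "x \<in> Q \<Longrightarrow> \<mu> G f \<le> \<mu> G x"
    "H \<in> ?C - {G} \<Longrightarrow> \<mu> G (q H) = \<mu> G f" "\<mu> G f < \<mu> G (q G)" if "G \<in> ?C" for G H x
    using coord[OF that] by (auto simp: coord_def)
  have surj: "\<exists>H\<in>face_interval F Q. I H = J" if J: "J \<subseteq> ?C" for J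
  proof -
    \<comment> \<open>\<open>Q\<close> is included so that the family is nonempty also when
      \<open>J\<close> is the set of all covers.\<close>
    define H where "H = \<Inter> (insert Q ((\<lambda>G. Q \<inter> {x. \<mu> G x = \<mu> G f}) ` (?C - J)))"
    have HQ: "H face_of Q"
      unfolding H_def
    proof (rule face_of_Inter)
      fix T assume "T \<in> insert Q ((\<lambda>G. Q \<inter> {x. \<mu> G x = \<mu> G f}) ` (?C - J))"
      then show "T face_of Q"
        using \<mu>(1,3) polytope_imp_convex[OF Q]
        by (auto simp: face_of_refl intro!: face_of_linear_level)
    qed auto
    have mem: "x \<in> H \<longleftrightarrow> x \<in> Q \<and> (\<forall>G\<in>?C - J. \<mu> G x = \<mu> G f)" for x
      by (auto simp: H_def)
    have FH: "F \<subseteq> H" using face_of_imp_subset[OF F(1)] \<mu>(2) by (auto simp: mem)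
    have qQ: "q G \<in> Q" if "G \<in> ?C" for G
      using q[OF that] that by (auto simp: covers_def dest: face_of_imp_subset)
    have "G \<subseteq> H \<longleftrightarrow> G \<in> J" if G: "G \<in> ?C" for G
    proof
      assume "G \<in> J"
      then have "q G \<in> H" using \<mu>(4)[of _ G] G qQ[OF G] by (auto simp: mem)
      then show "G \<subseteq> H" using cover_subset_face[OF Q F(1) G HQ FH, of "q G"] q[OF G] by auto
    next
      assume "G \<subseteq> H"
      then have "q G \<in> H" using q[OF G] by auto
      then show "G \<in> J" using \<mu>(5)[OF G] G by (force simp: mem)
    qed
    then have "I H = J" using J by (auto simp: I_def)
    then show ?thesis using HQ FH by (auto simp: face_interval_def)
  qed
  \<comment> \<open>\<open>boolean_poset\<close> asks for subsets of a set of natural numbers, so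
    the covers are numbered.\<close>
  obtain h where h: "bij_betw h ?C {..<card ?C}"
    using ex_bij_betw_finite_nat[OF fin] by (auto simp: atLeast0LessThan)
  define f' where "f' H = h ` I H" for H
  have IC: "I H \<subseteq> ?C" for H by (auto simp: I_def)
  have hsub: "A \<subseteq> B \<longleftrightarrow> h ` A \<subseteq> h ` B" if "A \<subseteq> ?C" "B \<subseteq> ?C" for A B
    using h that by (metis bij_betw_def image_mono inj_on_image_subset_iff)
  have emb': "G \<subseteq> H \<longleftrightarrow> f' G \<subseteq> f' H" if "G \<in> face_interval F Q" "H \<in> face_interval F Q" for G H
    using emb[OF that] hsub[OF IC IC] by (simp add: f'_def)
  have "bij_betw f' (face_interval F Q) (Pow {..<card ?C})"
    unfolding bij_betw_def
  proof
    show "inj_on f' (face_interval F Q)"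
      using emb' by (intro inj_onI subset_antisym) auto
    show "f' ` face_interval F Q = Pow {..<card ?C}"
    proof
      show "f' ` face_interval F Q \<subseteq> Pow {..<card ?C}"
        using h IC by (auto simp: f'_def bij_betw_def)
      show "Pow {..<card ?C} \<subseteq> f' ` face_interval F Q"
      proof
        fix B assume "B \<in> Pow {..<card ?C}"
        then obtain J where J: "J \<subseteq> ?C" "B = h ` J"
          using h by (metis PowD bij_betw_def subset_image_iff)
        from surj[OF J(1)] obtain H where "H \<in> face_interval F Q" "I H = J" by blast
        then show "B \<in> f' ` face_interval F Q" using J(2) by (auto simp: f'_def)
      qed
    qed
  qed
  then show ?thesis
    unfolding simple_star_def boolean_poset_def using emb' by blast
qed

text \<open>The isomorphism \<open>h\<close> turns dimension into cardinality: one dimension up adds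
  exactly one element. Hence the ground set has as many elements as the codimension, and covers of
  \<open>F\<close> correspond to singletons. This bounds their number from above, and
  \<open>aff_dim_le_covers\<close> bounds it from below.\<close>

lemma card_covers_if_simple_star:
  fixes Q :: "'a::euclidean_space set"
  assumes Q: "polytope Q" and F: "F face_of Q" "F \<noteq> {}" and simp: "simple_star F Q"
  shows "aff_dim Q = aff_dim F + int (card (covers F Q))"
proof -
  let ?L = "face_interval F Q"
  obtain A :: "nat set" and h where A: "finite A" and bij: "bij_betw h ?L (Pow A)"
    and ord: "\<And>G H. G \<in> ?L \<Longrightarrow> H \<in> ?L \<Longrightarrow> G \<subseteq> H \<longleftrightarrow> h G \<subseteq> h H"
    using simp by (auto simp: simple_star_def boolean_poset_def)
  have hA: "h G \<subseteq> A" if "G \<in> ?L" for G using bij that by (auto simp: bij_betw_def)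
  have FL: "F \<in> ?L" using F by (auto simp: face_interval_def)
  have QL: "Q \<in> ?L"
    using F face_of_imp_subset polytope_imp_convex[OF Q] by (auto simp: face_interval_def face_of_refl)
  have hF: "h F = {}"
  proof -
    obtain G where G: "G \<in> ?L" "h G = {}" using bij by (metis bij_betw_def empty_subsetI PowI imageE)
    then have "F \<subseteq> G" by (auto simp: face_interval_def)
    then show ?thesis using ord[OF FL G(1)] G(2) by auto
  qed
  have hQ: "h Q = A"
  proof -
    obtain G where G: "G \<in> ?L" "h G = A" using bij by (metis bij_betw_def Pow_top imageE)
    then have "G \<subseteq> Q" by (auto simp: face_interval_def dest: face_of_imp_subset)
    then show ?thesis using ord[OF G(1) QL] G(2) hA[OF QL] by auto
  qed
  have step: "card (h G) = card (h H) + 1" if H: "H \<in> ?L" and G: "G \<in> covers H Q" for G H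
  proof -
    have GL: "G \<in> ?L" and HG: "H \<subseteq> G" "aff_dim G = aff_dim H + 1"
      using H G by (auto simp: face_interval_def covers_def)
    have "\<not> G \<subseteq> H" using aff_dim_subset[of G H] HG by auto
    then have "h H \<subset> h G" using ord[OF H GL] ord[OF GL H] HG by auto
    then obtain x where x: "x \<in> h G" "x \<notin> h H" by auto
    \<comment> \<open>Every subset of \<open>A\<close> is the image of a face, so adding one element
      to \<open>h H\<close> gives a face \<open>M\<close> strictly above \<open>H\<close> and below
      \<open>G\<close>; dimensions leave only \<open>M = G\<close>.\<close>
    have "insert x (h H) \<in> Pow A" using x hA[OF GL] hA[OF H] by auto
    then obtain M where M: "M \<in> ?L" "h M = insert x (h H)" using bij by (metis bij_betw_def imageE)
    have MG: "H \<subseteq> M" "M \<subseteq> G" "\<not> M \<subseteq> H"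
      using ord[OF H M(1)] ord[OF M(1) GL] ord[OF M(1) H] M(2) x \<open>h H \<subset> h G\<close> by auto
    have Gp: "polytope G" and Mp: "polytope M"
      using GL M Q face_of_polytope_polytope by (auto simp: face_interval_def)
    have "M face_of G" using M GL MG by (auto simp: face_interval_def face_of_face)
    moreover have "H face_of M" using M H MG by (auto simp: face_interval_def face_of_face)
    then have "aff_dim H < aff_dim M"
      using face_of_aff_dim_lt[OF polytope_imp_convex[OF Mp]] MG by blast
    ultimately have "M = G" using face_eqI[OF Gp] HG by auto
    then show ?thesis using M(2) x finite_subset[OF hA[OF H] A] by auto
  qed
  have rank: "\<And>H. H \<in> ?L \<Longrightarrow> aff_dim Q = aff_dim H + int n \<Longrightarrow> card A = card (h H) + n" for n
  proof (induction n)
    case 0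
    then have "H = Q" using face_eqI[OF Q, of H] by (auto simp: face_interval_def)
    then show ?case using hQ by simp
  next
    case (Suc n)
    have Hf: "H face_of Q" "F \<subseteq> H" using Suc.prems by (auto simp: face_interval_def)
    have "H \<noteq> Q" "H \<noteq> {}" using Suc.prems(2) Hf F(2) by auto
    then obtain G where G: "G \<in> covers H Q" using covers_nonempty[OF Q Hf(1)] by blast
    then have "G \<in> ?L" "aff_dim Q = aff_dim G + int n"
      using Hf Suc.prems(2) by (auto simp: face_interval_def covers_def)
    from Suc.IH[OF this] step[OF Suc.prems(1) G] show ?case by simp
  qed
  have le: "aff_dim F \<le> aff_dim Q" using F face_of_imp_subset aff_dim_subset by blast
  have cA: "int (card A) = aff_dim Q - aff_dim F"
    using rank[OF FL, of "nat (aff_dim Q - aff_dim F)"] hF le by simp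
  have CL: "covers F Q \<subseteq> ?L" by (auto simp: covers_def face_interval_def)
  have "h ` covers F Q \<subseteq> (\<lambda>x. {x}) ` A"
  proof
    fix B assume "B \<in> h ` covers F Q"
    then obtain G where G: "G \<in> covers F Q" "B = h G" by auto
    then have "card B = 1" using step[OF FL G(1)] hF by simp
    moreover have "B \<subseteq> A" using G CL hA by auto
    ultimately show "B \<in> (\<lambda>x. {x}) ` A" by (auto simp: card_1_singleton_iff)
  qed
  then have "card (h ` covers F Q) \<le> card ((\<lambda>x. {x}) ` A)"
    using A by (intro card_mono) auto
  moreover have "card (h ` covers F Q) = card (covers F Q)"
    using bij CL by (meson bij_betw_def card_image inj_on_subset)
  ultimately have "card (covers F Q) \<le> card A"
    using card_image_le[OF A, of "\<lambda>x. {x}"] by linarith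
  then show ?thesis using cA aff_dim_le_covers[OF Q F] by linarith
qed

lemma simple_star_iff_card_covers:
  fixes Q :: "'a::euclidean_space set"
  assumes "polytope Q" "F face_of Q" "F \<noteq> {}"
  shows "simple_star F Q \<longleftrightarrow> int (card (covers F Q)) = aff_dim Q - aff_dim F"
  using simple_star_if_card_covers[OF assms] card_covers_if_simple_star[OF assms] by auto

section \<open>Polytopes stratified by a linear functional\<close>

lemma edge_segmentD:
  assumes "closed_segment v w edge_of P"
  shows "v \<in> vertices P" "w \<in> vertices P" "v \<noteq> w" "closed_segment v w face_of P"
proof -
  have f: "closed_segment v w face_of P" "aff_dim (closed_segment v w) = 1"
    using assms by (auto simp: edge_of_def)
  show "closed_segment v w face_of P" by (rule f(1))
  have "vertices (closed_segment v w) = {v, w}"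
    by (auto simp: vertices_def extreme_point_of_segment)
  then show "v \<in> vertices P" "w \<in> vertices P" using vertices_face[OF f(1)] by auto
  show "v \<noteq> w" using f(2) by auto
qed

lemma edge_of_face: "F face_of P \<Longrightarrow> e edge_of F \<longleftrightarrow> e edge_of P \<and> e \<subseteq> F"
  by (auto simp: edge_of_def face_of_face)

lemma directed_edge_face:
  assumes "F face_of P"
  shows "directed_edge F l v w \<longleftrightarrow> directed_edge P l v w \<and> v \<in> F \<and> w \<in> F"
proof -
  have "closed_segment v w \<subseteq> F \<longleftrightarrow> v \<in> F \<and> w \<in> F"
    using closed_segment_subset[OF _ _ face_of_imp_convex[OF assms]] by auto
  then show ?thesis by (auto simp: directed_edge_def edge_of_face[OF assms])
qed

text \<open>A one-dimensional face is a segment, and a vertex of the polytope lying in it must be an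
  end. Results on covers thus become results on edges.\<close>

lemma covers_vertex:
  assumes P: "polytope P" and v: "v \<in> vertices P"
  shows "G \<in> covers {v} P \<longleftrightarrow> (\<exists>w. G = closed_segment v w \<and> closed_segment v w edge_of P)"
proof
  assume "G \<in> covers {v} P"
  then have G: "G face_of P" "v \<in> G" "aff_dim G = 1" by (auto simp: covers_def)
  have "polytope G" using G(1) P face_of_polytope_polytope by blast
  then have "compact G" "convex G" by (auto intro: polytope_imp_compact polytope_imp_convex)
  moreover have "collinear G" using G(3) by (simp add: collinear_aff_dim)
  ultimately obtain a b where ab: "G = closed_segment a b"
    using compact_convex_collinear_segment[of G] G(2) by blast
  have "v extreme_point_of G" using v G by (simp add: extreme_point_of_face vertices_def)
  then have "v = a \<or> v = b" unfolding ab by (simp add: extreme_point_of_segment)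
  then show "\<exists>w. G = closed_segment v w \<and> closed_segment v w edge_of P"
    using G ab by (auto simp: edge_of_def closed_segment_commute)
next
  assume "\<exists>w. G = closed_segment v w \<and> closed_segment v w edge_of P"
  then show "G \<in> covers {v} P" by (auto simp: covers_def edge_of_def)
qed

lemma vertex_face: "v \<in> vertices P \<Longrightarrow> {v} face_of P"
  by (simp add: vertices_def face_of_singleton)

lemma vertex_cover_selector:
  assumes P: "polytope P" and v: "v \<in> vertices P"
  obtains q where "\<And>G. G \<in> covers {v} P \<Longrightarrow> q G \<in> G - {v} \<and> closed_segment v (q G) edge_of P"
proof -
  have "\<exists>w. w \<in> G - {v} \<and> closed_segment v w edge_of P" if "G \<in> covers {v} P" for G
    using that edge_segmentD(3) by (force simp: covers_vertex[OF P v])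
  then show ?thesis using that by metis
qed

lemma vertex_linear_ge:
  fixes \<phi> :: "'a::euclidean_space \<Rightarrow> real"
  assumes P: "polytope P" and v: "v \<in> vertices P" and \<phi>: "linear \<phi>"
    and edges: "\<And>w. closed_segment v w edge_of P \<Longrightarrow> \<phi> v \<le> \<phi> w" and x: "x \<in> P"
  shows "\<phi> v \<le> \<phi> x"
proof -
  obtain q where q: "\<And>G. G \<in> covers {v} P \<Longrightarrow> q G \<in> G - {v} \<and> closed_segment v (q G) edge_of P"
    using vertex_cover_selector[OF P v] by blast
  show ?thesis
    by (rule linear_ge_from_covers[OF P vertex_face[OF v] _ _ \<phi>, of v q]) (use q edges x in auto)
qed

text \<open>If the minimum were attained at a second point, the face of minimal points would have an
  edge at \<open>v\<close>, along which \<phi> is constant.\<close>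

lemma vertex_linear_gt:
  fixes \<phi> :: "'a::euclidean_space \<Rightarrow> real"
  assumes P: "polytope P" and v: "v \<in> vertices P" and \<phi>: "linear \<phi>"
    and edges: "\<And>w. closed_segment v w edge_of P \<Longrightarrow> \<phi> v < \<phi> w" and x: "x \<in> P" "x \<noteq> v"
  shows "\<phi> v < \<phi> x"
proof (rule ccontr)
  assume not: "\<not> \<phi> v < \<phi> x"
  have ge: "\<phi> v \<le> \<phi> y" if "y \<in> P" for y
    using vertex_linear_ge[OF P v \<phi> _ that] edges by force
  let ?H = "P \<inter> {y. \<phi> y = \<phi> v}"
  have H: "?H face_of P"
    by (rule face_of_linear_level[OF \<phi> polytope_imp_convex[OF P] ge])
  have Hp: "polytope ?H" using H P face_of_polytope_polytope by blast
  have vH: "v \<in> ?H" using v vertices_subset by auto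
  have vV: "v \<in> vertices ?H" using vertices_face[OF H] v vH by auto
  have "x \<in> ?H" using ge[of x] x not by auto
  then have "?H \<noteq> {v}" using x by auto
  then have "covers {v} ?H \<noteq> {}"
    using covers_nonempty[OF Hp vertex_face[OF vV]] by auto
  then obtain w where "closed_segment v w edge_of ?H" using covers_vertex[OF Hp vV] by auto
  then have "closed_segment v w edge_of P" "w \<in> ?H" by (auto simp: edge_of_face[OF H])
  then show False using edges[of w] by auto
qed

lemma dirspace_subset_edges:
  assumes P: "polytope P" and v: "v \<in> vertices P" and W: "subspace W"
    and edges: "\<And>w. closed_segment v w edge_of P \<Longrightarrow> w - v \<in> W"
  shows "dirspace P \<subseteq> W"
proof -
  obtain q where q: "\<And>G. G \<in> covers {v} P \<Longrightarrow> q G \<in> G - {v} \<and> closed_segment v (q G) edge_of P"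
    using vertex_cover_selector[OF P v] by blast
  have "dirspace {v} \<subseteq> W"
    by (rule dirspace_subset[of v]) (use W in \<open>auto simp: subspace_0\<close>)
  then show ?thesis
    by (intro dirspace_subset_covers[OF P vertex_face[OF v], of v q]) (use q edges W in auto)
qed

text \<open>Addition is injective on \<open>A \<times> B\<close> because the two subspaces meet in
  zero only; a linear left inverse splits a vector into its two parts, and each functional is
  applied to its own part.\<close>

lemma linear_extend_two:
  fixes \<phi> \<psi> :: "'a::euclidean_space \<Rightarrow> real"
  assumes A: "subspace A" "subspace B" "A \<inter> B \<subseteq> {0}" and lin: "linear \<phi>" "linear \<psi>"
  obtains \<theta> where "linear \<theta>" "\<And>x. x \<in> A \<Longrightarrow> \<theta> x = \<phi> x" "\<And>x. x \<in> B \<Longrightarrow> \<theta> x = \<psi> x"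
proof -
  let ?f = "\<lambda>z::'a \<times> 'a. fst z + snd z"
  have f: "linear ?f" by (rule linearI) (auto simp: algebra_simps)
  have sp: "span (A \<times> B) = A \<times> B" using A by (simp add: subspace_Times)
  have "inj_on ?f (span (A \<times> B))"
  proof (rule inj_onI, unfold sp)
    fix x y assume xy: "x \<in> A \<times> B" "y \<in> A \<times> B" "?f x = ?f y"
    have eq: "fst x - fst y = snd y - snd x" using xy(3) by (simp add: algebra_simps)
    have "fst x \<in> A" "fst y \<in> A" "snd x \<in> B" "snd y \<in> B" using xy(1,2) by auto
    then have "fst x - fst y \<in> A" "snd y - snd x \<in> B"
      using subspace_diff[OF A(1)] subspace_diff[OF A(2)] by blast+
    then have "fst x - fst y = 0" using A(3) eq by auto
    then show "x = y" using eq by (simp add: prod_eq_iff)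
  qed
  then obtain g where g: "linear g" "\<And>x. x \<in> A \<times> B \<Longrightarrow> g (?f x) = x"
    using linear_inj_on_left_inverse[OF f, of "A \<times> B"] sp by auto
  show ?thesis
  proof (rule that[of "\<lambda>x. \<phi> (fst (g x)) + \<psi> (snd (g x))"])
    show "linear (\<lambda>x. \<phi> (fst (g x)) + \<psi> (snd (g x)))"
      by (rule linearI) (simp_all add: linear_add[OF g(1)] linear_cmul[OF g(1)]
          linear_add[OF lin(1)] linear_add[OF lin(2)] linear_cmul[OF lin(1)] linear_cmul[OF lin(2)]
          algebra_simps)
    show "\<phi> (fst (g x)) + \<psi> (snd (g x)) = \<phi> x" if "x \<in> A" for x
      using g(2)[of "(x, 0)"] that subspace_0[OF A(2)] linear_0[OF lin(2)] by simp
    show "\<phi> (fst (g x)) + \<psi> (snd (g x)) = \<psi> x" if "x \<in> B" for x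
      using g(2)[of "(0, x)"] that subspace_0[OF A(1)] linear_0[OF lin(1)] by simp
  qed
qed

lemma one_le_aff_dim:
  fixes G :: "'a::euclidean_space set"
  assumes "x \<in> G" "y \<in> G" "x \<noteq> y" shows "1 \<le> aff_dim G"
proof -
  have "aff_dim G \<noteq> 0" using assms by (auto simp: aff_dim_eq_0)
  moreover have "\<not> aff_dim G < 0" using assms by (auto simp: aff_dim_negative_iff)
  ultimately show ?thesis by linarith
qed

section \<open>Generic linear functionals and ascending paths\<close>

definition mono_path :: "'a::euclidean_space set \<Rightarrow> ('a \<Rightarrow> real) \<Rightarrow> nat \<Rightarrow> (nat \<Rightarrow> 'a) \<Rightarrow> bool" where
  "mono_path P l k p \<longleftrightarrow> (\<forall>i<k. directed_edge P l (p i) (p (Suc i)))"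

locale generic_polytope =
  fixes P :: "'a::euclidean_space set" and l :: "'a \<Rightarrow> real"
  assumes polytope: "polytope P" and linear: "linear l"
    and edge_neq: "\<And>v w. closed_segment v w edge_of P \<Longrightarrow> l v \<noteq> l w"
begin

lemma convex: "convex P" by (rule polytope_imp_convex[OF polytope])

lemma directed_edgeD:
  assumes "directed_edge P l v w"
  shows "v \<in> vertices P" "w \<in> vertices P" "l v < l w" "closed_segment v w face_of P"
    "aff_dim (closed_segment v w) = 1"
  using assms edge_segmentD[of v w P] by (auto simp: directed_edge_def edge_of_def)

lemma edge_cases:
  assumes "closed_segment v w edge_of P"
  shows "directed_edge P l v w \<or> directed_edge P l w v"
  using edge_neq[OF assms] assms by (auto simp: directed_edge_def closed_segment_commute)

text \<open>If every edge at \<open>v\<close> descended, \<open>v\<close> would be the strict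
  maximum of \<open>l\<close> on \<open>P\<close> by \<open>vertex_linear_gt\<close>.\<close>

lemma out_edge:
  assumes "v \<in> vertices P" "p \<in> P" "p \<noteq> v" "l v \<le> l p"
  obtains w where "directed_edge P l v w"
proof (rule ccontr)
  assume no: "\<not> thesis"
  have "- l v < - l p"
  proof (rule vertex_linear_gt[OF polytope assms(1) linear_compose_neg[OF linear] _ assms(2,3)])
    fix w assume w: "closed_segment v w edge_of P"
    then show "- l v < - l w" using no that edge_neq[OF w] by (force simp: directed_edge_def)
  qed
  then show False using assms(4) by simp
qed

lemma in_edge:
  assumes "v \<in> vertices P" "p \<in> P" "p \<noteq> v" "l p \<le> l v"
  obtains u where "directed_edge P l u v"
proof (rule ccontr)
  assume no: "\<not> thesis"
  have "l v < l p"
  proof (rule vertex_linear_gt[OF polytope assms(1) linear _ assms(2,3)])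
    fix w assume w: "closed_segment v w edge_of P"
    then show "l v < l w"
      using no that edge_neq[OF w] by (force simp: directed_edge_def closed_segment_commute)
  qed
  then show False using assms(4) by simp
qed

definition top :: "'a \<Rightarrow> bool" where "top m \<longleftrightarrow> m \<in> vertices P \<and> (\<forall>x\<in>P. l x \<le> l m)"
definition bot :: "'a \<Rightarrow> bool" where "bot m \<longleftrightarrow> m \<in> vertices P \<and> (\<forall>x\<in>P. l m \<le> l x)"

lemma vertices_nonempty: "P \<noteq> {} \<Longrightarrow> vertices P \<noteq> {}"
  using polytope_hull_vertices[OF polytope] by force

lemma top_exists: assumes "P \<noteq> {}" obtains m where "top m"
proof -
  have fin: "finite (l ` vertices P)" "l ` vertices P \<noteq> {}"
    using vertices_nonempty[OF assms] finite_vertices[OF polytope] by auto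
  from Max_in[OF this] obtain m where m: "m \<in> vertices P" "Max (l ` vertices P) = l m" by (metis imageE)
  have "- l m \<le> - l x" if "x \<in> P" for x
    by (rule linear_ge_on_polytope[OF linear_compose_neg[OF linear] polytope _ that])
      (use m(2)[symmetric] fin in simp)
  then show ?thesis using that m by (auto simp: top_def)
qed

lemma bot_exists: assumes "P \<noteq> {}" obtains m where "bot m"
proof -
  have fin: "finite (l ` vertices P)" "l ` vertices P \<noteq> {}"
    using vertices_nonempty[OF assms] finite_vertices[OF polytope] by auto
  from Min_in[OF this] obtain m where m: "m \<in> vertices P" "Min (l ` vertices P) = l m" by (metis imageE)
  have "l m \<le> l x" if "x \<in> P" for x
    by (rule linear_ge_on_polytope[OF linear polytope _ that]) (use m(2)[symmetric] fin in simp)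
  then show ?thesis using that m by (auto simp: bot_def)
qed

lemma top_unique: assumes "top m" "x \<in> P" "l m \<le> l x" shows "x = m"
proof (rule ccontr)
  assume "x \<noteq> m"
  then obtain w where "directed_edge P l m w" using out_edge assms by (auto simp: top_def)
  then have "w \<in> P" "l m < l w" using directed_edgeD vertices_subset by blast+
  then show False using assms by (force simp: top_def)
qed

lemma bot_unique: assumes "bot m" "x \<in> P" "l x \<le> l m" shows "x = m"
proof (rule ccontr)
  assume "x \<noteq> m"
  then obtain w where "directed_edge P l w m" using in_edge assms by (auto simp: bot_def)
  then have "w \<in> P" "l w < l m" using directed_edgeD vertices_subset by blast+
  then show False using assms by (force simp: bot_def)
qed

text \<open>Finiteness of the vertex set makes the order by \<open>l\<close> well-founded; the
  number of higher vertices serves as measure.\<close>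

lemma up_induct [consumes 1, case_names up]:
  assumes "v \<in> vertices P"
    and "\<And>v. v \<in> vertices P \<Longrightarrow> (\<And>w. w \<in> vertices P \<Longrightarrow> l v < l w \<Longrightarrow> R w) \<Longrightarrow> R v"
  shows "R v"
  using assms(1)
proof (induction "card {u \<in> vertices P. l v < l u}" arbitrary: v rule: less_induct)
  case less
  show ?case
  proof (rule assms(2)[OF less.prems])
    fix w assume w: "w \<in> vertices P" "l v < l w"
    have "{u \<in> vertices P. l w < l u} \<subset> {u \<in> vertices P. l v < l u}" using w by force
    then have "card {u \<in> vertices P. l w < l u} < card {u \<in> vertices P. l v < l u}"
      using finite_vertices[OF polytope] by (intro psubset_card_mono) auto
    then show "R w" using less.hyps w by blast
  qed
qed

lemma down_induct [consumes 1, case_names down]: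
  assumes "v \<in> vertices P"
    and "\<And>v. v \<in> vertices P \<Longrightarrow> (\<And>w. w \<in> vertices P \<Longrightarrow> l w < l v \<Longrightarrow> R w) \<Longrightarrow> R v"
  shows "R v"
  using assms(1)
proof (induction "card {u \<in> vertices P. l u < l v}" arbitrary: v rule: less_induct)
  case less
  show ?case
  proof (rule assms(2)[OF less.prems])
    fix w assume w: "w \<in> vertices P" "l w < l v"
    have "{u \<in> vertices P. l u < l w} \<subset> {u \<in> vertices P. l u < l v}" using w by force
    then have "card {u \<in> vertices P. l u < l w} < card {u \<in> vertices P. l u < l v}"
      using finite_vertices[OF polytope] by (intro psubset_card_mono) auto
    then show "R w" using less.hyps w by blast
  qed
qed

lemma path_Cons:
  assumes "directed_edge P l v (p 0)" "mono_path P l k p"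
  shows "mono_path P l (Suc k) (case_nat v p)"
  using assms by (auto simp: mono_path_def less_Suc_eq_0_disj)

lemma path_to_top:
  assumes "v \<in> vertices P" "top m"
  shows "\<exists>k p. p 0 = v \<and> p k = m \<and> mono_path P l k p"
  using assms(1)
proof (induction rule: up_induct)
  case (up v)
  show ?case
  proof (cases "v = m")
    case True
    then show ?thesis by (intro exI[of _ 0] exI[of _ "\<lambda>_. v"]) (auto simp: mono_path_def)
  next
    case False
    have "v \<in> P" "m \<in> P" "l v \<le> l m" using assms(2) up(1) vertices_subset by (auto simp: top_def)
    then obtain w where w: "directed_edge P l v w"
      using out_edge[OF up(1), of m] False by blast
    then obtain k p where "p 0 = w" "p k = m" "mono_path P l k p"
      using up(2)[OF directed_edgeD(2,3)[OF w]] by blast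
    then show ?thesis
      using path_Cons[of v p k] w by (intro exI[of _ "Suc k"] exI[of _ "case_nat v p"]) auto
  qed
qed

lemma generic_face: "Q face_of P \<Longrightarrow> generic_polytope Q l"
  using polytope linear edge_neq face_of_polytope_polytope
  by (intro generic_polytope.intro) (auto simp: edge_of_face)

end

text \<open>\<open>Fm\<close> and \<open>Fp\<close> stand for \<open>F\<^sup>-\<close> and \<open>F\<^sup>+\<close>. They are kept as parameters because for a face
  \<open>Q\<close> of \<open>P\<close> the corresponding faces are just the intersections with \<open>Q\<close>, so that every
  statement about \<open>P\<close> is available for all of its faces.\<close>

locale stratified_polytope = generic_polytope +
  fixes Fm Fp :: "'a \<Rightarrow> 'a set"
  assumes Fm_face: "\<And>v. v \<in> vertices P \<Longrightarrow> Fm v face_of P"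
    and Fp_face: "\<And>v. v \<in> vertices P \<Longrightarrow> Fp v face_of P"
    and Fm_self: "\<And>v. v \<in> vertices P \<Longrightarrow> v \<in> Fm v"
    and Fp_self: "\<And>v. v \<in> vertices P \<Longrightarrow> v \<in> Fp v"
    and Fm_le: "\<And>v x. v \<in> vertices P \<Longrightarrow> x \<in> Fm v \<Longrightarrow> l x \<le> l v"
    and Fp_ge: "\<And>v x. v \<in> vertices P \<Longrightarrow> x \<in> Fp v \<Longrightarrow> l v \<le> l x"
    and edge_Fm: "\<And>v w. directed_edge P l v w \<Longrightarrow> v \<in> Fm w"
    and edge_Fp: "\<And>v w. directed_edge P l v w \<Longrightarrow> w \<in> Fp v"
    and Fm_trans: "\<And>u v. u \<in> vertices P \<Longrightarrow> v \<in> vertices P \<Longrightarrow> u \<in> Fm v \<Longrightarrow> Fm u \<subseteq> Fm v"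
begin

section \<open>Order and dimension of the faces at a vertex\<close>

lemma stratified_face:
  assumes Q: "Q face_of P"
  shows "stratified_polytope Q l (\<lambda>v. Fm v \<inter> Q) (\<lambda>v. Fp v \<inter> Q)"
proof -
  interpret Q: generic_polytope Q l by (rule generic_face[OF Q])
  have V: "v \<in> vertices P" "v \<in> Q" if "v \<in> vertices Q" for v
    using that vertices_face[OF Q] by auto
  have face: "(F \<inter> Q) face_of Q" if "F face_of P" for F
    using that Q by (meson face_of_Int face_of_face Int_lower2)
  show ?thesis
  proof unfold_locales
    fix v assume v: "v \<in> vertices Q"
    note vP = V[OF v]
    show "(Fm v \<inter> Q) face_of Q" "(Fp v \<inter> Q) face_of Q" using face Fm_face Fp_face vP by auto
    show "v \<in> Fm v \<inter> Q" "v \<in> Fp v \<inter> Q" using Fm_self Fp_self vP by auto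
    show "l x \<le> l v" if "x \<in> Fm v \<inter> Q" for x using Fm_le vP that by auto
    show "l v \<le> l x" if "x \<in> Fp v \<inter> Q" for x using Fp_ge vP that by auto
    show "Fm u \<inter> Q \<subseteq> Fm v \<inter> Q" if "u \<in> vertices Q" "u \<in> Fm v \<inter> Q" for u
      using Fm_trans[of u v] V[OF that(1)] vP that(2) by auto
  next
    fix v w assume "directed_edge Q l v w"
    then show "v \<in> Fm w \<inter> Q" "w \<in> Fp v \<inter> Q"
      using edge_Fm edge_Fp by (auto simp: directed_edge_face[OF Q])
  qed
qed

lemma vertex_in: "v \<in> vertices P \<Longrightarrow> v \<in> P"
  using vertices_subset by blast

text \<open>The edges at one vertex span all directions, so a face containing them has full
  dimension.\<close>

lemma face_eq_by_edges:
  assumes "G face_of P" "v \<in> vertices P" "v \<in> G" "\<And>w. closed_segment v w edge_of P \<Longrightarrow> w \<in> G"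
  shows "G = P"
proof (rule face_eqI[OF polytope assms(1)])
  have "dirspace P \<subseteq> dirspace G"
    by (rule dirspace_subset_edges[OF polytope assms(2)]) (use assms(3,4) in \<open>auto intro: dirspace_diff\<close>)
  then show "aff_dim P \<le> aff_dim G"
    using aff_dim_dirspace[OF assms(3)] aff_dim_dirspace[OF vertex_in[OF assms(2)]]
      dim_subset[of "dirspace P" "dirspace G"] by linarith
qed

text \<open>Every vertex below the top has an outgoing edge; its upper end lies in
  \<open>Fm m\<close> by induction, and transitivity passes this down the edge.\<close>

lemma Fm_top:
  assumes "top m" shows "Fm m = P"
proof -
  have m: "m \<in> vertices P" using assms by (simp add: top_def)
  have "z \<in> Fm m" if "z \<in> vertices P" for z
    using that
  proof (induction rule: up_induct)
    case (up z)
    show ?case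
    proof (cases "z = m")
      case True
      then show ?thesis using Fm_self m by auto
    next
      case False
      obtain w where w: "directed_edge P l z w"
        by (rule out_edge[OF up(1) vertex_in[OF m]]) (use False assms up(1) vertex_in in \<open>auto simp: top_def\<close>)
      then have "w \<in> Fm m" using up(2) directed_edgeD by blast
      then show ?thesis using Fm_trans[of w m] edge_Fm[OF w] directed_edgeD[OF w] m by blast
    qed
  qed
  then have "P \<subseteq> Fm m"
    using polytope_vertices_subsetD[OF polytope face_of_imp_convex[OF Fm_face[OF m]]] by blast
  then show ?thesis using face_of_imp_subset[OF Fm_face[OF m]] by blast
qed

lemma bot_in_Fm:
  assumes "bot m" "z \<in> vertices P" shows "m \<in> Fm z"
proof -
  have m: "m \<in> vertices P" using assms by (simp add: bot_def)
  show ?thesis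
    using assms(2)
  proof (induction rule: down_induct)
    case (down z)
    show ?case
    proof (cases "z = m")
      case True
      then show ?thesis using Fm_self m by auto
    next
      case False
      obtain w where w: "directed_edge P l w z"
        by (rule in_edge[OF down(1) vertex_in[OF m]]) (use False assms down(1) vertex_in in \<open>auto simp: bot_def\<close>)
      then have "m \<in> Fm w" using down(2) directed_edgeD by blast
      then show ?thesis using Fm_trans[of w z] edge_Fm[OF w] directed_edgeD[OF w] by blast
    qed
  qed
qed

text \<open>The top \<open>y\<close> of \<open>Fp x\<close> is the top of \<open>P\<close>: the face \<open>Fm y\<close> contains \<open>Fp x\<close> and \<open>Fm x\<close>,
  hence all edges at \<open>x\<close>.\<close>

lemma top_in_Fp:
  assumes m: "top m" and x: "x \<in> vertices P"
  shows "m \<in> Fp x"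
proof -
  note Q = Fp_face[OF x]
  interpret Q: stratified_polytope "Fp x" l "\<lambda>v. Fm v \<inter> Fp x" "\<lambda>v. Fp v \<inter> Fp x"
    by (rule stratified_face[OF Q])
  obtain y where y: "Q.top y" using Q.top_exists Fp_self[OF x] by blast
  then have yV: "y \<in> vertices P" "y \<in> Fp x" using vertices_face[OF Q] by (auto simp: Q.top_def)
  have sub: "Fp x \<subseteq> Fm y" using Q.Fm_top[OF y] by auto
  then have xy: "x \<in> Fm y" using Fp_self[OF x] by auto
  have "w \<in> Fm y" if "closed_segment x w edge_of P" for w
    using edge_cases[OF that] edge_Fm edge_Fp sub Fm_trans[OF x yV(1) xy] by blast
  then have "Fm y = P" using face_eq_by_edges[OF Fm_face[OF yV(1)] x xy] by blast
  then have "l m \<le> l y" using Fm_le[OF yV(1)] m vertex_in by (auto simp: top_def)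
  then have "y = m" using top_unique[OF m vertex_in[OF yV(1)]] by blast
  then show ?thesis using yV by simp
qed

text \<open>Each direction is an extremal statement inside a smaller stratified polytope:
  \<open>v\<close> is the top of \<open>Fm v\<close>, so \<open>top_in_Fp\<close> applies there, and
  \<open>u\<close> is the bottom of \<open>Fp u\<close>, so \<open>bot_in_Fm\<close> applies
  there.\<close>

lemma Fm_iff_Fp:
  assumes "u \<in> vertices P" "v \<in> vertices P"
  shows "u \<in> Fm v \<longleftrightarrow> v \<in> Fp u"
proof
  assume u: "u \<in> Fm v"
  note Q = Fm_face[OF assms(2)]
  interpret Q: stratified_polytope "Fm v" l "\<lambda>x. Fm x \<inter> Fm v" "\<lambda>x. Fp x \<inter> Fm v"
    by (rule stratified_face[OF Q])
  have "Q.top v" using assms Fm_self Fm_le vertices_face[OF Q] by (auto simp: Q.top_def)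
  then show "v \<in> Fp u" using Q.top_in_Fp u assms vertices_face[OF Q] by auto
next
  assume v: "v \<in> Fp u"
  note Q = Fp_face[OF assms(1)]
  interpret Q: stratified_polytope "Fp u" l "\<lambda>x. Fm x \<inter> Fp u" "\<lambda>x. Fp x \<inter> Fp u"
    by (rule stratified_face[OF Q])
  have "Q.bot u" using assms Fp_self Fp_ge vertices_face[OF Q] by (auto simp: Q.bot_def)
  then show "u \<in> Fm v" using Q.bot_in_Fm v assms vertices_face[OF Q] by auto
qed

text \<open>Read through \<open>Fm_iff_Fp\<close>, transitivity of \<open>Fm\<close> on vertices is
  transitivity of \<open>Fp\<close>, and a face is the hull of its vertices.\<close>

lemma Fp_trans:
  assumes u: "u \<in> vertices P" and v: "v \<in> vertices P" and "u \<in> Fp v"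
  shows "Fp u \<subseteq> Fp v"
proof (rule polytope_vertices_subsetD)
  show "polytope (Fp u)" using Fp_face[OF u] polytope face_of_polytope_polytope by blast
  show "convex (Fp v)" by (rule face_of_imp_convex[OF Fp_face[OF v]])
  show "vertices (Fp u) \<subseteq> Fp v"
  proof
    fix z assume "z \<in> vertices (Fp u)"
    then have z: "z \<in> vertices P" "z \<in> Fp u" using vertices_face[OF Fp_face[OF u]] by auto
    then have "u \<in> Fm z" "v \<in> Fm u" using Fm_iff_Fp assms by auto
    then show "z \<in> Fp v" using Fm_trans[OF u z(1)] Fm_iff_Fp[OF v z(1)] by blast
  qed
qed

text \<open>All edges at \<open>w\<close> except the one to the top lie in \<open>Fm w\<close>, so
  at most one dimension is lost; the top itself is missing from \<open>Fm w\<close>, so at least one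
  is.\<close>

lemma aff_dim_Fm_coatom:
  assumes m: "top m" and w: "w \<in> vertices P" "w \<noteq> m"
    and out: "\<And>z. directed_edge P l w z \<Longrightarrow> z = m"
  shows "aff_dim (Fm w) = aff_dim P - 1"
proof -
  have mV: "m \<in> vertices P" using m by (simp add: top_def)
  have "dirspace P \<subseteq> span (insert (m - w) (dirspace (Fm w)))"
  proof (rule dirspace_subset_edges[OF polytope w(1)])
    fix z assume "closed_segment w z edge_of P"
    from edge_cases[OF this] show "z - w \<in> span (insert (m - w) (dirspace (Fm w)))"
    proof
      assume "directed_edge P l w z"
      then show ?thesis using out by (auto intro: span_base)
    next
      assume "directed_edge P l z w"
      then show ?thesis using edge_Fm Fm_self[OF w(1)] by (auto intro!: span_base dirspace_diff)
    qed
  qed auto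
  then have "dim (dirspace P) \<le> dim (insert (m - w) (dirspace (Fm w)))"
    by (metis dim_span dim_subset)
  then have "aff_dim P \<le> aff_dim (Fm w) + 1"
    using aff_dim_dirspace[OF vertex_in[OF w(1)]] aff_dim_dirspace[OF Fm_self[OF w(1)]]
    by (simp add: dim_insert split: if_splits)
  moreover have "Fm w \<noteq> P"
    using Fm_le[OF w(1), of m] top_unique[OF m vertex_in[OF w(1)]] w(2) vertex_in[OF mV] by auto
  then have "aff_dim (Fm w) < aff_dim P"
    using face_of_aff_dim_lt[OF convex Fm_face[OF w(1)]] by blast
  ultimately show ?thesis by linarith
qed

end

text \<open>A highest vertex \<open>w\<close> of \<open>Fp v\<close> below the top has no outgoing
  edge except to the top, as such edges stay in \<open>Fp v\<close>. Hence \<open>Fm w\<close> loses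
  exactly one dimension both in \<open>P\<close> and in \<open>Fp v\<close>, and the induction
  continues at \<open>v\<close> inside \<open>Fm w\<close>, which contains all of
  \<open>Fm v\<close>. The lemma stands outside the locale because the induction varies
  \<open>P\<close>, \<open>Fm\<close> and \<open>Fp\<close>.\<close>

lemma aff_dim_additive:
  assumes "stratified_polytope P l Fm Fp" "v \<in> vertices P"
  shows "aff_dim (Fm v) + aff_dim (Fp v) = aff_dim P"
  using assms
proof (induction "nat (aff_dim P)" arbitrary: P Fm Fp v rule: less_induct)
  case less
  interpret stratified_polytope P l Fm Fp by (rule less.prems(1))
  note v = less.prems(2)
  obtain m where m: "top m" using top_exists vertex_in[OF v] by blast
  then have mV: "m \<in> vertices P" by (simp add: top_def)
  show ?case
  proof (cases "v = m")
    case True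
    have "x = v" if "x \<in> Fp v" for x
      using top_unique[OF m _ ] Fp_ge[OF v that] that face_of_imp_subset[OF Fp_face[OF v]] True by blast
    then have "Fp v = {v}" using Fp_self[OF v] by auto
    then show ?thesis using Fm_top[OF m] True by simp
  next
    case False
    let ?A = "vertices P \<inter> Fp v - {m}"
    have "finite ?A" "?A \<noteq> {}" using finite_vertices[OF polytope] v False Fp_self[OF v] by auto
    then have "Max (l ` ?A) \<in> l ` ?A" by (intro Max_in) auto
    then obtain w where w: "w \<in> ?A" "l w = Max (l ` ?A)" by (metis imageE)
    have wmax: "l z \<le> l w" if "z \<in> ?A" for z
      using w(2) that \<open>finite ?A\<close> by simp
    have wV: "w \<in> vertices P" "w \<in> Fp v" "w \<noteq> m" using w by auto
    have out: "z = m" if e: "directed_edge P l w z" for z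
    proof (rule ccontr)
      assume "z \<noteq> m"
      then have "z \<in> ?A" using directed_edgeD[OF e] edge_Fp[OF e] Fp_trans[OF wV(1) v wV(2)] by auto
      then show False using wmax directed_edgeD(3)[OF e] by force
    qed
    have dw: "aff_dim (Fm w) = aff_dim P - 1" by (rule aff_dim_Fm_coatom[OF m wV(1,3) out])
    interpret S: stratified_polytope "Fp v" l "\<lambda>x. Fm x \<inter> Fp v" "\<lambda>x. Fp x \<inter> Fp v"
      by (rule stratified_face[OF Fp_face[OF v]])
    \<comment> \<open>The top of \<open>P\<close> is also the top of \<open>Fp v\<close>, so the
      codimension count repeats there.\<close>
    have "S.top m" using m top_in_Fp[OF m v] vertices_face[OF Fp_face[OF v]]
        face_of_imp_subset[OF Fp_face[OF v]] by (auto simp: S.top_def top_def)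
    then have dS: "aff_dim (Fm w \<inter> Fp v) = aff_dim (Fp v) - 1"
      by (rule S.aff_dim_Fm_coatom)
        (use wV out vertices_face[OF Fp_face[OF v]] in \<open>auto simp: directed_edge_face[OF Fp_face[OF v]]\<close>)
    have vw: "v \<in> Fm w" using Fm_iff_Fp[OF v wV(1)] wV(2) by simp
    have "aff_dim (Fm w) \<ge> 0" using aff_dim_dirspace[OF Fm_self[OF wV(1)]] by simp
    then have "nat (aff_dim (Fm w)) < nat (aff_dim P)" using dw by linarith
    then have "aff_dim (Fm v \<inter> Fm w) + aff_dim (Fp v \<inter> Fm w) = aff_dim (Fm w)"
      by (rule less.hyps[OF _ stratified_face[OF Fm_face[OF wV(1)]]])
        (use v vw vertices_face[OF Fm_face[OF wV(1)]] in auto)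
    moreover have "Fm v \<inter> Fm w = Fm v" using Fm_trans[OF v wV(1) vw] by auto
    ultimately show ?thesis using dw dS by (simp add: Int_commute)
  qed
qed

context stratified_polytope
begin

text \<open>Each edge at \<open>v\<close> has its direction in one of the two spaces, so their sum
  contains all directions of \<open>P\<close>; by \<open>aff_dim_additive\<close> no dimension is
  left for the intersection.\<close>

lemma dirspace_Fm_Fp_disjoint:
  assumes v: "v \<in> vertices P"
  shows "dirspace (Fm v) \<inter> dirspace (Fp v) = {0}"
proof -
  let ?A = "dirspace (Fm v)" and ?B = "dirspace (Fp v)"
  have "dirspace P \<subseteq> {x + y |x y. x \<in> ?A \<and> y \<in> ?B}"
  proof (rule dirspace_subset_edges[OF polytope v subspace_sums])
    fix w assume "closed_segment v w edge_of P"
    from edge_cases[OF this] show "w - v \<in> {x + y |x y. x \<in> ?A \<and> y \<in> ?B}"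
    proof
      assume "directed_edge P l v w"
      then have "w - v \<in> ?B" using edge_Fp Fp_self[OF v] by (auto intro: dirspace_diff)
      then show ?thesis using subspace_0[OF subspace_dirspace[of "Fm v"]] by force
    next
      assume "directed_edge P l w v"
      then have "w - v \<in> ?A" using edge_Fm Fm_self[OF v] by (auto intro: dirspace_diff)
      then show ?thesis using subspace_0[OF subspace_dirspace[of "Fp v"]] by force
    qed
  qed auto
  then have "dim (dirspace P) \<le> dim {x + y |x y. x \<in> ?A \<and> y \<in> ?B}" by (rule dim_subset)
  moreover have "dim {x + y |x y. x \<in> ?A \<and> y \<in> ?B} + dim (?A \<inter> ?B) = dim ?A + dim ?B"
    by (rule dim_sums_Int) auto
  moreover have "dim ?A + dim ?B = dim (dirspace P)"
    using aff_dim_additive[OF stratified_polytope_axioms v] aff_dim_dirspace[OF Fm_self[OF v]]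
      aff_dim_dirspace[OF Fp_self[OF v]] aff_dim_dirspace[OF vertex_in[OF v]] by linarith
  ultimately have "dim (?A \<inter> ?B) = 0" by linarith
  then show ?thesis using subspace_0[OF subspace_dirspace] by (auto simp: dim_eq_0)
qed

lemma linear_ge_Fm_Fp:
  assumes v: "v \<in> vertices P" and \<phi>: "linear \<phi>"
    and "\<And>x. x \<in> Fm v \<Longrightarrow> \<phi> v \<le> \<phi> x" "\<And>x. x \<in> Fp v \<Longrightarrow> \<phi> v \<le> (\<phi> x :: real)" and x: "x \<in> P"
  shows "\<phi> v \<le> \<phi> x"
  by (rule vertex_linear_ge[OF polytope v \<phi> _ x]) (use assms edge_cases edge_Fm edge_Fp in blast)

lemma edge_face_interval:
  assumes e: "directed_edge P l v w"
  shows "closed_segment v w face_of (Fm w \<inter> Fp v)" "(Fm w \<inter> Fp v) face_of P"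
proof -
  note V = directed_edgeD[OF e]
  show I: "(Fm w \<inter> Fp v) face_of P" using Fm_face Fp_face V by (auto intro: face_of_Int)
  have "v \<in> Fm w \<inter> Fp v" "w \<in> Fm w \<inter> Fp v"
    using edge_Fm[OF e] edge_Fp[OF e] Fm_self Fp_self V by auto
  then show "closed_segment v w face_of (Fm w \<inter> Fp v)"
    using V(4) closed_segment_subset[OF _ _ face_of_imp_convex[OF I]] by (auto simp: face_of_face[OF I])
qed

section \<open>Two-dimensional faces above a directed edge\<close>

lemma edge_if_aff_dim_1:
  assumes "G face_of P" "aff_dim G = 1" "v \<in> vertices P" "w \<in> vertices P" "v \<in> G" "w \<in> G" "l v < l w"
  shows "directed_edge P l v w" "G = closed_segment v w"
proof -
  have "G \<in> covers {v} P" using assms by (auto simp: covers_def)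
  then obtain z where z: "G = closed_segment v z" "closed_segment v z edge_of P"
    using covers_vertex[OF polytope assms(3)] by blast
  have "w extreme_point_of G" using assms by (simp add: extreme_point_of_face vertices_def)
  then have "w = z" using assms(7) unfolding z(1) by (auto simp: extreme_point_of_segment)
  then show "directed_edge P l v w" "G = closed_segment v w"
    using z assms(7) by (auto simp: directed_edge_def)
qed

text \<open>Inside \<open>T\<close> the dimensions of \<open>Fm y\<close> and \<open>Fp y\<close>
  add up to 2, and each is at least 1: the first contains \<open>v\<close> and \<open>y\<close>, the
  second \<open>y\<close> and \<open>w\<close>. So both are edges of \<open>T\<close>.\<close>

lemma mid_vertex_of_polygon:
  assumes T: "T face_of P" "aff_dim T = 2" and e: "directed_edge P l v w"
    and vwT: "v \<in> T" "w \<in> T" "T \<subseteq> Fm w" "T \<subseteq> Fp v"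
    and y: "y \<in> vertices T" "y \<noteq> v" "y \<noteq> w"
  shows "Fm y \<inter> T = closed_segment v y" "Fp y \<inter> T = closed_segment y w"
    "directed_edge P l v y" "directed_edge P l y w"
proof -
  interpret T: stratified_polytope T l "\<lambda>x. Fm x \<inter> T" "\<lambda>x. Fp x \<inter> T"
    by (rule stratified_face[OF T(1)])
  note V = directed_edgeD[OF e]
  have yV: "y \<in> vertices P" "y \<in> T" using y(1) vertices_face[OF T(1)] by auto
  have vy: "v \<in> Fm y" "w \<in> Fp y" using Fm_iff_Fp yV vwT V by auto
  have "T.top w" "T.bot v"
    using V vertices_face[OF T(1)] vwT Fm_le[OF V(2)] Fp_ge[OF V(1)]
    by (auto simp: T.top_def T.bot_def)
  then have lt: "l v < l y" "l y < l w"
    using T.top_unique[of w y] T.bot_unique[of v y] yV y(2,3) by force+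
  have "1 \<le> aff_dim (Fm y \<inter> T)" using vy vwT Fm_self yV y(2) by (intro one_le_aff_dim[of v _ y]) auto
  moreover have "1 \<le> aff_dim (Fp y \<inter> T)" using vy vwT Fp_self yV y(3) by (intro one_le_aff_dim[of w _ y]) auto
  ultimately have d: "aff_dim (Fm y \<inter> T) = 1" "aff_dim (Fp y \<inter> T) = 1"
    using aff_dim_additive[OF T.stratified_polytope_axioms y(1)] T(2) by linarith+
  have f: "(Fm y \<inter> T) face_of P" "(Fp y \<inter> T) face_of P"
    using Fm_face Fp_face yV T(1) by (auto intro: face_of_Int)
  show "Fm y \<inter> T = closed_segment v y" "directed_edge P l v y"
    using edge_if_aff_dim_1[OF f(1) d(1) V(1) yV(1)] vy vwT Fm_self yV lt by auto
  show "Fp y \<inter> T = closed_segment y w" "directed_edge P l y w"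
    using edge_if_aff_dim_1[OF f(2) d(2) yV(1) V(2)] vy vwT Fp_self yV lt by auto
qed

text \<open>Every vertex of \<open>T\<close> other than \<open>v\<close> and \<open>w\<close> has
  only these two as neighbours. The functional exposing the segment from \<open>v\<close> to
  \<open>w\<close> is minimal at both, so such a vertex is its strict maximum on \<open>T\<close>,
  and a strict maximum is unique.\<close>

lemma mid_vertex_unique:
  assumes T: "T face_of P" "aff_dim T = 2" and e: "directed_edge P l v w"
    and vwT: "v \<in> T" "w \<in> T" "T \<subseteq> Fm w" "T \<subseteq> Fp v"
    and y: "y \<in> vertices T" "y \<noteq> v" "y \<noteq> w" and y': "y' \<in> vertices T" "y' \<noteq> v" "y' \<noteq> w"
  shows "y = y'"
proof (rule ccontr)
  assume neq: "y \<noteq> y'"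
  interpret T: stratified_polytope T l "\<lambda>x. Fm x \<inter> T" "\<lambda>x. Fp x \<inter> T"
    by (rule stratified_face[OF T(1)])
  note V = directed_edgeD[OF e]
  have sT: "closed_segment v w face_of T"
    using V(4) vwT face_of_imp_convex[OF T(1)] by (simp add: face_of_face[OF T(1)] closed_segment_subset)
  obtain g c where g: "linear g" "\<And>x. x \<in> closed_segment v w \<Longrightarrow> g x = c"
    "\<And>x. x \<in> T \<Longrightarrow> x \<notin> closed_segment v w \<Longrightarrow> c < (g x :: real)"
    using exposing_functional[OF T.polytope sT] by blast
  have *: "g b < g a" if a: "a \<in> vertices T" "a \<noteq> v" "a \<noteq> w"
    and b: "b \<in> vertices T" "a \<noteq> b" for a b
  proof -
    note mid = mid_vertex_of_polygon[OF T e vwT a]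
    have "a \<notin> closed_segment v w"
    proof
      assume "a \<in> closed_segment v w"
      moreover have "a \<in> vertices P" using a vertices_face[OF T(1)] by auto
      ultimately have "a extreme_point_of closed_segment v w"
        using V(4) by (simp add: extreme_point_of_face vertices_def)
      then show False using a by (simp add: extreme_point_of_segment)
    qed
    then have ga: "c < g a" using g(3) a(1) vertices_subset by blast
    have "- g a < - g b"
    proof (rule vertex_linear_gt[OF T.polytope a(1) linear_compose_neg[OF g(1)]])
      fix z assume z: "closed_segment a z edge_of T"
      have zv: "z \<in> vertices T" "z \<noteq> a" using edge_segmentD[OF z] by auto
      from T.edge_cases[OF z] have "z \<in> Fm a \<inter> T \<or> z \<in> Fp a \<inter> T"
        using T.edge_Fm T.edge_Fp by blast
      then have "z = v \<or> z = w"
      proof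
        assume "z \<in> Fm a \<inter> T"
        moreover have "closed_segment v a face_of T"
          using mid(1) T.Fm_face[OF a(1)] by simp
        ultimately have "z extreme_point_of closed_segment v a"
          using zv mid(1) by (simp add: extreme_point_of_face vertices_def)
        then show ?thesis using zv by (auto simp: extreme_point_of_segment)
      next
        assume "z \<in> Fp a \<inter> T"
        moreover have "closed_segment a w face_of T"
          using mid(2) T.Fp_face[OF a(1)] by simp
        ultimately have "z extreme_point_of closed_segment a w"
          using zv mid(2) by (simp add: extreme_point_of_face vertices_def)
        then show ?thesis using zv by (auto simp: extreme_point_of_segment)
      qed
      then have "g z = c" using g(2) by auto
      then show "- g a < - g z" using ga by simp
    qed (use b vertices_subset in auto)
    then show ?thesis by simp
  qed
  show False using *[OF y y'(1) neq] *[OF y' y(1)] neq by auto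
qed

text \<open>A cover of the edge inside this intersection is no segment, so it has a vertex besides
  \<open>v\<close> and \<open>w\<close>; the two preceding lemmas show that there is only one and
  that it is joined to both.\<close>

lemma monotone_triangles_eq_covers:
  assumes e: "directed_edge P l v w"
  shows "monotone_triangles P l v w = covers (closed_segment v w) (Fm w \<inter> Fp v)"
proof -
  note V = directed_edgeD[OF e]
  let ?I = "Fm w \<inter> Fp v" and ?s = "closed_segment v w"
  note I = edge_face_interval[OF e]
  have vwI: "v \<in> ?I" "w \<in> ?I"
    using edge_Fm[OF e] edge_Fp[OF e] Fm_self Fp_self V by auto
  show ?thesis
  proof (intro subset_antisym subsetI)
    fix T assume "T \<in> monotone_triangles P l v w"
    then obtain x where T: "T face_of P" "aff_dim T = 2" "vertices T = {v, w, x}"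
      "directed_edge P l v x" "directed_edge P l x w"
      by (auto simp: monotone_triangles_def vertices_def)
    have Tp: "polytope T" using T(1) polytope face_of_polytope_polytope by blast
    have "x \<in> ?I" using edge_Fm[OF T(5)] edge_Fp[OF T(4)] by auto
    then have "T \<subseteq> ?I"
      by (intro polytope_vertices_subsetD[OF Tp face_of_imp_convex[OF I(2)]]) (use T vwI in auto)
    moreover have "?s \<subseteq> T"
      using T(3) vertices_subset[of T] polytope_imp_convex[OF Tp] by (intro closed_segment_subset) auto
    ultimately show "T \<in> covers ?s ?I"
      using T V(5) by (auto simp: covers_def face_of_face[OF I(2)])
  next
    fix T assume "T \<in> covers ?s ?I"
    then have T: "T face_of P" "T \<subseteq> ?I" "aff_dim T = 2" "?s \<subseteq> T"
      using V(5) by (auto simp: covers_def face_of_face[OF I(2)])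
    have Tp: "polytope T" using T(1) polytope face_of_polytope_polytope by blast
    have vwT: "v \<in> T" "w \<in> T" "T \<subseteq> Fm w" "T \<subseteq> Fp v" using T by auto
    have VT: "v \<in> vertices T" "w \<in> vertices T" using V vwT vertices_face[OF T(1)] by auto
    have "\<not> vertices T \<subseteq> {v, w}"
    proof
      assume "vertices T \<subseteq> {v, w}"
      then have "T \<subseteq> ?s"
        by (intro polytope_vertices_subsetD[OF Tp convex_closed_segment]) auto
      then show False using aff_dim_subset[of T ?s] T(3) V(5) by simp
    qed
    then obtain y where y: "y \<in> vertices T" "y \<noteq> v" "y \<noteq> w" by auto
    note mid = mid_vertex_of_polygon[OF T(1,3) e vwT y]
    have "z \<in> {v, w, y}" if "z \<in> vertices T" for z
      using mid_vertex_unique[OF T(1,3) e vwT y that] by blast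
    then have "vertices T = {v, w, y}" using VT y by blast
    then show "T \<in> monotone_triangles P l v w"
      using T mid(3,4) unfolding monotone_triangles_def vertices_def by blast
  qed
qed

end

section \<open>Monotone paths\<close>

context stratified_polytope
begin

lemma mono_pathD:
  assumes "mono_path P l k p" "i < k"
  shows "directed_edge P l (p i) (p (Suc i))" "p i \<in> vertices P" "p (Suc i) \<in> vertices P"
    "l (p i) < l (p (Suc i))"
proof -
  show e: "directed_edge P l (p i) (p (Suc i))" using assms by (simp add: mono_path_def)
  show "p i \<in> vertices P" "p (Suc i) \<in> vertices P" "l (p i) < l (p (Suc i))"
    using directed_edgeD(1-3)[OF e] .
qed

lemma path_le:
  assumes "mono_path P l k p" "i \<le> j" "j \<le> k" "p k \<in> vertices P"
  shows "p i \<in> vertices P" "p j \<in> vertices P" "Fm (p i) \<subseteq> Fm (p j)"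
proof -
  have V: "p i \<in> vertices P" if "i \<le> k" for i
    using that assms(4) mono_pathD(2)[OF assms(1), of i] by (cases "i = k") auto
  show "p i \<in> vertices P" "p j \<in> vertices P" using V assms by auto
  show "Fm (p i) \<subseteq> Fm (p j)"
    using assms(2,3)
  proof (induction j rule: dec_induct)
    case (step n)
    then have "n < k" by simp
    have "Fm (p n) \<subseteq> Fm (p (Suc n))"
      using Fm_trans[OF _ _ edge_Fm[OF mono_pathD(1)[OF assms(1) \<open>n < k\<close>]]]
        mono_pathD(2,3)[OF assms(1) \<open>n < k\<close>] by blast
    then show ?case using step by auto
  qed simp
qed

lemma Fm_bot: assumes "bot m" shows "Fm m = {m}"
proof -
  have m: "m \<in> vertices P" using assms by (simp add: bot_def)
  have "x = m" if "x \<in> Fm m" for x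
    using bot_unique[OF assms _ Fm_le[OF m that]] that face_of_imp_subset[OF Fm_face[OF m]] by blast
  then show ?thesis using Fm_self[OF m] by auto
qed

text \<open>Additivity at \<open>p m\<close> inside \<open>Fm (p (Suc m))\<close> makes the sum
  telescope, starting from the single point \<open>Fm (p 0)\<close>. If the path ends at the top,
  the total is the dimension of \<open>P\<close>.\<close>

lemma sum_aff_dim_path:
  assumes p: "mono_path P l k p" "bot (p 0)" and m: "m \<le> k"
  shows "(\<Sum>i<m. aff_dim (Fm (p (Suc i)) \<inter> Fp (p i))) = aff_dim (Fm (p m))"
  using m
proof (induction m)
  case 0
  then show ?case using Fm_bot[OF p(2)] by simp
next
  case (Suc m)
  note e = mono_pathD[OF p(1), of m]
  have m: "m < k" using Suc.prems by simp
  note Q = Fm_face[OF e(3)[OF m]]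
  have v: "p m \<in> vertices (Fm (p (Suc m)))"
    using vertices_face[OF Q] e(2)[OF m] edge_Fm[OF e(1)[OF m]] by auto
  have "aff_dim (Fm (p m) \<inter> Fm (p (Suc m))) + aff_dim (Fp (p m) \<inter> Fm (p (Suc m)))
      = aff_dim (Fm (p (Suc m)))"
    by (rule aff_dim_additive[OF stratified_face[OF Q] v])
  moreover have "Fm (p m) \<inter> Fm (p (Suc m)) = Fm (p m)"
    using Fm_trans[OF e(2)[OF m] e(3)[OF m] edge_Fm[OF e(1)[OF m]]] by auto
  ultimately show ?case using Suc m by (simp add: Int_commute)
qed

lemma simple_star_if_edges_simple:
  assumes F: "F face_of P" and v: "bot v" "v \<in> F" and w: "top w" "w \<in> F"
    and simp: "\<And>a b. directed_edge P l a b \<Longrightarrow> simple_star (closed_segment a b) (Fm b \<inter> Fp a)"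
  shows "simple_star F P"
proof -
  interpret F: stratified_polytope F l "\<lambda>x. Fm x \<inter> F" "\<lambda>x. Fp x \<inter> F"
    by (rule stratified_face[OF F])
  have vF: "v \<in> vertices F" and wF: "F.top w" using v w vertices_face[OF F] face_of_imp_subset[OF F]
    by (auto simp: F.top_def top_def bot_def)
  obtain k p where p: "p 0 = v" "p k = w" "mono_path F l k p"
    using F.path_to_top[OF vF wF] by blast
  have edge: "directed_edge P l (p i) (p (Suc i))" "p i \<in> F" "p (Suc i) \<in> F" if "i < k" for i
    using p(3) that by (auto simp: mono_path_def directed_edge_face[OF F])
  have pP: "mono_path P l k p" using edge by (auto simp: mono_path_def)
  define J where "J i = Fm (p (Suc i)) \<inter> Fp (p i)" for i
  define e where "e i = closed_segment (p i) (p (Suc i))" for i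
  define new where "new i = {T \<in> covers (e i) (J i). \<not> T \<subseteq> F}" for i
  have J: "e i face_of J i" "J i face_of P" if "i < k" for i
    unfolding e_def J_def by (rule edge_face_interval[OF edge(1)[OF that]])+
  have Jp: "polytope (J i)" if "i < k" for i
    using J(2)[OF that] polytope face_of_polytope_polytope by blast
  have ne: "e i \<noteq> {}" "aff_dim (e i) = 1" if "i < k" for i
    using directed_edgeD(5)[OF edge(1)[OF that]] by (auto simp: e_def)
  have inF: "(J i \<inter> G) face_of J i" "e i \<subseteq> J i \<inter> G" if "i < k" "G face_of P" "F \<subseteq> G" for i G
  proof -
    show "(J i \<inter> G) face_of J i"
      using J(2)[OF that(1)] that(2) by (meson face_of_Int face_of_face Int_lower1)
    have "e i \<subseteq> G" unfolding e_def
      using edge[OF that(1)] that(3) by (intro closed_segment_subset face_of_imp_convex[OF that(2)]) auto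
    then show "e i \<subseteq> J i \<inter> G" using face_of_imp_subset[OF J(1)[OF that(1)]] by auto
  qed
  \<comment> \<open>The path lies in \<open>F\<close> and hence in \<open>G\<close>, and the faces
    \<open>J i \<inter> G\<close> play for it in \<open>G\<close> the role of the \<open>J i\<close>
    in \<open>P\<close>; so the telescoping sum is available for every face above
    \<open>F\<close>.\<close>
  have dims: "(\<Sum>i<k. aff_dim (J i \<inter> G)) = aff_dim G" if G: "G face_of P" "F \<subseteq> G" for G
  proof -
    interpret G: stratified_polytope G l "\<lambda>x. Fm x \<inter> G" "\<lambda>x. Fp x \<inter> G"
      by (rule stratified_face[OF G(1)])
    have "mono_path G l k p" using edge G(2) by (auto simp: mono_path_def directed_edge_face[OF G(1)])
    moreover have "G.bot (p 0)" "G.top (p k)"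
      using p(1,2) v w G vertices_face[OF G(1)] face_of_imp_subset[OF G(1)]
      by (auto simp: G.bot_def G.top_def bot_def top_def)
    ultimately have "(\<Sum>i<k. aff_dim ((Fm (p (Suc i)) \<inter> G) \<inter> (Fp (p i) \<inter> G))) = aff_dim G"
      using G.sum_aff_dim_path[of k p k] G.Fm_top[of "p k"] by simp
    moreover have "(Fm (p (Suc i)) \<inter> G) \<inter> (Fp (p i) \<inter> G) = J i \<inter> G" for i
      by (auto simp: J_def)
    ultimately show ?thesis by simp
  qed
  have FP: "F \<subseteq> P" by (rule face_of_imp_subset[OF F])
  have ex: "\<exists>c. c \<in> (SIGMA i:{..<k}. new i) \<and> snd c \<subseteq> G" if G: "G \<in> covers F P" for G
  proof -
    have Gf: "G face_of P" "F \<subseteq> G" "aff_dim G = aff_dim F + 1" using G by (auto simp: covers_def)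
    \<comment> \<open>The dimensions add up to a larger total for \<open>G\<close> than for
      \<open>F\<close>, so they grow for at least one \<open>i\<close>, and there some cover of
      \<open>e i\<close> lies in \<open>G\<close> but not in \<open>F\<close>.\<close>
    have "\<not> (\<forall>i<k. aff_dim (J i \<inter> G) \<le> aff_dim (J i \<inter> F))"
    proof
      assume "\<forall>i<k. aff_dim (J i \<inter> G) \<le> aff_dim (J i \<inter> F)"
      then have "(\<Sum>i<k. aff_dim (J i \<inter> G)) \<le> (\<Sum>i<k. aff_dim (J i \<inter> F))"
        by (intro sum_mono) auto
      then show False using dims[OF Gf(1,2)] dims[OF F] Gf(3) by simp
    qed
    then obtain i where i: "i < k" "\<not> aff_dim (J i \<inter> G) \<le> aff_dim (J i \<inter> F)" by auto
    have "\<exists>T\<in>covers (e i) (J i). T \<subseteq> J i \<inter> G \<and> \<not> T \<subseteq> J i \<inter> F"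
    proof (rule ccontr)
      assume "\<not> ?thesis"
      then have "J i \<inter> G \<subseteq> J i \<inter> F"
        using face_interval_subsetI[OF Jp[OF i(1)] J(1)[OF i(1)] ne(1)[OF i(1)]
            inF[OF i(1) Gf(1,2)] inF[OF i(1) F subset_refl]] by blast
      then show False using i(2) aff_dim_subset by blast
    qed
    then show ?thesis using i(1) unfolding new_def by force
  qed
  then obtain c where c: "\<And>G. G \<in> covers F P \<Longrightarrow> c G \<in> (SIGMA i:{..<k}. new i)"
    "\<And>G. G \<in> covers F P \<Longrightarrow> snd (c G) \<subseteq> G" by metis
  have fin: "finite (new i)" if "i < k" for i
    using finite_covers[OF Jp[OF that]] by (simp add: new_def)
  \<comment> \<open>The assigned two-face leaves \<open>F\<close>, so it determines the cover of
    \<open>F\<close> containing it.\<close>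
  have sub: "G \<subseteq> G'" if G: "G \<in> covers F P" "G' \<in> covers F P" "c G = c G'" for G G'
  proof -
    from c(1)[OF G(1)] have "\<not> snd (c G) \<subseteq> F" by (auto simp: new_def)
    then obtain x where "x \<in> snd (c G)" "x \<notin> F" by auto
    then show ?thesis
      using cover_subset_face[OF polytope F G(1), of G' x] c(2)[OF G(1)] c(2)[OF G(2)] G(2,3)
      by (auto simp: covers_def)
  qed
  have "inj_on c (covers F P)"
  proof (rule inj_onI)
    fix G G' assume "G \<in> covers F P" "G' \<in> covers F P" "c G = c G'"
    then show "G = G'" using sub[of G G'] sub[of G' G] by simp
  qed
  moreover have "c ` covers F P \<subseteq> (SIGMA i:{..<k}. new i)" using c(1) by blast
  ultimately have "card (covers F P) \<le> card (SIGMA i:{..<k}. new i)"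
    using fin by (intro card_inj_on_le) auto
  also have "\<dots> = (\<Sum>i<k. card (new i))" using fin by (intro card_SigmaI) auto
  finally have "int (card (covers F P)) \<le> (\<Sum>i<k. int (card (new i)))"
    by (metis of_nat_mono of_nat_sum)
  \<comment> \<open>Simplicity fixes the number of covers of \<open>e i\<close> in
    \<open>J i\<close>; at least \<open>aff_dim (J i \<inter> F) - 1\<close> of them lie in
    \<open>F\<close>, and the rest are the new ones.\<close>
  also have "\<dots> \<le> (\<Sum>i<k. aff_dim (J i \<inter> P) - aff_dim (J i \<inter> F))"
  proof (intro sum_mono)
    fix i assume "i \<in> {..<k}"
    then have i: "i < k" by simp
    have JF: "polytope (J i \<inter> F)" using inF(1)[OF i F subset_refl] Jp[OF i] face_of_polytope_polytope by blast
    have "e i face_of (J i \<inter> F)"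
      using face_of_subset[OF J(1)[OF i] inF(2)[OF i F subset_refl]] by auto
    from aff_dim_le_covers[OF JF this ne(1)[OF i]]
    have 1: "aff_dim (J i \<inter> F) \<le> 1 + int (card (covers (e i) (J i \<inter> F)))" using ne(2)[OF i] by simp
    have "simple_star (e i) (J i)" using simp[OF edge(1)[OF i]] by (simp add: e_def J_def)
    then have 2: "int (card (covers (e i) (J i))) = aff_dim (J i) - 1"
      using simple_star_iff_card_covers[OF Jp[OF i] J(1)[OF i] ne(1)[OF i]] ne(2)[OF i] by simp
    have "covers (e i) (J i) = new i \<union> covers (e i) (J i \<inter> F)"
      unfolding covers_face[OF inF(1)[OF i F subset_refl]] new_def
      by (auto simp: covers_def dest: face_of_imp_subset)
    moreover have "new i \<inter> covers (e i) (J i \<inter> F) = {}"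
      unfolding covers_face[OF inF(1)[OF i F subset_refl]] new_def by auto
    ultimately have "card (covers (e i) (J i)) = card (new i) + card (covers (e i) (J i \<inter> F))"
      using finite_covers[OF JF] fin[OF i] by (simp add: card_Un_disjoint)
    moreover have "J i \<inter> P = J i" using face_of_imp_subset[OF J(2)[OF i]] by auto
    ultimately show "int (card (new i)) \<le> aff_dim (J i \<inter> P) - aff_dim (J i \<inter> F)"
      using 1 2 by simp
  qed
  also have "\<dots> = aff_dim P - aff_dim F"
    using dims[OF face_of_refl[OF convex] FP] dims[OF F] by (simp add: sum_subtractf)
  finally have "int (card (covers F P)) \<le> aff_dim P - aff_dim F" .
  moreover have "F \<noteq> {}" using v by auto
  ultimately show ?thesis
    using aff_dim_le_covers[OF polytope F] simple_star_iff_card_covers[OF polytope F] by simp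
qed

text \<open>The first \<open>m\<close> of these faces lie in \<open>Fm (p m)\<close>, the next one
  in \<open>Fp (p m)\<close>, and these two have no common direction. Hence a functional can be
  prescribed on one after the other.\<close>

lemma path_extension:
  assumes p: "mono_path P l k p" "p k \<in> vertices P" and \<psi>: "\<And>i. linear (\<psi> i)" and m: "m \<le> k"
  shows "\<exists>\<theta>::'a \<Rightarrow> real. linear \<theta> \<and>
    (\<forall>i<m. \<forall>x\<in>dirspace (Fm (p (Suc i)) \<inter> Fp (p i)). \<theta> x = \<psi> i x)"
  using m
proof (induction m)
  case 0
  then show ?case using \<psi> by auto
next
  case (Suc m)
  then obtain \<theta> :: "'a \<Rightarrow> real" where \<theta>: "linear \<theta>"
    "\<And>i x. i < m \<Longrightarrow> x \<in> dirspace (Fm (p (Suc i)) \<inter> Fp (p i)) \<Longrightarrow> \<theta> x = \<psi> i x"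
    by (meson Suc_leD)
  have m: "m < k" using Suc.prems by simp
  have "dirspace (Fm (p m)) \<inter> dirspace (Fp (p m)) \<subseteq> {0}"
    using dirspace_Fm_Fp_disjoint[OF mono_pathD(2)[OF p(1) m]] by simp
  then obtain \<theta>' where \<theta>': "linear \<theta>'" "\<And>x. x \<in> dirspace (Fm (p m)) \<Longrightarrow> \<theta>' x = \<theta> x"
    "\<And>x. x \<in> dirspace (Fp (p m)) \<Longrightarrow> \<theta>' x = \<psi> m x"
    using linear_extend_two[OF subspace_dirspace subspace_dirspace _ \<theta>(1) \<psi>[of m]] by blast
  have "\<theta>' x = \<psi> i x" if "i < Suc m" and x: "x \<in> dirspace (Fm (p (Suc i)) \<inter> Fp (p i))" for i x
  proof (cases "i = m")
    case True
    then show ?thesis using x \<theta>'(3) dirspace_mono[of "Fm (p (Suc m)) \<inter> Fp (p m)" "Fp (p m)"] by auto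
  next
    case False
    then have "i < m" using that by simp
    then have "Fm (p (Suc i)) \<subseteq> Fm (p m)" using path_le(3)[OF p(1) _ _ p(2), of "Suc i" m] m by simp
    then have "x \<in> dirspace (Fm (p m))"
      using x dirspace_mono[of "Fm (p (Suc i)) \<inter> Fp (p i)" "Fm (p m)"] by blast
    then show ?thesis using \<theta>'(2) \<theta>(2)[OF \<open>i < m\<close> x] by simp
  qed
  then show ?case using \<theta>'(1) by blast
qed

text \<open>Local convexity along a path suffices: the conditions below only involve consecutive edges
  and the faces \<open>Fm (p (Suc i)) \<inter> Fp (p i)\<close>, because \<open>P\<close> is near each vertex \<open>v\<close> the sum of the
  cones of \<open>Fm v\<close> and \<open>Fp v\<close>.\<close>

lemma path_lower:
  fixes \<psi> :: "'a \<Rightarrow> real" and s :: "nat \<Rightarrow> real"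
  assumes p: "mono_path P l k p" "bot (p 0)" "top (p k)" and \<psi>: "linear \<psi>"
    and slope: "\<And>i. i < k \<Longrightarrow> \<psi> (p (Suc i)) - \<psi> (p i) = s i * (l (p (Suc i)) - l (p i))"
    and mono: "\<And>i. Suc i < k \<Longrightarrow> s i \<le> s (Suc i)"
    and loc: "\<And>i x. i < k \<Longrightarrow> x \<in> Fm (p (Suc i)) \<inter> Fp (p i) \<Longrightarrow>
      \<psi> (p i) - s i * l (p i) \<le> \<psi> x - s i * l x"
    and i: "i < k" and x: "x \<in> P"
  shows "\<psi> (p i) - s i * l (p i) \<le> \<psi> x - s i * l x"
proof -
  have eq: "\<psi> (p (Suc i)) - s i * l (p (Suc i)) = \<psi> (p i) - s i * l (p i)" if "i < k" for i
    using slope[OF that] by (simp add: algebra_simps)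
  have lin: "linear (\<lambda>x. 1 * \<psi> x + (- s i) * l x)" for i
    by (rule linear_combine[OF \<psi> linear])
  \<comment> \<open>Downward from the top: the claim on \<open>Fp (p (Suc i))\<close> with slope
    \<open>s (Suc i)\<close> implies the one with the smaller slope \<open>s i\<close>, because
    \<open>l\<close> is at least \<open>l (p (Suc i))\<close> on that face.\<close>
  have up: "\<psi> (p i) - s i * l (p i) \<le> \<psi> x - s i * l x" if "i < k" "x \<in> Fp (p i)" for i x
    using that
  proof (induction "k - i" arbitrary: i x rule: less_induct)
    case less
    note i = less.prems(1)
    note V = mono_pathD[OF p(1) i]
    note e = edge_Fm[OF V(1)] edge_Fp[OF V(1)]
    show ?case
    proof (cases "Suc i = k")
      case True
      then have "x \<in> Fm (p (Suc i)) \<inter> Fp (p i)"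
        using Fm_top[OF p(3)] less.prems(2) face_of_imp_subset[OF Fp_face[OF V(2)]] by auto
      then show ?thesis using loc[OF i] by blast
    next
      case False
      then have i': "Suc i < k" using i by simp
      note Q = Fp_face[OF V(2)]
      interpret Q: stratified_polytope "Fp (p i)" l "\<lambda>x. Fm x \<inter> Fp (p i)" "\<lambda>x. Fp x \<inter> Fp (p i)"
        by (rule stratified_face[OF Q])
      have v: "p (Suc i) \<in> vertices (Fp (p i))" using vertices_face[OF Q] V e by auto
      have "1 * \<psi> (p (Suc i)) + (- s i) * l (p (Suc i)) \<le> 1 * \<psi> x + (- s i) * l x"
      proof (rule Q.linear_ge_Fm_Fp[OF v lin _ _ less.prems(2)])
        fix y assume "y \<in> Fm (p (Suc i)) \<inter> Fp (p i)"
        from loc[OF i this] show "1 * \<psi> (p (Suc i)) + (- s i) * l (p (Suc i)) \<le> 1 * \<psi> y + (- s i) * l y"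
          using eq[OF i] by simp
      next
        fix y assume y: "y \<in> Fp (p (Suc i)) \<inter> Fp (p i)"
        have "\<psi> (p (Suc i)) - s (Suc i) * l (p (Suc i)) \<le> \<psi> y - s (Suc i) * l y"
          using less.hyps[of "Suc i" y] i' y by auto
        moreover have "(s (Suc i) - s i) * l (p (Suc i)) \<le> (s (Suc i) - s i) * l y"
          using mono[OF i'] Fp_ge[OF V(3), of y] y by (intro mult_left_mono) auto
        ultimately show "1 * \<psi> (p (Suc i)) + (- s i) * l (p (Suc i)) \<le> 1 * \<psi> y + (- s i) * l y"
          by (simp add: algebra_simps)
      qed
      then show ?thesis using eq[OF i] by simp
    qed
  qed
  \<comment> \<open>Upward from the bottom: on \<open>Fm (p (Suc i))\<close> the inequality is
    inherited from the previous edge, on \<open>Fp (p (Suc i))\<close> it is \<open>up\<close>, and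
    these two faces contain all edges at \<open>p (Suc i)\<close>.\<close>
  show ?thesis
    using i x
  proof (induction i arbitrary: x)
    case 0
    have b: "p 0 \<in> vertices P" using p(2) by (simp add: bot_def)
    have "Fm (p 0) = {p 0}" by (rule Fm_bot[OF p(2)])
    then have "1 * \<psi> (p 0) + (- s 0) * l (p 0) \<le> 1 * \<psi> x + (- s 0) * l x"
      using up[OF 0(1)] by (intro linear_ge_Fm_Fp[OF b lin _ _ 0(2)]) auto
    then show ?case by simp
  next
    case (Suc i)
    have i: "i < k" using Suc.prems by simp
    note V = mono_pathD[OF p(1) i]
    have "1 * \<psi> (p (Suc i)) + (- s (Suc i)) * l (p (Suc i)) \<le> 1 * \<psi> x + (- s (Suc i)) * l x"
    proof (rule linear_ge_Fm_Fp[OF V(3) lin _ _ Suc.prems(2)])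
      fix y assume y: "y \<in> Fm (p (Suc i))"
      then have yP: "y \<in> P" using face_of_imp_subset[OF Fm_face[OF V(3)]] by auto
      have "\<psi> (p (Suc i)) - s i * l (p (Suc i)) \<le> \<psi> y - s i * l y"
        using Suc.IH[OF i yP] eq[OF i] by simp
      moreover have "(s (Suc i) - s i) * l y \<le> (s (Suc i) - s i) * l (p (Suc i))"
        using mono[OF Suc.prems(1)] Fm_le[OF V(3) y] by (intro mult_left_mono) auto
      ultimately show "1 * \<psi> (p (Suc i)) + (- s (Suc i)) * l (p (Suc i)) \<le> 1 * \<psi> y + (- s (Suc i)) * l y"
        by (simp add: algebra_simps)
    next
      fix y assume "y \<in> Fp (p (Suc i))"
      from up[OF Suc.prems(1) this]
      show "1 * \<psi> (p (Suc i)) + (- s (Suc i)) * l (p (Suc i)) \<le> 1 * \<psi> y + (- s (Suc i)) * l y" by simp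
    qed
    then show ?case by simp
  qed
qed

text \<open>The part below the edge is an ascending path inside \<open>Fm v\<close>, a face with top
  \<open>v\<close> that contains the bottom of \<open>P\<close>. The edge itself joins it to a path
  from \<open>w\<close>, which explains the shift by \<open>Suc k1\<close>.\<close>

lemma path_through_edge:
  assumes e: "directed_edge P l v w" and "bot a" "top b"
  obtains k p i where "mono_path P l k p" "p 0 = a" "p k = b" "i < k" "p i = v" "p (Suc i) = w"
proof -
  note V = directed_edgeD[OF e]
  note Q = Fm_face[OF V(1)]
  interpret Q: stratified_polytope "Fm v" l "\<lambda>x. Fm x \<inter> Fm v" "\<lambda>x. Fp x \<inter> Fm v"
    by (rule stratified_face[OF Q])
  have "Q.top v" using V(1) Fm_self Fm_le vertices_face[OF Q] by (auto simp: Q.top_def)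
  moreover have "a \<in> vertices (Fm v)"
    using bot_in_Fm[OF assms(2) V(1)] assms(2) vertices_face[OF Q] by (auto simp: bot_def)
  ultimately obtain k1 p1 where p1: "p1 0 = a" "p1 k1 = v" "mono_path (Fm v) l k1 p1"
    using Q.path_to_top by blast
  obtain k2 p2 where p2: "p2 0 = w" "p2 k2 = b" "mono_path P l k2 p2"
    using path_to_top[OF V(2) assms(3)] by blast
  let ?p = "\<lambda>j. if j \<le> k1 then p1 j else p2 (j - Suc k1)"
  have "directed_edge P l (?p i) (?p (Suc i))" if "i < Suc (k1 + k2)" for i
  proof -
    consider "i < k1" | "i = k1" | "i > k1" by linarith
    then show ?thesis
    proof cases
      case 1
      then show ?thesis using p1(3) by (auto simp: mono_path_def directed_edge_face[OF Q])
    next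
      case 2
      then show ?thesis using e p1(2) p2(1) by simp
    next
      case 3
      then have "Suc i - Suc k1 = Suc (i - Suc k1)" "i - Suc k1 < k2" using that by auto
      then show ?thesis using 3 p2(3) by (simp add: mono_path_def)
    qed
  qed
  then show ?thesis
    using p1 p2 by (intro that[of "Suc (k1 + k2)" ?p k1]) (auto simp: mono_path_def)
qed

end

text \<open>Here \<open>dual\<close> says, tested on functionals, that \<open>Q\<close> lies in the
  cone at \<open>z\<close> spanned by the rays, and \<open>prim\<close> that each ray enters
  \<open>Q\<close>; \<open>pointed\<close> makes \<open>z\<close> a vertex and \<open>expo\<close>
  makes each ray an edge direction. The edges at \<open>z\<close> are thus in bijection with the
  rays.\<close>

lemma star_of_vertex_by_rays:
  fixes Q :: "'a::euclidean_space set" and r :: "'i \<Rightarrow> 'a"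
  assumes Q: "polytope Q" and I: "finite I" and z: "z \<in> Q"
    and dual: "\<And>\<psi> q. linear \<psi> \<Longrightarrow> (\<And>i. i \<in> I \<Longrightarrow> 0 \<le> \<psi> (r i)) \<Longrightarrow> q \<in> Q \<Longrightarrow> \<psi> z \<le> (\<psi> q :: real)"
    and prim: "\<And>i. i \<in> I \<Longrightarrow> \<exists>\<epsilon>>0. z + \<epsilon> *\<^sub>R r i \<in> Q"
    and expo: "\<And>i. i \<in> I \<Longrightarrow> \<exists>\<psi>. linear \<psi> \<and> \<psi> (r i) = 0 \<and> (\<forall>j\<in>I - {i}. 0 < (\<psi> (r j) :: real))"
    and pointed: "\<exists>\<psi>. linear \<psi> \<and> (\<forall>i\<in>I. 0 < (\<psi> (r i) :: real))"
  shows "z \<in> vertices Q" "card (covers {z} Q) = card I" "aff_dim Q = int (dim (r ` I))"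
proof -
  \<comment> \<open>A functional that is nonnegative on the rays where \<open>g\<close> vanishes
    becomes nonnegative on all rays after adding a large multiple of \<open>g\<close>; at a point
    with \<open>g q = g z\<close> that multiple cancels.\<close>
  have perturb: "a z \<le> a q"
    if g: "linear g" "\<And>i. i \<in> I \<Longrightarrow> 0 \<le> g (r i)" and a: "linear a"
      "\<And>i. i \<in> I \<Longrightarrow> g (r i) = 0 \<Longrightarrow> 0 \<le> a (r i)" and q: "q \<in> Q" "g q = g z"
    for g a :: "'a \<Rightarrow> real" and q
  proof -
    define N where "N = Max (insert 0 ((\<lambda>i. \<bar>a (r i)\<bar> / g (r i)) ` I))"
    have N: "\<bar>a (r i)\<bar> / g (r i) \<le> N" if "i \<in> I" for i
      unfolding N_def using I that by (intro Max_ge) auto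
    have "0 \<le> N * g (r i) + 1 * a (r i)" if "i \<in> I" for i
    proof (cases "g (r i) = 0")
      case True
      then show ?thesis using a(2)[OF that] by simp
    next
      case False
      then have "\<bar>a (r i)\<bar> \<le> N * g (r i)"
        using N[OF that] g(2)[OF that] by (simp add: pos_divide_le_eq)
      then show ?thesis by simp
    qed
    then have "N * g z + 1 * a z \<le> N * g q + 1 * a q"
      by (rule dual[OF linear_combine[OF g(1) a(1)] _ q(1)])
    then show ?thesis using q(2) by simp
  qed
  have perturb_eq: "a z = a q"
    if g: "linear g" "\<And>i. i \<in> I \<Longrightarrow> 0 \<le> g (r i)" and a: "linear a"
      "\<And>i. i \<in> I \<Longrightarrow> g (r i) = 0 \<Longrightarrow> a (r i) = 0" and q: "q \<in> Q" "g q = g z"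
    for g a :: "'a \<Rightarrow> real" and q
    using perturb[OF g a(1) _ q] perturb[OF g linear_compose_neg[OF a(1)] _ q] a(2) by force
  have only_z: "q = z"
    if g: "linear g" "\<And>i. i \<in> I \<Longrightarrow> 0 < g (r i)" and q: "q \<in> Q" "g q = g z"
    for g :: "'a \<Rightarrow> real" and q
  proof -
    \<comment> \<open>With \<open>g\<close> positive on all rays every linear functional agrees at
      \<open>q\<close> and \<open>z\<close>; the choice \<open>q - z\<close> gives distance
      zero.\<close>
    have "(q - z) \<bullet> z = (q - z) \<bullet> q"
      by (rule perturb_eq[OF g(1) _ linear_inner_right _ q]) (use g(2) in force)+
    then have "(q - z) \<bullet> (q - z) = 0" by (simp add: inner_diff_right)
    then show ?thesis by simp
  qed
  obtain \<psi>0 where \<psi>0: "linear \<psi>0" "\<And>i. i \<in> I \<Longrightarrow> 0 < (\<psi>0 (r i) :: real)" using pointed by blast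
  have r0: "r i \<noteq> 0" if "i \<in> I" for i
    using \<psi>0(2)[OF that] linear_0[OF \<psi>0(1)] by auto
  have "(Q \<inter> {x. \<psi>0 x = \<psi>0 z}) face_of Q"
    by (rule face_of_linear_level[OF \<psi>0(1) polytope_imp_convex[OF Q]])
      (use dual[OF \<psi>0(1)] \<psi>0(2) in \<open>auto intro: less_imp_le\<close>)
  moreover have "Q \<inter> {x. \<psi>0 x = \<psi>0 z} = {z}" using only_z[OF \<psi>0] z by auto
  ultimately have zf: "{z} face_of Q" by simp
  then show "z \<in> vertices Q" by (simp add: vertices_def face_of_singleton)
  have "\<exists>\<psi>. \<forall>i\<in>I. linear (\<psi> i) \<and> \<psi> i (r i) = 0 \<and> (\<forall>j\<in>I - {i}. 0 < (\<psi> i (r j) :: real))"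
    by (rule bchoice) (use expo in blast)
  then obtain \<psi> :: "'i \<Rightarrow> 'a \<Rightarrow> real" where
    "\<forall>i\<in>I. linear (\<psi> i) \<and> \<psi> i (r i) = 0 \<and> (\<forall>j\<in>I - {i}. 0 < \<psi> i (r j))" by (elim exE)
  then have \<psi>: "linear (\<psi> i)" "\<psi> i (r i) = 0" "j \<in> I - {i} \<Longrightarrow> 0 < \<psi> i (r j)" if "i \<in> I" for i j
    using that by auto
  have \<psi>ge: "0 \<le> \<psi> i (r j)" if "i \<in> I" "j \<in> I" for i j
    using \<psi>[OF that(1)] that by (cases "j = i") (auto intro: less_imp_le)
  obtain \<epsilon> where \<epsilon>: "\<And>i. i \<in> I \<Longrightarrow> \<epsilon> i > 0" "\<And>i. i \<in> I \<Longrightarrow> z + \<epsilon> i *\<^sub>R r i \<in> Q" using prim by metis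
  define E where "E i = Q \<inter> {x. \<psi> i x = \<psi> i z}" for i
  have Ef: "E i face_of Q" if "i \<in> I" for i
    unfolding E_def
    by (rule face_of_linear_level[OF \<psi>(1)[OF that] polytope_imp_convex[OF Q]])
      (use dual[OF \<psi>(1)[OF that] \<psi>ge[OF that]] in blast)
  have zE: "z \<in> E i" for i using z by (simp add: E_def)
  have \<psi>pt: "\<psi> i (z + \<epsilon> j *\<^sub>R r j) = \<psi> i z + \<epsilon> j * \<psi> i (r j)" if "i \<in> I" for i j
    using \<psi>(1)[OF that] by (simp add: linear_add linear_cmul)
  have ptE: "z + \<epsilon> j *\<^sub>R r j \<in> E i \<longleftrightarrow> i = j" if "i \<in> I" "j \<in> I" for i j
    using \<psi>pt[OF that(1)] \<psi>(2)[OF that(1)] \<psi>(3)[OF that(1), of j] \<epsilon>[OF that(2)] that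
    by (cases "i = j") (auto simp: E_def)
  have Espan: "x - z \<in> span {r i}" if i: "i \<in> I" and x: "x \<in> E i" for i x
  proof -
    \<comment> \<open>\<open>a\<close> is the part of \<open>x - z\<close> orthogonal to
      \<open>r i\<close>; it annihilates the only ray on which \<psi> \<open>i\<close> vanishes, so
      as a functional it takes equal values at \<open>z\<close> and \<open>x\<close>.\<close>
    define c where "c = ((x - z) \<bullet> r i) / (r i \<bullet> r i)"
    define a where "a = (x - z) - c *\<^sub>R r i"
    have ar: "a \<bullet> r i = 0" using r0[OF i] by (simp add: a_def c_def inner_diff_left)
    have "a \<bullet> z = a \<bullet> x"
    proof (rule perturb_eq[OF \<psi>(1)[OF i] \<psi>ge[OF i] linear_inner_right])
      show "a \<bullet> r j = 0" if "j \<in> I" "\<psi> i (r j) = 0" for j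
        using \<psi>(3)[OF i, of j] that ar by (cases "j = i") auto
    qed (use x in \<open>auto simp: E_def\<close>)
    then have "a \<bullet> (x - z) = 0" by (simp add: inner_diff_right)
    then have "a \<bullet> a = 0" using ar by (simp add: a_def inner_diff_right)
    then have "x - z = c *\<^sub>R r i" by (simp add: a_def)
    then show ?thesis by (auto intro: span_mul span_base)
  qed
  have Ecov: "E i \<in> covers {z} Q" if i: "i \<in> I" for i
  proof -
    have "dirspace (E i) \<subseteq> span {r i}"
      by (rule dirspace_subset[OF zE]) (use Espan[OF i] in auto)
    then have "dim (dirspace (E i)) \<le> dim {r i}" by (metis dim_span dim_subset)
    then have "aff_dim (E i) \<le> 1" using aff_dim_dirspace[OF zE[of i]] dim_le_card'[of "{r i}"] by simp
    moreover have "1 \<le> aff_dim (E i)"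
      using zE[of i] ptE[OF i i] \<epsilon>(1)[OF i] r0[OF i]
      by (intro one_le_aff_dim[of z _ "z + \<epsilon> i *\<^sub>R r i"]) auto
    ultimately show ?thesis using Ef[OF i] zE by (simp add: covers_def)
  qed
  have Einj: "inj_on E I" by (rule inj_onI) (metis ptE)
  have "covers {z} Q = E ` I"
  proof (intro subset_antisym subsetI)
    fix G assume G: "G \<in> covers {z} Q"
    then have Gf: "G face_of Q" "z \<in> G" "aff_dim G = 1" by (auto simp: covers_def)
    obtain g c where g: "linear g" "\<And>x. x \<in> G \<Longrightarrow> g x = c" "\<And>x. x \<in> Q \<Longrightarrow> x \<notin> G \<Longrightarrow> c < (g x :: real)"
      using exposing_functional[OF Q Gf(1)] by blast
    have c: "c = g z" using g(2) Gf(2) by auto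
    have gr: "g (z + \<epsilon> i *\<^sub>R r i) = g z + \<epsilon> i * g (r i)" for i
      using g(1) by (simp add: linear_add linear_cmul)
    have gge: "0 \<le> g (r i)" if "i \<in> I" for i
    proof -
      have "c \<le> g (z + \<epsilon> i *\<^sub>R r i)" using g(2) g(3)[OF \<epsilon>(2)[OF that]] by (metis less_imp_le order_refl)
      then have "0 \<le> \<epsilon> i * g (r i)" using gr c by simp
      then show ?thesis using \<epsilon>(1)[OF that] by (simp add: zero_le_mult_iff)
    qed
    \<comment> \<open>Otherwise \<open>g\<close> would be positive on all rays and expose only
      \<open>z\<close>, whereas \<open>G\<close> has dimension one.\<close>
    have "\<exists>i\<in>I. g (r i) = 0"
    proof (rule ccontr)
      assume none: "\<not> (\<exists>i\<in>I. g (r i) = 0)"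
      have pos: "0 < g (r i)" if "i \<in> I" for i
        using gge[OF that] none that by (metis less_eq_real_def)
      have "q = z" if "q \<in> G" for q
      proof (rule only_z[OF g(1) pos])
        show "q \<in> Q" by (rule subsetD[OF face_of_imp_subset[OF Gf(1)] that])
        show "g q = g z" using g(2)[OF that] g(2)[OF Gf(2)] by (rule trans[OF _ sym])
      qed
      then have "G = {z}" using Gf(2) by blast
      then show False using Gf(3) by simp
    qed
    then obtain i where i: "i \<in> I" "g (r i) = 0" by blast
    have "z + \<epsilon> i *\<^sub>R r i \<in> G" using gr[of i] i(2) g(3)[OF \<epsilon>(2)[OF i(1)]] c by (metis add.right_neutral less_irrefl mult_zero_right)
    moreover have "z + \<epsilon> i *\<^sub>R r i \<in> E i" using ptE i by simp
    moreover have "z + \<epsilon> i *\<^sub>R r i \<notin> {z}" using \<epsilon>(1)[OF i(1)] r0[OF i(1)] by simp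
    ultimately have "E i = G"
      using cover_subset_face[OF Q zf Ecov[OF i(1)] Gf(1)] cover_subset_face[OF Q zf G Ef[OF i(1)]]
        zE Gf(2) by blast
    then show "G \<in> E ` I" using i by auto
  qed (use Ecov in auto)
  then show "card (covers {z} Q) = card I" using card_image[OF Einj] by simp
  have "dirspace Q = span (r ` I)"
  proof
    obtain q where q: "\<And>G. G \<in> covers {z} Q \<Longrightarrow> q G \<in> G - {z}" using covers_nonempty_diff by metis
    show "dirspace Q \<subseteq> span (r ` I)"
    proof (rule dirspace_subset_covers[OF Q zf _ q])
      show "dirspace {z} \<subseteq> span (r ` I)" by (rule dirspace_subset[of z]) (auto intro: span_0)
      show "q G - z \<in> span (r ` I)" if "G \<in> covers {z} Q" for G
      proof -
        obtain i where i: "i \<in> I" "G = E i" using \<open>G \<in> covers {z} Q\<close> \<open>covers {z} Q = E ` I\<close> by auto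
        then have "q G - z \<in> span {r i}" using q[OF that] Espan[OF i(1)] by auto
        then show ?thesis using i(1) span_mono[of "{r i}" "r ` I"] by auto
      qed
    qed auto
    have "r i \<in> dirspace Q" if "i \<in> I" for i
    proof -
      have "\<epsilon> i *\<^sub>R r i \<in> dirspace Q" using dirspace_diff[OF \<epsilon>(2)[OF that] z] by simp
      then have "(1 / \<epsilon> i) *\<^sub>R \<epsilon> i *\<^sub>R r i \<in> dirspace Q" by (rule subspace_scale[OF subspace_dirspace])
      then show ?thesis using \<epsilon>(1)[OF that] by simp
    qed
    then show "span (r ` I) \<subseteq> dirspace Q" by (intro span_minimal) auto
  qed
  then show "aff_dim Q = int (dim (r ` I))" using aff_dim_dirspace[OF z] by simp
qed

section \<open>The monotone path polytope\<close>

text \<open>Integrals instead of means, with prescribed end points, so that consecutive pieces of a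
  section simply add up.\<close>

definition section_integrals ::
    "'a::euclidean_space set \<Rightarrow> ('a \<Rightarrow> real) \<Rightarrow> 'a \<Rightarrow> 'a \<Rightarrow> 'a set" where
  "section_integrals P l p q = {I. \<exists>\<gamma>. continuous_on {l p..l q} \<gamma> \<and>
     (\<forall>t\<in>{l p..l q}. \<gamma> t \<in> P \<and> l (\<gamma> t) = t) \<and> \<gamma> (l p) = p \<and> \<gamma> (l q) = q \<and>
     (\<gamma> has_integral I) {l p..l q}}"

lemma section_integralsI:
  assumes "continuous_on {l p..l q} \<gamma>" "\<And>t. t \<in> {l p..l q} \<Longrightarrow> \<gamma> t \<in> P \<and> l (\<gamma> t) = t"
    "\<gamma> (l p) = p" "\<gamma> (l q) = q" "(\<gamma> has_integral I) {l p..l q}"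
  shows "I \<in> section_integrals P l p q"
  using assms by (auto simp: section_integrals_def)

lemma section_integralsE:
  assumes "I \<in> section_integrals P l p q"
  obtains \<gamma> where "continuous_on {l p..l q} \<gamma>" "\<And>t. t \<in> {l p..l q} \<Longrightarrow> \<gamma> t \<in> P \<and> l (\<gamma> t) = t"
    "\<gamma> (l p) = p" "\<gamma> (l q) = q" "(\<gamma> has_integral I) {l p..l q}"
  using assms by (auto simp: section_integrals_def)

lemma section_refl: "p \<in> P \<Longrightarrow> 0 \<in> section_integrals P l p p"
  by (rule section_integralsI[of _ _ _ "\<lambda>_. p"]) auto

lemma section_segment:
  fixes P :: "'a::euclidean_space set"
  assumes P: "convex P" "p \<in> P" "q \<in> P" and l: "linear l" "l p < l q"
  shows "((l q - l p) / 2) *\<^sub>R (p + q) \<in> section_integrals P l p q"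
proof -
  \<comment> \<open>\<open>v\<close> is the direction of the segment normalized to
    \<open>l v = 1\<close>, and \<open>u\<close> is the point of its line at level 0, so the section
    is \<open>u + t *\<^sub>R v\<close>.\<close>
  define v where "v = (1 / (l q - l p)) *\<^sub>R (q - p)"
  define u where "u = p - l p *\<^sub>R v"
  have p: "p = u + l p *\<^sub>R v" by (simp add: u_def)
  have "(l q - l p) *\<^sub>R v = q - p" using l(2) by (simp add: v_def)
  then have q: "q = u + l q *\<^sub>R v" by (simp add: u_def algebra_simps)
  have lv: "l v = 1" using l by (simp add: v_def linear_cmul linear_diff flip: diff_divide_distrib)
  have lu: "l u = 0" using lv by (simp add: u_def linear_diff[OF l(1)] linear_cmul[OF l(1)])
  show ?thesis
  proof (rule section_integralsI[of _ _ _ "\<lambda>t. u + t *\<^sub>R v"])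
    show "continuous_on {l p..l q} (\<lambda>t. u + t *\<^sub>R v)" by (intro continuous_intros)
    fix t assume t: "t \<in> {l p..l q}"
    define c where "c = (t - l p) / (l q - l p)"
    have c: "0 \<le> c" "c \<le> 1" using t l(2) by (auto simp: c_def)
    have "c * (l q - l p) = t - l p" using l(2) by (simp add: c_def)
    then have "t = (1 - c) * l p + c * l q" by (simp add: algebra_simps)
    then have "u + t *\<^sub>R v = u + ((1 - c) * l p + c * l q) *\<^sub>R v" by (rule arg_cong)
    then have "u + t *\<^sub>R v = (1 - c) *\<^sub>R (u + l p *\<^sub>R v) + c *\<^sub>R (u + l q *\<^sub>R v)"
      by (simp add: algebra_simps)
    then have "u + t *\<^sub>R v = (1 - c) *\<^sub>R p + c *\<^sub>R q" using p q by simp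
    then have "u + t *\<^sub>R v \<in> P" using convexD[OF P, of "1 - c" c] c by simp
    then show "u + t *\<^sub>R v \<in> P \<and> l (u + t *\<^sub>R v) = t"
      using lu lv by (simp add: linear_add[OF l(1)] linear_cmul[OF l(1)])
  next
    show "u + l p *\<^sub>R v = p" "u + l q *\<^sub>R v = q" using p q by simp_all
    have "((\<lambda>t. u + t *\<^sub>R v) has_integral
        (l q - l p) *\<^sub>R u + (((l q)\<^sup>2 - (l p)\<^sup>2) / 2) *\<^sub>R v) {l p..l q}"
      using l(2) has_integral_const_real[of u "l p" "l q"]
      by (intro has_integral_add has_integral_scaleR_left ident_has_integral) auto
    moreover have "(l q - l p) *\<^sub>R u + (((l q)\<^sup>2 - (l p)\<^sup>2) / 2) *\<^sub>R v
        = ((l q - l p) / 2) *\<^sub>R ((u + l p *\<^sub>R v) + (u + l q *\<^sub>R v))"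
    proof -
      have "((l q - l p) / 2) *\<^sub>R ((u + l p *\<^sub>R v) + (u + l q *\<^sub>R v))
          = ((l q - l p) / 2) *\<^sub>R (2 *\<^sub>R u + (l p + l q) *\<^sub>R v)"
        by (simp add: scaleR_2 algebra_simps)
      also have "\<dots> = (l q - l p) *\<^sub>R u + ((l q - l p) / 2 * (l p + l q)) *\<^sub>R v"
        by (simp add: scaleR_add_right)
      also have "(l q - l p) / 2 * (l p + l q) = ((l q)\<^sup>2 - (l p)\<^sup>2) / 2"
        by (simp add: power2_eq_square algebra_simps)
      finally show ?thesis by simp
    qed
    ultimately show "((\<lambda>t. u + t *\<^sub>R v) has_integral ((l q - l p) / 2) *\<^sub>R (p + q)) {l p..l q}"
      using p q by simp
  qed
qed

lemma section_append:
  assumes I: "I \<in> section_integrals P l p q" and J: "J \<in> section_integrals P l q r"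
    and le: "l p \<le> l q" "l q \<le> l r"
  shows "I + J \<in> section_integrals P l p r"
proof -
  obtain \<gamma> where \<gamma>: "continuous_on {l p..l q} \<gamma>" "\<And>t. t \<in> {l p..l q} \<Longrightarrow> \<gamma> t \<in> P \<and> l (\<gamma> t) = t"
    "\<gamma> (l p) = p" "\<gamma> (l q) = q" "(\<gamma> has_integral I) {l p..l q}"
    using section_integralsE[OF I] by blast
  obtain \<delta> where \<delta>: "continuous_on {l q..l r} \<delta>" "\<And>t. t \<in> {l q..l r} \<Longrightarrow> \<delta> t \<in> P \<and> l (\<delta> t) = t"
    "\<delta> (l q) = q" "\<delta> (l r) = r" "(\<delta> has_integral J) {l q..l r}"
    using section_integralsE[OF J] by blast
  let ?h = "\<lambda>t. if t \<le> l q then \<gamma> t else \<delta> t"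
  show ?thesis
  proof (rule section_integralsI[of _ _ _ ?h])
    have un: "{l p..l r} = {l p..l q} \<union> {l q..l r}" using le by auto
    show "continuous_on {l p..l r} ?h"
      unfolding un
      by (rule continuous_on_cases) (use \<gamma> \<delta> in auto)
    show "?h t \<in> P \<and> l (?h t) = t" if "t \<in> {l p..l r}" for t
      using \<gamma>(2)[of t] \<delta>(2)[of t] that by auto
    show "?h (l p) = p" using \<gamma>(3) le by simp
    show "?h (l r) = r" using \<gamma>(4) \<delta>(3,4) le(2) by (metis order_antisym)
    have "(?h has_integral I) {l p..l q}"
      by (rule has_integral_eq[OF _ \<gamma>(5)]) auto
    moreover have "(?h has_integral J) {l q..l r}"
      by (rule has_integral_eq[OF _ \<delta>(5)]) (use \<gamma>(4) \<delta>(3) in auto)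
    ultimately show "(?h has_integral I + J) {l p..l r}"
      using le by (intro has_integral_combine)
  qed
qed

lemma convex_section_integrals:
  assumes P: "convex P" and l: "linear l"
  shows "convex (section_integrals P l p q)"
proof (rule convexI)
  fix I J and u v :: real
  assume I: "I \<in> section_integrals P l p q" and J: "J \<in> section_integrals P l p q"
    and uv: "0 \<le> u" "0 \<le> v" "u + v = 1"
  obtain \<gamma> where \<gamma>: "continuous_on {l p..l q} \<gamma>" "\<And>t. t \<in> {l p..l q} \<Longrightarrow> \<gamma> t \<in> P \<and> l (\<gamma> t) = t"
    "\<gamma> (l p) = p" "\<gamma> (l q) = q" "(\<gamma> has_integral I) {l p..l q}"
    using section_integralsE[OF I] by blast
  obtain \<delta> where \<delta>: "continuous_on {l p..l q} \<delta>" "\<And>t. t \<in> {l p..l q} \<Longrightarrow> \<delta> t \<in> P \<and> l (\<delta> t) = t"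
    "\<delta> (l p) = p" "\<delta> (l q) = q" "(\<delta> has_integral J) {l p..l q}"
    using section_integralsE[OF J] by blast
  have uvx: "u *\<^sub>R x + v *\<^sub>R x = x" for x :: 'a using uv(3) by (metis scaleR_add_left scaleR_one)
  show "u *\<^sub>R I + v *\<^sub>R J \<in> section_integrals P l p q"
  proof (rule section_integralsI[of _ _ _ "\<lambda>t. u *\<^sub>R \<gamma> t + v *\<^sub>R \<delta> t"])
    show "continuous_on {l p..l q} (\<lambda>t. u *\<^sub>R \<gamma> t + v *\<^sub>R \<delta> t)"
      using \<gamma>(1) \<delta>(1) by (intro continuous_intros)
    fix t assume t: "t \<in> {l p..l q}"
    have "u * t + v * t = t" using uv(3) by (metis distrib_right mult_1)
    then show "u *\<^sub>R \<gamma> t + v *\<^sub>R \<delta> t \<in> P \<and> l (u *\<^sub>R \<gamma> t + v *\<^sub>R \<delta> t) = t"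
      using \<gamma>(2)[OF t] \<delta>(2)[OF t] convexD[OF P _ _ uv]
      by (simp add: linear_add[OF l] linear_cmul[OF l])
  next
    show "((\<lambda>t. u *\<^sub>R \<gamma> t + v *\<^sub>R \<delta> t) has_integral u *\<^sub>R I + v *\<^sub>R J) {l p..l q}"
      using \<gamma>(5) \<delta>(5) by (intro has_integral_add has_integral_cmul)
  qed (use \<gamma> \<delta> uvx in auto)
qed

text \<open>The exact integral of the piecewise affine section through the vertices from
  \<open>p i\<close> to \<open>p j\<close>: each edge contributes its length in \<open>l\<close>
  times its midpoint.\<close>

definition path_integral :: "('a::euclidean_space \<Rightarrow> real) \<Rightarrow> (nat \<Rightarrow> 'a) \<Rightarrow> nat \<Rightarrow> nat \<Rightarrow> 'a" where
  "path_integral l p i j = (\<Sum>n=i..<j. ((l (p (Suc n)) - l (p n)) / 2) *\<^sub>R (p n + p (Suc n)))"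

lemma path_integral_Suc:
  "i \<le> j \<Longrightarrow> path_integral l p i (Suc j) =
    path_integral l p i j + ((l (p (Suc j)) - l (p j)) / 2) *\<^sub>R (p j + p (Suc j))"
  by (simp add: path_integral_def)

lemma path_integral_append:
  "i \<le> j \<Longrightarrow> j \<le> n \<Longrightarrow> path_integral l p i n = path_integral l p i j + path_integral l p j n"
  by (simp add: path_integral_def sum.atLeastLessThan_concat)

section \<open>Integrals along monotone edge paths\<close>

context generic_polytope
begin

lemma mono_path_mono:
  assumes p: "mono_path P l k p" and "i \<le> j" "j \<le> k"
  shows "l (p i) \<le> l (p j)"
  using assms(2,3)
proof (induction j rule: dec_induct)
  case (step n)
  then show ?case using directed_edgeD(3)[of "p n" "p (Suc n)"] p by (force simp: mono_path_def)
qed simp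

lemma mono_path_strict:
  assumes p: "mono_path P l k p" and "i < j" "j \<le> k"
  shows "l (p i) < l (p j)"
proof -
  have "l (p i) < l (p (Suc i))" using directed_edgeD(3) p assms by (simp add: mono_path_def)
  also have "\<dots> \<le> l (p j)" using mono_path_mono[OF p, of "Suc i" j] assms by simp
  finally show ?thesis .
qed

lemma mono_path_vertices:
  assumes p: "mono_path P l k p" "p k \<in> vertices P" "i \<le> k"
  shows "p i \<in> vertices P"
  using assms directed_edgeD(1)[of "p i" "p (Suc i)"] by (cases "i = k") (auto simp: mono_path_def)

lemma section_path:
  assumes p: "mono_path P l k p" "p k \<in> vertices P" and ij: "i \<le> j" "j \<le> k"
  shows "path_integral l p i j \<in> section_integrals P l (p i) (p j)"
  using ij
proof (induction j rule: dec_induct)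
  case base
  have "p i \<in> P" using mono_path_vertices[OF p, of i] ij vertices_subset by auto
  then show ?case by (simp add: path_integral_def section_refl)
next
  case (step n)
  have "((l (p (Suc n)) - l (p n)) / 2) *\<^sub>R (p n + p (Suc n)) \<in> section_integrals P l (p n) (p (Suc n))"
    using mono_path_vertices[OF p] step mono_path_strict[OF p(1), of n "Suc n"] subsetD[OF vertices_subset]
    by (intro section_segment[OF convex _ _ linear]) auto
  moreover have "l (p i) \<le> l (p n)" "l (p n) \<le> l (p (Suc n))"
    using mono_path_mono[OF p(1)] step by auto
  ultimately show ?case
    unfolding path_integral_Suc[OF step.hyps(1)] using step by (intro section_append) auto
qed

text \<open>Stated with a difference, so that a local change of the path directly yields a
  displacement of the whole integral.\<close>

lemma section_replace:
  assumes p: "mono_path P l k p" "p k \<in> vertices P" and ij: "i \<le> j" "j \<le> k"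
    and K: "K \<in> section_integrals P l (p i) (p j)"
  shows "path_integral l p 0 k + (K - path_integral l p i j) \<in> section_integrals P l (p 0) (p k)"
proof -
  have "path_integral l p 0 i + K \<in> section_integrals P l (p 0) (p j)"
    using section_path[OF p, of 0 i] K mono_path_mono[OF p(1)] ij by (intro section_append) auto
  then have "path_integral l p 0 i + K + path_integral l p j k \<in> section_integrals P l (p 0) (p k)"
    by (rule section_append)
      (use section_path[OF p, of j k] mono_path_mono[OF p(1)] ij in auto)
  moreover have "path_integral l p 0 k = path_integral l p 0 i + path_integral l p i j + path_integral l p j k"
    using path_integral_append[of 0 i k l p] path_integral_append[of i j k l p] ij by simp
  ultimately show ?thesis by (simp add: algebra_simps)
qed

text \<open>Over each edge, \<psi> along any section stays above an affine function of
  \<open>t\<close> with slope \<open>s i\<close>, and the edge itself attains this function; the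
  pieces are then integrated.\<close>

lemma section_integral_ge:
  fixes \<psi> :: "'a \<Rightarrow> real"
  assumes p: "mono_path P l k p" and \<psi>: "linear \<psi>"
    and slope: "\<And>i. i < k \<Longrightarrow> \<psi> (p (Suc i)) - \<psi> (p i) = s i * (l (p (Suc i)) - l (p i))"
    and low: "\<And>i x. i < k \<Longrightarrow> x \<in> P \<Longrightarrow> \<psi> (p i) - s i * l (p i) \<le> \<psi> x - s i * l x"
    and I: "I \<in> section_integrals P l (p 0) (p k)"
  shows "\<psi> (path_integral l p 0 k) \<le> \<psi> I"
proof -
  obtain \<gamma> where \<gamma>: "continuous_on {l (p 0)..l (p k)} \<gamma>"
    "\<And>t. t \<in> {l (p 0)..l (p k)} \<Longrightarrow> \<gamma> t \<in> P \<and> l (\<gamma> t) = t"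
    "\<gamma> (l (p 0)) = p 0" "\<gamma> (l (p k)) = p k" "(\<gamma> has_integral I) {l (p 0)..l (p k)}"
    using section_integralsE[OF I] by blast
  have bl: "bounded_linear \<psi>" using \<psi> by (simp add: linear_conv_bounded_linear)
  have cont: "continuous_on {l (p 0)..l (p k)} (\<psi> \<circ> \<gamma>)"
    by (rule continuous_on_compose[OF \<gamma>(1) linear_continuous_on[OF bl]])
  have intb: "(\<psi> \<circ> \<gamma>) integrable_on {l (p i)..l (p j)}" if "i \<le> j" "j \<le> k" for i j
    using mono_path_mono[OF p, of 0 i] mono_path_mono[OF p, of j k] that
    by (intro integrable_continuous_real continuous_on_subset[OF cont]) auto
  have "\<psi> (path_integral l p 0 m) \<le> integral {l (p 0)..l (p m)} (\<psi> \<circ> \<gamma>)" if "m \<le> k" for m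
    using that
  proof (induction m)
    case 0
    then show ?case using linear_0[OF \<psi>] by (simp add: path_integral_def)
  next
    case (Suc m)
    have m: "m < k" using Suc.prems by simp
    let ?a = "l (p m)" and ?b = "l (p (Suc m))"
    define c where "c = \<psi> (p m) - s m * ?a"
    have cb: "\<psi> (p (Suc m)) = c + s m * ?b" using slope[OF m] by (simp add: c_def algebra_simps)
    have ca: "\<psi> (p m) = c + s m * ?a" by (simp add: c_def)
    have ab: "?a \<le> ?b" using mono_path_mono[OF p, of m "Suc m"] m by simp
    have hi: "((\<lambda>t. c + s m * t) has_integral (?b - ?a) * c + s m * ((?b\<^sup>2 - ?a\<^sup>2) / 2)) {?a..?b}"
      using has_integral_const_real[of c ?a ?b] ab
      by (intro has_integral_add has_integral_mult_right ident_has_integral) auto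
    have "(?b - ?a) * c + s m * ((?b\<^sup>2 - ?a\<^sup>2) / 2) \<le> integral {?a..?b} (\<psi> \<circ> \<gamma>)"
    proof (rule has_integral_le[OF hi])
      show "(\<psi> \<circ> \<gamma> has_integral integral {?a..?b} (\<psi> \<circ> \<gamma>)) {?a..?b}"
        using intb[of m "Suc m"] m by (intro integrable_integral) auto
      fix t assume t: "t \<in> {?a..?b}"
      then have "t \<in> {l (p 0)..l (p k)}"
        using mono_path_mono[OF p, of 0 m] mono_path_mono[OF p, of "Suc m" k] m by auto
      then have "\<gamma> t \<in> P" "l (\<gamma> t) = t" using \<gamma>(2) by auto
      then show "c + s m * t \<le> (\<psi> \<circ> \<gamma>) t" using low[OF m, of "\<gamma> t"] by (simp add: c_def)
    qed
    moreover have "\<psi> (((?b - ?a) / 2) *\<^sub>R (p m + p (Suc m))) = (?b - ?a) * c + s m * ((?b\<^sup>2 - ?a\<^sup>2) / 2)"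
      unfolding linear_cmul[OF \<psi>] linear_add[OF \<psi>] ca cb
      by (simp add: power2_eq_square field_simps)
    moreover have "integral {l (p 0)..?a} (\<psi> \<circ> \<gamma>) + integral {?a..?b} (\<psi> \<circ> \<gamma>) = integral {l (p 0)..?b} (\<psi> \<circ> \<gamma>)"
      using intb[of 0 "Suc m"] Suc.prems mono_path_mono[OF p, of 0 m] ab m
      by (intro Henstock_Kurzweil_Integration.integral_combine) auto
    ultimately show ?case
      using Suc.IH m by (simp add: path_integral_Suc linear_add[OF \<psi>] comp_def)
  qed
  from this[of k] have "\<psi> (path_integral l p 0 k) \<le> integral {l (p 0)..l (p k)} (\<psi> \<circ> \<gamma>)" by simp
  also have "\<dots> = \<psi> I" using has_integral_linear[OF \<gamma>(5) bl] by (rule integral_unique)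
  finally show ?thesis .
qed

text \<open>The outgoing edge of least slope is followed greedily. No incoming edge has a larger
  slope, so \<open>\<psi> x - s0 * l x\<close> is minimal at \<open>v\<close> over all of
  \<open>P\<close>. The slope hypothesis is the invariant of the induction.\<close>

lemma lower_path_exists:
  fixes \<psi> :: "'a \<Rightarrow> real"
  assumes \<psi>: "linear \<psi>" and b: "top b" and v: "v \<in> vertices P"
    and "\<And>u w. directed_edge P l u v \<Longrightarrow> directed_edge P l v w \<Longrightarrow>
      (\<psi> v - \<psi> u) / (l v - l u) \<le> (\<psi> w - \<psi> v) / (l w - l v)"
  shows "\<exists>k p s. p 0 = v \<and> p k = b \<and> mono_path P l k p \<and>
    (\<forall>i<k. \<psi> (p (Suc i)) - \<psi> (p i) = s i * (l (p (Suc i)) - l (p i)) \<and>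
      (\<forall>x\<in>P. \<psi> (p i) - s i * l (p i) \<le> \<psi> x - s i * l x))"
  using v assms(4)
proof (induction rule: up_induct)
  case (up v)
  show ?case
  proof (cases "v = b")
    case True
    then show ?thesis
      by (intro exI[of _ 0] exI[of _ "\<lambda>_. v"]) (auto simp: mono_path_def)
  next
    case False
    let ?sl = "\<lambda>w. (\<psi> w - \<psi> v) / (l w - l v)"
    let ?W = "{w. directed_edge P l v w}"
    have vb: "v \<in> P" "b \<in> P" "l v \<le> l b" using b up(1) vertices_subset by (auto simp: top_def)
    obtain w0 where w0: "directed_edge P l v w0"
      using out_edge[OF up(1) vb(2) _ vb(3)] False by blast
    have fin: "finite ?W" using finite_vertices[OF polytope] directed_edgeD(2)
      by (auto intro: finite_subset[rotated])
    have ne: "?W \<noteq> {}" using w0 by auto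
    define w where "w = arg_min_on ?sl ?W"
    have w: "directed_edge P l v w" using arg_min_if_finite(1)[OF fin ne, of ?sl] by (simp add: w_def)
    have wmin: "?sl w \<le> ?sl z" if "directed_edge P l v z" for z
      unfolding w_def by (rule arg_min_least[OF fin ne]) (use that in simp)
    define s0 where "s0 = ?sl w"
    note W = directed_edgeD[OF w]
    have eq: "\<psi> w - \<psi> v = s0 * (l w - l v)" using W(3) by (simp add: s0_def)
    have lin: "linear (\<lambda>x. 1 * \<psi> x + (- s0) * l x)" by (rule linear_combine[OF \<psi> linear])
    have low: "\<psi> v - s0 * l v \<le> \<psi> x - s0 * l x" if "x \<in> P" for x
    proof -
      have "1 * \<psi> v + (- s0) * l v \<le> 1 * \<psi> x + (- s0) * l x"
      proof (rule vertex_linear_ge[OF polytope up(1) lin _ that])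
        fix z assume "closed_segment v z edge_of P"
        from edge_cases[OF this] show "1 * \<psi> v + (- s0) * l v \<le> 1 * \<psi> z + (- s0) * l z"
        proof
          assume z: "directed_edge P l v z"
          then have "s0 \<le> ?sl z" "l v < l z" using wmin directed_edgeD(3) by (auto simp: s0_def)
          then have "s0 * (l z - l v) \<le> \<psi> z - \<psi> v" by (simp add: pos_le_divide_eq)
          then show ?thesis by (simp add: algebra_simps)
        next
          assume z: "directed_edge P l z v"
          then have "(\<psi> v - \<psi> z) / (l v - l z) \<le> s0" "l z < l v"
            using up(3)[OF z w] directed_edgeD(3) by (auto simp: s0_def)
          then have "\<psi> v - \<psi> z \<le> s0 * (l v - l z)" by (simp add: pos_divide_le_eq)
          then show ?thesis by (simp add: algebra_simps)
        qed
      qed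
      then show ?thesis by simp
    qed
    have loww: "\<psi> w - s0 * l w \<le> \<psi> x - s0 * l x" if "x \<in> P" for x
      using low[OF that] eq by (simp add: algebra_simps)
    \<comment> \<open>The upper end \<open>w\<close> minimizes the same functional; this compares
      all slopes at \<open>w\<close> with \<open>s0\<close> and so reproduces the invariant
      there.\<close>
    have "(\<psi> w - \<psi> u) / (l w - l u) \<le> (\<psi> z - \<psi> w) / (l z - l w)"
      if u: "directed_edge P l u w" and z: "directed_edge P l w z" for u z
    proof -
      have "u \<in> P" "z \<in> P" using directed_edgeD u z vertices_subset by blast+
      from loww[OF this(1)] loww[OF this(2)]
      have "\<psi> w - \<psi> u \<le> s0 * (l w - l u)" "s0 * (l z - l w) \<le> \<psi> z - \<psi> w"
        by (simp_all add: algebra_simps)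
      then have "(\<psi> w - \<psi> u) / (l w - l u) \<le> s0" "s0 \<le> (\<psi> z - \<psi> w) / (l z - l w)"
        using directed_edgeD(3)[OF u] directed_edgeD(3)[OF z]
        by (simp_all add: pos_divide_le_eq pos_le_divide_eq)
      then show ?thesis by linarith
    qed
    from up(2)[OF W(2,3) this] obtain k p s where IH: "p 0 = w" "p k = b" "mono_path P l k p"
      "\<forall>i<k. \<psi> (p (Suc i)) - \<psi> (p i) = s i * (l (p (Suc i)) - l (p i)) \<and>
        (\<forall>x\<in>P. \<psi> (p i) - s i * l (p i) \<le> \<psi> x - s i * l x)" by blast
    have "mono_path P l (Suc k) (case_nat v p)" using path_Cons[OF _ IH(3)] w IH(1) by simp
    moreover have "\<forall>i<Suc k. \<psi> (case_nat v p (Suc i)) - \<psi> (case_nat v p i) =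
        case_nat s0 s i * (l (case_nat v p (Suc i)) - l (case_nat v p i)) \<and>
        (\<forall>x\<in>P. \<psi> (case_nat v p i) - case_nat s0 s i * l (case_nat v p i) \<le> \<psi> x - case_nat s0 s i * l x)"
    proof (intro allI impI)
      fix i assume "i < Suc k"
      then show "\<psi> (case_nat v p (Suc i)) - \<psi> (case_nat v p i) =
        case_nat s0 s i * (l (case_nat v p (Suc i)) - l (case_nat v p i)) \<and>
        (\<forall>x\<in>P. \<psi> (case_nat v p i) - case_nat s0 s i * l (case_nat v p i) \<le> \<psi> x - case_nat s0 s i * l x)"
        using IH low eq by (cases i) auto
    qed
    ultimately show ?thesis
      using IH(2) by (intro exI[of _ "Suc k"] exI[of _ "case_nat v p"] exI[of _ "case_nat s0 s"]) auto
  qed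
qed

section \<open>The monotone path polytope as a convex hull\<close>

lemma monotone_path_polytope_eq:
  assumes a: "bot a" and b: "top b" and ab: "a \<noteq> b"
  shows "monotone_path_polytope P l = (\<lambda>I. (1 / (l b - l a)) *\<^sub>R I) ` section_integrals P l a b"
proof -
  have aP: "a \<in> P" and bP: "b \<in> P" using a b vertices_subset by (auto simp: bot_def top_def)
  have "\<not> (\<exists>p. P \<subseteq> {p})" using aP bP ab by blast
  moreover have "Inf (l ` P) = l a"
    by (rule cInf_eq_minimum) (use a aP in \<open>auto simp: bot_def\<close>)
  moreover have "Sup (l ` P) = l b"
    by (rule cSup_eq_maximum) (use b bP in \<open>auto simp: top_def\<close>)
  ultimately have M: "monotone_path_polytope P l =
    {(1 / (l b - l a)) *\<^sub>R integral {l a..l b} \<gamma> | \<gamma>.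
      continuous_on {l a..l b} \<gamma> \<and> (\<forall>t\<in>{l a..l b}. \<gamma> t \<in> P \<and> l (\<gamma> t) = t)}"
    by (simp add: monotone_path_polytope_def Let_def)
  have le: "l a \<le> l b" using a bP by (auto simp: bot_def)
  show ?thesis
    unfolding M
  proof (intro subset_antisym subsetI)
    fix x assume "x \<in> {(1 / (l b - l a)) *\<^sub>R integral {l a..l b} \<gamma> | \<gamma>.
      continuous_on {l a..l b} \<gamma> \<and> (\<forall>t\<in>{l a..l b}. \<gamma> t \<in> P \<and> l (\<gamma> t) = t)}"
    then obtain \<gamma> where x: "x = (1 / (l b - l a)) *\<^sub>R integral {l a..l b} \<gamma>"
      and \<gamma>: "continuous_on {l a..l b} \<gamma>" "\<forall>t\<in>{l a..l b}. \<gamma> t \<in> P \<and> l (\<gamma> t) = t" by blast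
    have ends: "\<gamma> (l a) \<in> P" "l (\<gamma> (l a)) = l a" "\<gamma> (l b) \<in> P" "l (\<gamma> (l b)) = l b" using \<gamma>(2) le by auto
    have "integral {l a..l b} \<gamma> \<in> section_integrals P l a b"
    proof (rule section_integralsI[OF \<gamma>(1)])
      \<comment> \<open>A section starts on the lowest level and ends on the highest, where
        \<open>P\<close> has only one point each, so prescribing the end points is no
        restriction.\<close>
      show "\<gamma> (l a) = a" using bot_unique[OF a ends(1)] ends(2) by simp
      show "\<gamma> (l b) = b" using top_unique[OF b ends(3)] ends(4) by simp
      show "(\<gamma> has_integral integral {l a..l b} \<gamma>) {l a..l b}"
        by (rule integrable_integral[OF integrable_continuous_real[OF \<gamma>(1)]])
    qed (use \<gamma>(2) in auto)
    then show "x \<in> (\<lambda>I. (1 / (l b - l a)) *\<^sub>R I) ` section_integrals P l a b" using x by blast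
  next
    fix x assume "x \<in> (\<lambda>I. (1 / (l b - l a)) *\<^sub>R I) ` section_integrals P l a b"
    then obtain I where I: "I \<in> section_integrals P l a b" "x = (1 / (l b - l a)) *\<^sub>R I" by blast
    obtain \<gamma> where \<gamma>: "continuous_on {l a..l b} \<gamma>" "\<And>t. t \<in> {l a..l b} \<Longrightarrow> \<gamma> t \<in> P \<and> l (\<gamma> t) = t"
      "\<gamma> (l a) = a" "\<gamma> (l b) = b" "(\<gamma> has_integral I) {l a..l b}"
      using section_integralsE[OF I(1)] by blast
    then have "x = (1 / (l b - l a)) *\<^sub>R integral {l a..l b} \<gamma>" using I(2) integral_unique[OF \<gamma>(5)] by simp
    then show "x \<in> {(1 / (l b - l a)) *\<^sub>R integral {l a..l b} \<gamma> | \<gamma>.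
      continuous_on {l a..l b} \<gamma> \<and> (\<forall>t\<in>{l a..l b}. \<gamma> t \<in> P \<and> l (\<gamma> t) = t)}" using \<gamma>(1,2) by blast
  qed
qed

definition path_means :: "'a \<Rightarrow> 'a \<Rightarrow> 'a set" where
  "path_means a b = {(1 / (l b - l a)) *\<^sub>R path_integral l p 0 k |k p.
     mono_path P l k p \<and> p 0 = a \<and> p k = b}"

text \<open>The vertices on a path are distinct since \<open>l\<close> increases, so a path is
  encoded by a list of at most \<open>card (vertices P)\<close> vertices.\<close>

lemma finite_path_means:
  assumes b: "top b"
  shows "finite (path_means a b)"
proof -
  let ?V = "vertices P"
  let ?L = "{xs. set xs \<subseteq> ?V \<and> length xs \<le> card ?V}"
  let ?g = "\<lambda>xs. (1 / (l b - l a)) *\<^sub>R path_integral l (\<lambda>n. xs ! n) 0 (length xs - 1)"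
  have "path_means a b \<subseteq> ?g ` ?L"
  proof
    fix x assume "x \<in> path_means a b"
    then obtain k p where x: "x = (1 / (l b - l a)) *\<^sub>R path_integral l p 0 k"
      and p: "mono_path P l k p" "p k = b" by (auto simp: path_means_def)
    have pk: "p k \<in> ?V" using p(2) b by (simp add: top_def)
    have sub: "p ` {..k} \<subseteq> ?V" using mono_path_vertices[OF p(1) pk] by auto
    have "inj_on p {..k}"
      by (rule linorder_inj_onI) (use mono_path_strict[OF p(1)] in force)+
    then have "card {..k} \<le> card ?V"
      using card_inj_on_le[OF _ sub finite_vertices[OF polytope]] by blast
    then have len: "map p [0..<Suc k] \<in> ?L" using sub by auto
    have "path_integral l (\<lambda>n. map p [0..<Suc k] ! n) 0 k = path_integral l p 0 k"
      unfolding path_integral_def by (rule sum.cong) (auto simp del: upt_Suc)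
    then have "x = ?g (map p [0..<Suc k])" using x by (simp del: upt_Suc)
    then show "x \<in> ?g ` ?L" using len by blast
  qed
  moreover have "finite ?L" by (rule finite_lists_length_le[OF finite_vertices[OF polytope]])
  ultimately show ?thesis by (meson finite_imageI finite_subset)
qed

text \<open>A point outside the hull would be separated from it by some normal \<open>n\<close>; but
  the lower path for \<open>n\<close> has a mean that is at most as large in direction
  \<open>n\<close>.\<close>

lemma monotone_path_polytope_hull:
  assumes a: "bot a" and b: "top b" and ab: "a \<noteq> b"
  shows "monotone_path_polytope P l = convex hull (path_means a b)"
proof
  let ?c = "1 / (l b - l a)"
  have bV: "b \<in> vertices P" and aV: "a \<in> vertices P" using a b by (auto simp: top_def bot_def)
  have "convex (monotone_path_polytope P l)"
    unfolding monotone_path_polytope_eq[OF assms]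
    by (rule convex_scaling[OF convex_section_integrals[OF convex linear]])
  moreover have "path_means a b \<subseteq> monotone_path_polytope P l"
    unfolding monotone_path_polytope_eq[OF assms] path_means_def
    using section_path bV by fastforce
  ultimately show "convex hull (path_means a b) \<subseteq> monotone_path_polytope P l" by (rule hull_minimal[rotated])
  show "monotone_path_polytope P l \<subseteq> convex hull (path_means a b)"
  proof (rule ccontr)
    assume "\<not> ?thesis"
    then obtain I where I: "I \<in> section_integrals P l a b" "?c *\<^sub>R I \<notin> convex hull (path_means a b)"
      unfolding monotone_path_polytope_eq[OF assms] by blast
    have cl: "closed (convex hull (path_means a b))"
      using finite_path_means[OF b] by (simp add: compact_convex_hull compact_imp_closed finite_imp_compact)
    obtain n \<beta> where n: "n \<bullet> (?c *\<^sub>R I) < \<beta>" "\<And>x. x \<in> convex hull (path_means a b) \<Longrightarrow> \<beta> < n \<bullet> x"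
      using separating_hyperplane_closed_point[OF convex_convex_hull cl I(2)] by blast
    \<comment> \<open>No edge enters the bottom, which makes the slope condition of
      \<open>lower_path_exists\<close> vacuous at \<open>a\<close>.\<close>
    have "\<not> directed_edge P l u a" for u
      using directed_edgeD[of u a] a vertices_subset by (force simp: bot_def)
    then obtain k p s where p: "p 0 = a" "p k = b" "mono_path P l k p"
      "\<forall>i<k. n \<bullet> p (Suc i) - n \<bullet> p i = s i * (l (p (Suc i)) - l (p i)) \<and>
        (\<forall>x\<in>P. n \<bullet> p i - s i * l (p i) \<le> n \<bullet> x - s i * l x)"
      using lower_path_exists[OF linear_inner_right[of n] b aV] by metis
    have "n \<bullet> path_integral l p 0 k \<le> n \<bullet> I"
      by (rule section_integral_ge[OF p(3) linear_inner_right, where s = s]) (use p I(1) in auto)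
    moreover have "0 \<le> ?c" using b aV vertices_subset by (auto simp: top_def)
    ultimately have "n \<bullet> (?c *\<^sub>R path_integral l p 0 k) \<le> n \<bullet> (?c *\<^sub>R I)"
      by (simp add: mult_left_mono divide_right_mono)
    moreover have "?c *\<^sub>R path_integral l p 0 k \<in> convex hull (path_means a b)"
      using p by (intro hull_inc) (auto simp: path_means_def)
    ultimately show False using n by fastforce
  qed
qed

lemma polytope_monotone_path_polytope:
  assumes "bot a" "top b" "a \<noteq> b"
  shows "polytope (monotone_path_polytope P l)" "vertices (monotone_path_polytope P l) \<subseteq> path_means a b"
  using finite_path_means[OF assms(2)]
  by (auto simp: monotone_path_polytope_hull[OF assms] vertices_def polytope_convex_hull
      dest: extreme_point_of_convex_hull)

end

section \<open>The vertex of a monotone path\<close>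

text \<open>\<open>q\<close> fixes a point of each covering face outside the edge, so that the rays
  below are definite vectors.\<close>

locale stratified_path = stratified_polytope +
  fixes k :: nat and p :: "nat \<Rightarrow> 'a" and q :: "nat \<Rightarrow> 'a set \<Rightarrow> 'a"
  assumes path: "mono_path P l k p" and path_bot: "bot (p 0)" and path_top: "top (p k)"
    and path_pos: "0 < k"
    and q: "\<And>i T. T \<in> covers (closed_segment (p i) (p (Suc i))) (Fm (p (Suc i)) \<inter> Fp (p i)) \<Longrightarrow>
      q i T \<in> T - closed_segment (p i) (p (Suc i))"
begin

definition edge :: "nat \<Rightarrow> 'a set" where "edge i = closed_segment (p i) (p (Suc i))"
definition block :: "nat \<Rightarrow> 'a set" where "block i = Fm (p (Suc i)) \<inter> Fp (p i)"
text \<open>The velocity of the section along the edge, normalized to \<open>l (dir i) = 1\<close>;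
  the value of a functional on it is the slope of the edge.\<close>

definition dir :: "nat \<Rightarrow> 'a" where
  "dir i = (1 / (l (p (Suc i)) - l (p i))) *\<^sub>R (p (Suc i) - p i)"
definition rho :: "nat \<Rightarrow> 'a" where "rho i = dir (Suc i) - dir i"
definition tau :: "nat \<Rightarrow> 'a set \<Rightarrow> 'a" where
  "tau i T = q i T - p i - (l (q i T) - l (p i)) *\<^sub>R dir i"

text \<open>\<open>rho\<close> bends the path at an inner vertex, \<open>tau\<close> replaces an edge by a detour through a face
  covering it; these turn out to span the edges of the monotone path polytope at \<open>path_mean\<close>.\<close>

definition rays :: "(nat + nat \<times> 'a set) set" where
  "rays = {..<k - 1} <+> (SIGMA i:{..<k}. covers (edge i) (block i))"
definition ray :: "nat + nat \<times> 'a set \<Rightarrow> 'a" where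
  "ray = case_sum rho (\<lambda>(i, T). tau i T)"
definition path_mean :: 'a where
  "path_mean = (1 / (l (p k) - l (p 0))) *\<^sub>R path_integral l p 0 k"

section \<open>Independence and extremality of the rays\<close>

lemma edgeD:
  assumes "i < k"
  shows "directed_edge P l (p i) (p (Suc i))" "p i \<in> vertices P" "p (Suc i) \<in> vertices P"
    "l (p i) < l (p (Suc i))" "edge i face_of block i" "block i face_of P" "aff_dim (edge i) = 1"
    "polytope (block i)" "p i \<in> edge i" "p (Suc i) \<in> edge i" "p i \<in> block i" "p (Suc i) \<in> block i"
proof -
  note e = mono_pathD[OF path assms]
  show "directed_edge P l (p i) (p (Suc i))" "p i \<in> vertices P" "p (Suc i) \<in> vertices P"
    "l (p i) < l (p (Suc i))" by (rule e)+
  show I: "edge i face_of block i" "block i face_of P"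
    unfolding edge_def block_def by (rule edge_face_interval[OF e(1)])+
  show "aff_dim (edge i) = 1" using directed_edgeD(5)[OF e(1)] by (simp add: edge_def)
  show "polytope (block i)" using I polytope face_of_polytope_polytope by blast
  show pe: "p i \<in> edge i" "p (Suc i) \<in> edge i" by (auto simp: edge_def)
  show "p i \<in> block i" "p (Suc i) \<in> block i" using pe face_of_imp_subset[OF I(1)] by auto
qed

lemma qD: "T \<in> covers (edge i) (block i) \<Longrightarrow> q i T \<in> T - edge i"
  unfolding edge_def block_def by (rule q)

lemma q_block: "T \<in> covers (edge i) (block i) \<Longrightarrow> q i T \<in> block i"
  using qD[of T i] by (auto simp: covers_def dest: face_of_imp_subset)

lemma l_dir: "i < k \<Longrightarrow> l (dir i) = 1"
  using edgeD(4)[of i] by (simp add: dir_def linear_cmul[OF linear] linear_diff[OF linear] flip: diff_divide_distrib)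

lemma scale_dir: "i < k \<Longrightarrow> (l (p (Suc i)) - l (p i)) *\<^sub>R dir i = p (Suc i) - p i"
  using edgeD(4)[of i] by (simp add: dir_def)

lemma l_rho: "Suc i < k \<Longrightarrow> l (rho i) = 0"
  by (simp add: rho_def linear_diff[OF linear] l_dir)

lemma l_tau: "i < k \<Longrightarrow> l (tau i T) = 0"
  by (simp add: tau_def linear_diff[OF linear] linear_cmul[OF linear] l_dir)

lemma dir_block: "i < k \<Longrightarrow> dir i \<in> dirspace (block i)"
  unfolding dir_def using edgeD[of i] by (intro subspace_scale dirspace_diff) auto

lemma tau_block: "i < k \<Longrightarrow> T \<in> covers (edge i) (block i) \<Longrightarrow> tau i T \<in> dirspace (block i)"
  unfolding tau_def using edgeD[of i] q_block[of T i] dir_block[of i]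
  by (intro subspace_diff[OF subspace_dirspace] subspace_scale dirspace_diff) auto

lemma rays_cases:
  assumes "x \<in> rays"
  obtains (bend) i where "x = Inl i" "Suc i < k" "ray x = rho i"
  | (detour) i T where "x = Inr (i, T)" "i < k" "T \<in> covers (edge i) (block i)" "ray x = tau i T"
  using assms by (force simp: rays_def ray_def)

lemma finite_rays: "finite rays"
  unfolding rays_def using edgeD(8) by (auto intro!: finite_covers)

lemma card_rays: "card rays = (k - 1) + (\<Sum>i<k. card (covers (edge i) (block i)))"
proof -
  have fin: "\<forall>i\<in>{..<k}. finite (covers (edge i) (block i))" using edgeD(8) finite_covers by blast
  then show ?thesis
    unfolding rays_def by (subst card_Plus) (auto intro!: card_SigmaI)
qed

lemma linear_const_edge:
  fixes \<phi> :: "'a \<Rightarrow> real"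
  assumes "linear \<phi>" "\<phi> (p (Suc i)) = \<phi> (p i)" "x \<in> edge i"
  shows "\<phi> x = \<phi> (p i)"
proof -
  obtain u where "x = (1 - u) *\<^sub>R p i + u *\<^sub>R p (Suc i)"
    using assms(3) by (auto simp: edge_def closed_segment_def)
  then have "\<phi> x = (1 - u) * \<phi> (p i) + u * \<phi> (p (Suc i))"
    by (simp only: linear_add[OF assms(1)] linear_cmul[OF assms(1)] real_scaleR_def)
  then show ?thesis using assms(2) by (simp add: algebra_simps)
qed

text \<open>On block \<open>i\<close> the functional is prescribed as
  \<open>g i x + s i * l x\<close>. Since \<open>g i\<close> vanishes on \<open>dir i\<close> and
  \<open>l\<close> on the detours, the slopes \<open>s\<close> alone determine the values on the
  bends and the \<open>g i\<close> alone those on the detours.\<close>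

lemma functional_on_rays:
  fixes g :: "nat \<Rightarrow> 'a \<Rightarrow> real" and s :: "nat \<Rightarrow> real"
  assumes g: "\<And>i. linear (g i)" "\<And>i. i < k \<Longrightarrow> g i (p (Suc i)) = g i (p i)"
  obtains \<theta> where "linear \<theta>" "\<And>i. Suc i < k \<Longrightarrow> \<theta> (rho i) = s (Suc i) - s i"
    "\<And>i T. i < k \<Longrightarrow> T \<in> covers (edge i) (block i) \<Longrightarrow> \<theta> (tau i T) = g i (q i T) - g i (p i)"
proof -
  have pk: "p k \<in> vertices P" using path_top by (simp add: top_def)
  have "\<exists>\<theta>::'a \<Rightarrow> real. linear \<theta> \<and>
    (\<forall>i<k. \<forall>x\<in>dirspace (Fm (p (Suc i)) \<inter> Fp (p i)). \<theta> x = 1 * g i x + s i * l x)"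
    by (rule path_extension[OF path pk linear_combine[OF g(1) linear] order_refl])
  then obtain \<theta> :: "'a \<Rightarrow> real" where \<theta>: "linear \<theta>"
    "\<And>i x. i < k \<Longrightarrow> x \<in> dirspace (block i) \<Longrightarrow> \<theta> x = g i x + s i * l x"
    by (auto simp: block_def)
  have gd: "g i (dir i) = 0" if "i < k" for i
    using g(2)[OF that] by (simp add: dir_def linear_cmul[OF g(1)] linear_diff[OF g(1)])
  have d: "\<theta> (dir i) = s i" if "i < k" for i
    using \<theta>(2)[OF that dir_block[OF that]] gd[OF that] l_dir[OF that] by simp
  show ?thesis
  proof (rule that[OF \<theta>(1)])
    show "\<theta> (rho i) = s (Suc i) - s i" if "Suc i < k" for i
      using d[of i] d[of "Suc i"] that by (simp add: rho_def linear_diff[OF \<theta>(1)])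
    show "\<theta> (tau i T) = g i (q i T) - g i (p i)" if "i < k" "T \<in> covers (edge i) (block i)" for i T
      using \<theta>(2)[OF that(1) tau_block[OF that]] l_tau[OF that(1)] gd[OF that(1)]
      by (simp add: tau_def linear_diff[OF g(1)] linear_cmul[OF g(1)])
  qed
qed

lemma exposing_edges:
  obtains g :: "nat \<Rightarrow> 'a \<Rightarrow> real" where "\<And>i. linear (g i)" "\<And>i. i < k \<Longrightarrow> g i (p (Suc i)) = g i (p i)"
    "\<And>i T. i < k \<Longrightarrow> T \<in> covers (edge i) (block i) \<Longrightarrow> g i (p i) < g i (q i T)"
proof -
  have "\<exists>g::'a \<Rightarrow> real. linear g \<and> (i < k \<longrightarrow> g (p (Suc i)) = g (p i) \<and>
      (\<forall>T\<in>covers (edge i) (block i). g (p i) < g (q i T)))" for i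
  proof (cases "i < k")
    case True
    obtain g :: "'a \<Rightarrow> real" and c where g: "linear g" "\<And>x. x \<in> edge i \<Longrightarrow> g x = c"
      "\<And>x. x \<in> block i \<Longrightarrow> x \<notin> edge i \<Longrightarrow> c < g x"
      using exposing_functional[OF edgeD(8,5)[OF True]] by blast
    have "g (p (Suc i)) = g (p i)" "g (p i) = c" using g(2) edgeD(9,10)[OF True] by auto
    moreover have "c < g (q i T)" if "T \<in> covers (edge i) (block i)" for T
      using g(3) q_block[OF that] qD[OF that] by blast
    ultimately show ?thesis using g(1) by auto
  next
    case False
    then show ?thesis using linear by blast
  qed
  then obtain g where "\<And>i. linear (g i) \<and> (i < k \<longrightarrow> g i (p (Suc i)) = (g i (p i) :: real) \<and>
      (\<forall>T\<in>covers (edge i) (block i). g i (p i) < g i (q i T)))" by metis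
  then show ?thesis by (intro that[of g]) auto
qed

lemma rays_pointed: "\<exists>\<psi>. linear \<psi> \<and> (\<forall>x\<in>rays. 0 < (\<psi> (ray x) :: real))"
proof -
  obtain g :: "nat \<Rightarrow> 'a \<Rightarrow> real" where g: "\<And>i. linear (g i)" "\<And>i. i < k \<Longrightarrow> g i (p (Suc i)) = g i (p i)"
    "\<And>i T. i < k \<Longrightarrow> T \<in> covers (edge i) (block i) \<Longrightarrow> g i (p i) < g i (q i T)"
    using exposing_edges by blast
  obtain \<theta> where \<theta>: "linear \<theta>" "\<And>i. Suc i < k \<Longrightarrow> \<theta> (rho i) = real (Suc i) - real i"
    "\<And>i T. i < k \<Longrightarrow> T \<in> covers (edge i) (block i) \<Longrightarrow> \<theta> (tau i T) = g i (q i T) - g i (p i)"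
    using functional_on_rays[OF g(1,2), of real] by blast
  have "0 < \<theta> (ray x)" if "x \<in> rays" for x
    using that by (cases rule: rays_cases) (use \<theta>(2,3) g(3) in auto)
  then show ?thesis using \<theta>(1) by blast
qed

lemma rays_exposed:
  assumes "x \<in> rays"
  shows "\<exists>\<psi>. linear \<psi> \<and> \<psi> (ray x) = 0 \<and> (\<forall>y\<in>rays - {x}. 0 < (\<psi> (ray y) :: real))"
proof -
  obtain g :: "nat \<Rightarrow> 'a \<Rightarrow> real" where g: "\<And>i. linear (g i)" "\<And>i. i < k \<Longrightarrow> g i (p (Suc i)) = g i (p i)"
    "\<And>i T. i < k \<Longrightarrow> T \<in> covers (edge i) (block i) \<Longrightarrow> g i (p i) < g i (q i T)"
    using exposing_edges by blast
  show ?thesis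
    using assms
  proof (cases rule: rays_cases)
    case (bend j)
    \<comment> \<open>Slopes increase by one at each bend except bend \<open>j\<close>, where they
      stay equal.\<close>
    let ?s = "\<lambda>i. real i - (if i > j then 1 else 0)"
    obtain \<theta> where \<theta>: "linear \<theta>" "\<And>i. Suc i < k \<Longrightarrow> \<theta> (rho i) = ?s (Suc i) - ?s i"
      "\<And>i T. i < k \<Longrightarrow> T \<in> covers (edge i) (block i) \<Longrightarrow> \<theta> (tau i T) = g i (q i T) - g i (p i)"
      using functional_on_rays[OF g(1,2), of ?s] by blast
    have "\<theta> (ray x) = 0" using \<theta>(2)[of j] bend by simp
    moreover have "0 < \<theta> (ray y)" if "y \<in> rays - {x}" for y
    proof -
      have "y \<in> rays" using that by simp
      then show ?thesis
      proof (cases rule: rays_cases)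
        case (bend i)
        then have "i \<noteq> j" using that \<open>x = Inl j\<close> by auto
        then show ?thesis using \<theta>(2)[of i] bend by auto
      next
        case (detour i T)
        then show ?thesis using \<theta>(3) g(3) by simp
      qed
    qed
    ultimately show ?thesis using \<theta>(1) by blast
  next
    case (detour j T)
    have jk: "j < k" by fact
    note T = \<open>T \<in> covers (edge j) (block j)\<close>
    then have Tf: "T face_of block j" "edge j \<subseteq> T" by (auto simp: covers_def)
    \<comment> \<open>On block \<open>j\<close> the functional exposing the edge is replaced by one
      exposing the larger face \<open>T\<close>; it vanishes on the detour through \<open>T\<close>
      and stays positive on the others.\<close>
    obtain h :: "'a \<Rightarrow> real" and c where h: "linear h" "\<And>x. x \<in> T \<Longrightarrow> h x = c"
      "\<And>x. x \<in> block j \<Longrightarrow> x \<notin> T \<Longrightarrow> c < h x"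
      using exposing_functional[OF edgeD(8)[OF jk] Tf(1)] by blast
    have hp: "h (p j) = c" "h (p (Suc j)) = c" using h(2) Tf(2) edgeD(9,10)[OF jk] by auto
    have hT: "h (q j T) = c" using h(2) qD[OF T] by auto
    have hS: "c < h (q j S)" if S: "S \<in> covers (edge j) (block j)" "S \<noteq> T" for S
    proof -
      have "q j S \<notin> T"
      proof
        assume "q j S \<in> T"
        then have "S \<subseteq> T"
          using cover_subset_face[OF edgeD(8,5)[OF jk] S(1) Tf, of "q j S"] qD[OF S(1)] by auto
        moreover have "polytope T" using Tf(1) edgeD(8)[OF jk] face_of_polytope_polytope by blast
        moreover have "S face_of T" "aff_dim T \<le> aff_dim S"
          using S(1) T \<open>S \<subseteq> T\<close> by (auto simp: covers_def face_of_face[OF Tf(1)])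
        ultimately show False using face_eqI S(2) by blast
      qed
      then show ?thesis using h(3) q_block[OF S(1)] by blast
    qed
    let ?g = "\<lambda>i. if i = j then h else g i"
    have lin: "linear (?g i)" for i using h(1) g(1) by simp
    have g2: "?g i (p (Suc i)) = ?g i (p i)" if "i < k" for i using hp g(2)[OF that] by simp
    obtain \<theta> where \<theta>: "linear \<theta>" "\<And>i. Suc i < k \<Longrightarrow> \<theta> (rho i) = real (Suc i) - real i"
      "\<And>i T. i < k \<Longrightarrow> T \<in> covers (edge i) (block i) \<Longrightarrow> \<theta> (tau i T) = ?g i (q i T) - ?g i (p i)"
      using functional_on_rays[where g = ?g and s = real, OF lin g2] by blast
    have "\<theta> (ray x) = 0" using \<theta>(3)[OF jk T] hT hp detour by simp
    moreover have "0 < \<theta> (ray y)" if "y \<in> rays - {x}" for y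
    proof -
      have "y \<in> rays" using that by simp
      then show ?thesis
      proof (cases rule: rays_cases)
        case (bend i)
        then show ?thesis using \<theta>(2)[of i] by simp
      next
        case (detour i S)
        then show ?thesis
          using \<theta>(3)[of i S] g(3)[of i S] hS[of S] hp that \<open>x = Inr (j, T)\<close> by (cases "i = j") auto
      qed
    qed
    ultimately show ?thesis using \<theta>(1) by blast
  qed
qed

lemma length_pos: "l (p 0) < l (p k)"
  using mono_path_strict[OF path path_pos] by simp

lemma ends_neq: "p 0 \<noteq> p k"
  using length_pos by auto

lemma mpp_eq:
  "monotone_path_polytope P l = (\<lambda>I. (1 / (l (p k) - l (p 0))) *\<^sub>R I) ` section_integrals P l (p 0) (p k)"
  by (rule monotone_path_polytope_eq[OF path_bot path_top ends_neq])

lemma pk_vertex: "p k \<in> vertices P"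
  using path_top by (simp add: top_def)

text \<open>Nonnegativity on the bends makes the slopes nondecreasing, and nonnegativity on the
  detours makes the path lowest within each block by \<open>linear_ge_from_covers\<close>. Then
  \<open>path_lower\<close> and \<open>section_integral_ge\<close> show that no section does
  better.\<close>

lemma rays_dual:
  assumes \<psi>: "linear \<psi>" "\<And>x. x \<in> rays \<Longrightarrow> 0 \<le> (\<psi> (ray x) :: real)"
    and y: "y \<in> monotone_path_polytope P l"
  shows "\<psi> path_mean \<le> \<psi> y"
proof -
  obtain I where I: "I \<in> section_integrals P l (p 0) (p k)" "y = (1 / (l (p k) - l (p 0))) *\<^sub>R I"
    using y by (auto simp: mpp_eq)
  define s where "s i = \<psi> (dir i)" for i
  have slope: "\<psi> (p (Suc i)) - \<psi> (p i) = s i * (l (p (Suc i)) - l (p i))" if "i < k" for i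
  proof -
    have "\<psi> (p (Suc i)) - \<psi> (p i) = \<psi> ((l (p (Suc i)) - l (p i)) *\<^sub>R dir i)"
      unfolding scale_dir[OF that] by (simp add: linear_diff[OF \<psi>(1)])
    then show ?thesis by (simp add: s_def linear_cmul[OF \<psi>(1)])
  qed
  have mono: "s i \<le> s (Suc i)" if "Suc i < k" for i
  proof -
    have "Inl i \<in> rays" using that by (auto simp: rays_def)
    from \<psi>(2)[OF this] show ?thesis
      by (simp add: ray_def rho_def s_def linear_diff[OF \<psi>(1)])
  qed
  have loc: "\<psi> (p i) - s i * l (p i) \<le> \<psi> x - s i * l x"
    if i: "i < k" and x: "x \<in> Fm (p (Suc i)) \<inter> Fp (p i)" for i x
  proof -
    let ?\<phi> = "\<lambda>x. 1 * \<psi> x + (- s i) * l x"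
    have lin: "linear ?\<phi>" by (rule linear_combine[OF \<psi>(1) linear])
    have "?\<phi> (p i) \<le> ?\<phi> x"
    proof (rule linear_ge_from_covers[OF edgeD(8,5,9)[OF i] qD lin linear_const_edge[OF lin]])
      show "?\<phi> (p (Suc i)) = ?\<phi> (p i)" using slope[OF i] by (simp add: algebra_simps)
      show "?\<phi> (p i) \<le> ?\<phi> (q i T)" if T: "T \<in> covers (edge i) (block i)" for T
      proof -
        have "Inr (i, T) \<in> rays" using i T by (auto simp: rays_def)
        from \<psi>(2)[OF this] show ?thesis
          by (simp add: ray_def tau_def s_def linear_diff[OF \<psi>(1)] linear_cmul[OF \<psi>(1)] left_diff_distrib
              mult.commute[of "\<psi> (dir i)"])
      qed
      show "x \<in> block i" using x by (simp add: block_def)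
    qed
    then show ?thesis by simp
  qed
  have low: "\<psi> (p i) - s i * l (p i) \<le> \<psi> x - s i * l x" if "i < k" "x \<in> P" for i x
    by (rule path_lower[OF path path_bot path_top \<psi>(1) slope mono loc that])
  have "\<psi> (path_integral l p 0 k) \<le> \<psi> I"
    by (rule section_integral_ge[OF path \<psi>(1) slope low I(1)])
  then show ?thesis
    using length_pos by (simp add: path_mean_def I(2) linear_cmul[OF \<psi>(1)] divide_right_mono)
qed

lemma path_mean_in: "path_mean \<in> monotone_path_polytope P l"
  using section_path[OF path pk_vertex, of 0 k] by (auto simp: mpp_eq path_mean_def)

lemma ray_attained:
  assumes ij: "i \<le> j" "j \<le> k" and K: "K \<in> section_integrals P l (p i) (p j)"
    and r: "K - path_integral l p i j = c *\<^sub>R r" "0 < c"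
  shows "\<exists>\<epsilon>>0. path_mean + \<epsilon> *\<^sub>R r \<in> monotone_path_polytope P l"
proof (intro exI conjI)
  let ?c = "1 / (l (p k) - l (p 0))"
  show "0 < ?c * c" using length_pos r(2) by simp
  have "path_integral l p 0 k + c *\<^sub>R r \<in> section_integrals P l (p 0) (p k)"
    using section_replace[OF path pk_vertex ij K] r(1) by simp
  then have "?c *\<^sub>R (path_integral l p 0 k + c *\<^sub>R r) \<in> monotone_path_polytope P l"
    unfolding mpp_eq by (rule imageI)
  then show "path_mean + (?c * c) *\<^sub>R r \<in> monotone_path_polytope P l"
    by (simp add: path_mean_def scaleR_add_right)
qed

lemma rays_attained:
  assumes "x \<in> rays"
  shows "\<exists>\<epsilon>>0. path_mean + \<epsilon> *\<^sub>R ray x \<in> monotone_path_polytope P l"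
  using assms
proof (cases rule: rays_cases)
  case (detour i T)
  have i: "i < k" and T: "T \<in> covers (edge i) (block i)" by fact+
  note E = edgeD[OF i]
  \<comment> \<open>The edge is replaced by the two segments through \<open>y\<close>, which need
    not be a vertex. The integral changes by half the length of the edge in \<open>l\<close> times
    \<open>tau i T\<close>.\<close>
  define v w y where "v = p i" and "w = p (Suc i)" and "y = q i T"
  have yI: "y \<in> Fm w" "y \<in> Fp v" "y \<noteq> v" "y \<noteq> w"
    using q_block[OF T] qD[OF T] E(9,10) by (auto simp: block_def v_def w_def y_def)
  have P: "v \<in> P" "w \<in> P" "y \<in> P"
    using E vertex_in face_of_imp_subset[OF E(6)] q_block[OF T] by (auto simp: v_def w_def y_def)
  interpret B: stratified_polytope "block i" l "\<lambda>x. Fm x \<inter> block i" "\<lambda>x. Fp x \<inter> block i"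
    by (rule stratified_face[OF E(6)])
  have "l v \<le> l x" "l x \<le> l w" if "x \<in> block i" for x
    using that Fm_le[OF E(3)] Fp_ge[OF E(2)] by (auto simp: block_def v_def w_def)
  then have "B.top w" "B.bot v"
    using E(2,3,11,12) vertices_face[OF E(6)] by (auto simp: B.top_def B.bot_def v_def w_def)
  then have lt: "l v < l y" "l y < l w"
    using B.top_unique[of w y] B.bot_unique[of v y] yI q_block[OF T] by (force simp: y_def)+
  define \<alpha> \<beta> where "\<alpha> = l y - l v" and "\<beta> = l w - l y"
  have \<alpha>\<beta>: "\<alpha> > 0" "\<beta> > 0" "l w - l v = \<alpha> + \<beta>" using lt by (auto simp: \<alpha>_def \<beta>_def)
  have w: "w = v + (\<alpha> + \<beta>) *\<^sub>R dir i"
    using scale_dir[OF i] \<alpha>\<beta>(3) by (simp add: v_def w_def)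
  have y: "y = v + \<alpha> *\<^sub>R dir i + tau i T" by (simp add: tau_def \<alpha>_def v_def y_def)
  have "(\<alpha> / 2) *\<^sub>R (v + y) \<in> section_integrals P l v y"
    unfolding \<alpha>_def by (rule section_segment[OF convex P(1,3) linear lt(1)])
  moreover have "(\<beta> / 2) *\<^sub>R (y + w) \<in> section_integrals P l y w"
    unfolding \<beta>_def by (rule section_segment[OF convex P(3,2) linear lt(2)])
  ultimately have "(\<alpha> / 2) *\<^sub>R (v + y) + (\<beta> / 2) *\<^sub>R (y + w) \<in> section_integrals P l v w"
    using lt by (intro section_append) auto
  moreover have "(\<alpha> / 2) *\<^sub>R (v + y) + (\<beta> / 2) *\<^sub>R (y + w) - path_integral l p i (Suc i)
      = ((\<alpha> + \<beta>) / 2) *\<^sub>R tau i T"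
  proof -
    define A B where "A = \<alpha> / 2" and "B = \<beta> / 2"
    have AB: "\<alpha> / 2 = A" "\<beta> / 2 = B" "(\<alpha> + \<beta>) / 2 = A + B" "\<alpha> = 2 * A" "\<beta> = 2 * B"
      by (simp_all add: A_def B_def)
    have "path_integral l p i (Suc i) = (A + B) *\<^sub>R (v + w)"
      unfolding AB(3)[symmetric] using \<alpha>\<beta>(3) by (simp add: path_integral_def v_def w_def)
    moreover have "A *\<^sub>R (v + y) + B *\<^sub>R (y + w) - (A + B) *\<^sub>R (v + w) = (A + B) *\<^sub>R y - B *\<^sub>R v - A *\<^sub>R w"
      by (simp add: algebra_simps)
    moreover have "(A + B) *\<^sub>R y - B *\<^sub>R v - A *\<^sub>R w = (A + B) *\<^sub>R tau i T"
      unfolding w y AB(4,5) by (simp add: algebra_simps)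
    ultimately show ?thesis unfolding AB(1-3) by simp
  qed
  ultimately show ?thesis
    using ray_attained[of i "Suc i" _ "(\<alpha> + \<beta>) / 2" "tau i T"] i \<alpha>\<beta> detour(4)
    by (simp add: v_def w_def)
next
  case (bend i)
  have i: "Suc i < k" "i < k" using bend by auto
  note E = edgeD[OF i(2)] and E' = edgeD[OF i(1)]
  define u v w where "u = p i" and "v = p (Suc i)" and "w = p (Suc (Suc i))"
  have P: "u \<in> P" "v \<in> P" "w \<in> P" using E E' vertex_in by (auto simp: u_def v_def w_def)
  define \<alpha> \<beta> where "\<alpha> = l v - l u" and "\<beta> = l w - l v"
  have \<alpha>\<beta>: "\<alpha> > 0" "\<beta> > 0" using E(4) E'(4) by (auto simp: \<alpha>_def \<beta>_def u_def v_def w_def)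
  have v: "v = u + \<alpha> *\<^sub>R dir i" using scale_dir[OF i(2)] by (simp add: \<alpha>_def u_def v_def)
  have w: "w = v + \<beta> *\<^sub>R dir (Suc i)" using scale_dir[OF i(1)] by (simp add: \<beta>_def w_def v_def)
  \<comment> \<open>The vertex \<open>v\<close> is moved to \<open>v'\<close> on the same level, the
    midpoint of two points at distance \<delta> in \<open>l\<close> from \<open>v\<close> on the
    adjacent edges; the minimum keeps both on their edges.\<close>
  define \<delta> where "\<delta> = min \<alpha> \<beta>"
  have \<delta>: "0 < \<delta>" "\<delta> / \<alpha> \<le> 1" "\<delta> / \<beta> \<le> 1" using \<alpha>\<beta> by (auto simp: \<delta>_def)
  define v' where "v' = v + (\<delta> / 2) *\<^sub>R rho i"
  have "v - \<delta> *\<^sub>R dir i = (1 - \<delta> / \<alpha>) *\<^sub>R v + (\<delta> / \<alpha>) *\<^sub>R u"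
    using \<alpha>\<beta> unfolding v by (simp add: algebra_simps)
  then have m1: "v - \<delta> *\<^sub>R dir i \<in> P"
    using convexD[OF convex P(2,1), of "1 - \<delta> / \<alpha>" "\<delta> / \<alpha>"] \<delta> \<alpha>\<beta> by simp
  have "v + \<delta> *\<^sub>R dir (Suc i) = (1 - \<delta> / \<beta>) *\<^sub>R v + (\<delta> / \<beta>) *\<^sub>R w"
    using \<alpha>\<beta> unfolding w by (simp add: algebra_simps)
  then have m2: "v + \<delta> *\<^sub>R dir (Suc i) \<in> P"
    using convexD[OF convex P(2,3), of "1 - \<delta> / \<beta>" "\<delta> / \<beta>"] \<delta> \<alpha>\<beta> by simp
  have "2 *\<^sub>R v' = 2 *\<^sub>R ((1/2) *\<^sub>R (v - \<delta> *\<^sub>R dir i) + (1/2) *\<^sub>R (v + \<delta> *\<^sub>R dir (Suc i)))"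
    by (simp add: v'_def rho_def algebra_simps scaleR_2)
  then have "v' = (1/2) *\<^sub>R (v - \<delta> *\<^sub>R dir i) + (1/2) *\<^sub>R (v + \<delta> *\<^sub>R dir (Suc i))" by simp
  then have v'P: "v' \<in> P" using convexD[OF convex m1 m2, of "1/2" "1/2"] by simp
  have lv': "l v' = l v" using l_rho[OF i(1)] by (simp add: v'_def linear_add[OF linear] linear_cmul[OF linear])
  have "(\<alpha> / 2) *\<^sub>R (u + v') \<in> section_integrals P l u v'"
    using section_segment[OF convex P(1) v'P linear] lv' \<alpha>\<beta> by (simp add: \<alpha>_def)
  moreover have "(\<beta> / 2) *\<^sub>R (v' + w) \<in> section_integrals P l v' w"
    using section_segment[OF convex v'P P(3) linear] lv' \<alpha>\<beta> by (simp add: \<beta>_def)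
  ultimately have "(\<alpha> / 2) *\<^sub>R (u + v') + (\<beta> / 2) *\<^sub>R (v' + w) \<in> section_integrals P l u w"
    using lv' \<alpha>\<beta> by (intro section_append) (auto simp: \<alpha>_def \<beta>_def)
  moreover have "(\<alpha> / 2) *\<^sub>R (u + v') + (\<beta> / 2) *\<^sub>R (v' + w) - path_integral l p i (Suc (Suc i))
      = ((\<alpha> + \<beta>) / 2 * (\<delta> / 2)) *\<^sub>R rho i"
  proof -
    have "path_integral l p i (Suc (Suc i)) = (\<alpha> / 2) *\<^sub>R (u + v) + (\<beta> / 2) *\<^sub>R (v + w)"
      by (simp add: path_integral_def \<alpha>_def \<beta>_def u_def v_def w_def)
    then have "(\<alpha> / 2) *\<^sub>R (u + v') + (\<beta> / 2) *\<^sub>R (v' + w) - path_integral l p i (Suc (Suc i))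
      = ((\<alpha> + \<beta>) / 2) *\<^sub>R (v' - v)" by (simp add: algebra_simps add_divide_distrib)
    then show ?thesis by (simp add: v'_def)
  qed
  ultimately show ?thesis
    using ray_attained[of i "Suc (Suc i)" _ "(\<alpha> + \<beta>) / 2 * (\<delta> / 2)" "rho i"] i \<alpha>\<beta> \<delta> bend(3)
    by (simp add: u_def w_def)
qed

text \<open>Together with \<open>dir 0\<close> the rays generate all block directions in turn, hence
  all directions of \<open>P\<close>. All rays lie in the kernel of \<open>l\<close> and
  \<open>dir 0\<close> does not, so leaving it out loses exactly one dimension.\<close>

lemma dim_rays: "int (dim (ray ` rays)) = aff_dim P - 1"
proof -
  let ?W = "span (insert (dir 0) (ray ` rays))"
  have base: "y \<in> ?W" if "y \<in> insert (dir 0) (ray ` rays)" for y using that by (rule span_base)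
  have dirW: "dir i \<in> ?W" if "i < k" for i
    using that
  proof (induction i)
    case 0
    show ?case by (rule base) simp
  next
    case (Suc i)
    have "Inl i \<in> rays" "ray (Inl i) = rho i" using Suc.prems by (auto simp: rays_def ray_def)
    then have "rho i \<in> ?W" by (intro base) (metis imageI insertI2)
    moreover have "dir (Suc i) = dir i + rho i" by (simp add: rho_def)
    ultimately show ?case using Suc by (simp add: span_add)
  qed
  have blockW: "dirspace (block i) \<subseteq> ?W" if i: "i < k" for i
  proof (rule dirspace_subset_covers[OF edgeD(8,5,9)[OF i] qD])
    note E = edgeD[OF i]
    show "dirspace (edge i) \<subseteq> ?W"
    proof (rule dirspace_subset[OF E(9)])
      fix x assume "x \<in> edge i"
      then obtain t where "x = (1 - t) *\<^sub>R p i + t *\<^sub>R p (Suc i)"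
        by (auto simp: edge_def closed_segment_def)
      then have "x - p i = t *\<^sub>R (p (Suc i) - p i)" by (simp add: algebra_simps)
      also have "\<dots> = t *\<^sub>R (l (p (Suc i)) - l (p i)) *\<^sub>R dir i" by (simp add: scale_dir[OF i])
      finally show "x - p i \<in> ?W" using dirW[OF i] by (metis span_scale)
    qed (rule subspace_span)
    fix T assume T: "T \<in> covers (edge i) (block i)"
    have "Inr (i, T) \<in> rays" "ray (Inr (i, T)) = tau i T" using i T by (auto simp: rays_def ray_def)
    then have "tau i T \<in> ?W" by (intro base) (metis imageI insertI2)
    moreover have "q i T - p i = tau i T + (l (q i T) - l (p i)) *\<^sub>R dir i" by (simp add: tau_def)
    ultimately show "q i T - p i \<in> ?W" using dirW[OF i] by (simp add: span_add span_scale)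
  qed (assumption, rule subspace_span)
  have "dirspace (Fm (p m)) \<subseteq> ?W" if "m \<le> k" for m
    using that
  proof (induction m)
    case 0
    show ?case
      unfolding Fm_bot[OF path_bot] by (rule dirspace_subset[of "p 0", OF _ subspace_span]) (auto intro: span_0)
  next
    case (Suc m)
    then have m: "m < k" by simp
    note E = edgeD[OF m]
    note Q = Fm_face[OF E(3)]
    interpret Q: stratified_polytope "Fm (p (Suc m))" l "\<lambda>x. Fm x \<inter> Fm (p (Suc m))" "\<lambda>x. Fp x \<inter> Fm (p (Suc m))"
      by (rule stratified_face[OF Q])
    have v: "p m \<in> vertices (Fm (p (Suc m)))"
      using vertices_face[OF Q] E(2) edge_Fm[OF E(1)] by auto
    show ?case
    proof (rule dirspace_subset_edges[OF Q.polytope v])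
      fix z assume z: "closed_segment (p m) z edge_of Fm (p (Suc m))"
      from Q.edge_cases[OF z] have "z \<in> Fm (p m) \<or> z \<in> block m"
        using Q.edge_Fm Q.edge_Fp unfolding block_def by blast
      then show "z - p m \<in> ?W"
        using Suc.IH m blockW[OF m] Fm_self[OF E(2)] E(11)
          dirspace_diff[of z "Fm (p m)" "p m"] dirspace_diff[of z "block m" "p m"] by auto
    qed (rule subspace_span)
  qed
  from this[of k] have PW: "dirspace P \<subseteq> ?W" using Fm_top[OF path_top] by simp
  have blockP: "dirspace (block i) \<subseteq> dirspace P" if "i < k" for i
    by (rule dirspace_mono[OF face_of_imp_subset[OF edgeD(6)[OF that]]])
  have "ray x \<in> dirspace P" if "x \<in> rays" for x
    using that
  proof (cases rule: rays_cases)
    case (bend i)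
    then show ?thesis using dir_block[of i] dir_block[of "Suc i"] blockP[of i] blockP[of "Suc i"]
      unfolding bend(3) rho_def by (intro subspace_diff[OF subspace_dirspace]) auto
  next
    case (detour i T)
    then show ?thesis using tau_block[of i T] blockP[of i] by auto
  qed
  moreover have "dir 0 \<in> dirspace P" using dir_block[of 0] blockP[of 0] path_pos by auto
  ultimately have "?W \<subseteq> dirspace P" by (intro span_minimal) auto
  then have W: "?W = dirspace P" using PW by blast
  have "span (ray ` rays) \<subseteq> {x. l x = 0}"
  proof (rule span_minimal)
    show "subspace {x. l x = 0}" using linear by (rule linear_subspace_kernel)
    show "ray ` rays \<subseteq> {x. l x = 0}"
    proof clarify
      fix x assume "x \<in> rays"
      then show "l (ray x) = 0" by (cases rule: rays_cases) (simp_all add: l_rho l_tau)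
    qed
  qed
  then have "dir 0 \<notin> span (ray ` rays)" using l_dir[of 0] path_pos by auto
  then have "dim (insert (dir 0) (ray ` rays)) = dim (ray ` rays) + 1" by (simp add: dim_insert)
  moreover have "dim (insert (dir 0) (ray ` rays)) = dim (dirspace P)" using W by (metis dim_span)
  moreover have "aff_dim P = int (dim (dirspace P))"
    using aff_dim_dirspace[OF vertex_in[OF pk_vertex]] .
  ultimately show ?thesis by simp
qed

lemma simple_star_path_mean:
  shows "path_mean \<in> vertices (monotone_path_polytope P l)"
    "simple_star {path_mean} (monotone_path_polytope P l) \<longleftrightarrow>
      (\<forall>i<k. simple_star (edge i) (block i))"
proof -
  let ?M = "monotone_path_polytope P l"
  have M: "polytope ?M" by (rule polytope_monotone_path_polytope[OF path_bot path_top ends_neq])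
  note star = star_of_vertex_by_rays[OF M finite_rays path_mean_in rays_dual rays_attained rays_exposed rays_pointed]
  show v: "path_mean \<in> vertices ?M" by (rule star(1))
  have "simple_star {path_mean} ?M \<longleftrightarrow> int (card rays) = aff_dim P - 1"
    using simple_star_iff_card_covers[OF M vertex_face[OF v]] star(2,3) dim_rays by simp
  \<comment> \<open>The block dimensions add up to \<open>aff_dim P\<close>; the
    \<open>k - 1\<close> bends are absorbed by subtracting one in each of the \<open>k\<close>
    blocks.\<close>
  also have "\<dots> \<longleftrightarrow> (\<Sum>i<k. int (card (covers (edge i) (block i)))) = (\<Sum>i<k. aff_dim (block i) - 1)"
  proof -
    have "(\<Sum>i<k. aff_dim (block i)) = aff_dim P"
      using sum_aff_dim_path[OF path path_bot, of k] Fm_top[OF path_top] by (simp add: block_def)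
    then have "(\<Sum>i<k. aff_dim (block i) - 1) = aff_dim P - int k" by (simp add: sum_subtractf)
    moreover have "int (card rays) = int k - 1 + (\<Sum>i<k. int (card (covers (edge i) (block i))))"
      unfolding card_rays using path_pos by simp
    ultimately show ?thesis by linarith
  qed
  \<comment> \<open>Each summand on the left is at least the one on the right by
    \<open>aff_dim_le_covers\<close>, so equal sums force equality in every block.\<close>
  also have "\<dots> \<longleftrightarrow> (\<forall>i<k. int (card (covers (edge i) (block i))) = aff_dim (block i) - 1)"
  proof -
    have ge: "aff_dim (block i) - 1 \<le> int (card (covers (edge i) (block i)))" if "i < k" for i
      using aff_dim_le_covers[OF edgeD(8,5)[OF that]] edgeD(7,9)[OF that] by force
    have "aff_dim (block i) - 1 = int (card (covers (edge i) (block i)))"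
      if "(\<Sum>i<k. int (card (covers (edge i) (block i)))) = (\<Sum>i<k. aff_dim (block i) - 1)" "i < k" for i
      by (rule sum_mono_inv[OF that(1)[symmetric] ge]) (use that(2) in auto)
    then show ?thesis by auto
  qed
  also have "\<dots> \<longleftrightarrow> (\<forall>i<k. simple_star (edge i) (block i))"
  proof -
    have "simple_star (edge i) (block i) \<longleftrightarrow> int (card (covers (edge i) (block i))) = aff_dim (block i) - 1"
      if "i < k" for i
      using simple_star_iff_card_covers[OF edgeD(8,5)[OF that]] edgeD(7,9)[OF that] by force
    then show ?thesis by auto
  qed
  finally show "simple_star {path_mean} ?M \<longleftrightarrow> (\<forall>i<k. simple_star (edge i) (block i))" .
qed

end

section \<open>Simplicity at all vertices of the monotone path polytope\<close>

context stratified_polytope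
begin

lemma stratified_path_exists:
  assumes "mono_path P l k p" "bot (p 0)" "top (p k)" "p 0 \<noteq> p k"
  obtains q where "stratified_path P l Fm Fp k p q"
proof -
  define q where "q i T = (SOME x. x \<in> T - closed_segment (p i) (p (Suc i)))" for i T
  have q: "q i T \<in> T - closed_segment (p i) (p (Suc i))"
    if "T \<in> covers (closed_segment (p i) (p (Suc i))) (Fm (p (Suc i)) \<inter> Fp (p i))" for i T
    unfolding q_def by (rule someI_ex[OF covers_nonempty_diff[OF that]])
  have "0 < k" using assms(4) by (cases k) auto
  then have "stratified_path P l Fm Fp k p q"
    using assms q by unfold_locales auto
  then show ?thesis by (rule that)
qed

text \<open>Every directed edge lies on a path from bottom to top, whose mean is a vertex;
  conversely every vertex is the mean of such a path. So the criterion at one vertex reaches all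
  edges and all vertices.\<close>

lemma simple_monotone_path_polytope_iff:
  assumes a: "bot a" and b: "top b" and ab: "a \<noteq> b"
  shows "simple_polytope (monotone_path_polytope P l) \<longleftrightarrow>
    (\<forall>v w. directed_edge P l v w \<longrightarrow> simple_star (closed_segment v w) (Fm w \<inter> Fp v))"
proof
  assume simp: "simple_polytope (monotone_path_polytope P l)"
  show "\<forall>v w. directed_edge P l v w \<longrightarrow> simple_star (closed_segment v w) (Fm w \<inter> Fp v)"
  proof (intro allI impI)
    fix v w assume "directed_edge P l v w"
    then obtain k p i where p: "mono_path P l k p" "p 0 = a" "p k = b" "i < k" "p i = v" "p (Suc i) = w"
      using path_through_edge[OF _ a b] by blast
    obtain q where "stratified_path P l Fm Fp k p q"
      by (rule stratified_path_exists[OF p(1)]) (use p a b ab in auto)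
    then interpret R: stratified_path P l Fm Fp k p q .
    have "simple_star {R.path_mean} (monotone_path_polytope P l)"
      using simp R.simple_star_path_mean(1) by (auto simp: simple_polytope_def vertices_def)
    then have "simple_star (R.edge i) (R.block i)" using R.simple_star_path_mean(2) p(4) by blast
    then show "simple_star (closed_segment v w) (Fm w \<inter> Fp v)"
      using p(5,6) by (simp add: R.edge_def R.block_def)
  qed
next
  assume simp: "\<forall>v w. directed_edge P l v w \<longrightarrow> simple_star (closed_segment v w) (Fm w \<inter> Fp v)"
  note M = polytope_monotone_path_polytope[OF a b ab]
  show "simple_polytope (monotone_path_polytope P l)"
    unfolding simple_polytope_def
  proof (intro conjI M(1) allI impI)
    fix z assume "z extreme_point_of monotone_path_polytope P l"
    then have "z \<in> path_means a b" using M(2) by (auto simp: vertices_def)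
    then obtain k p where p: "mono_path P l k p" "p 0 = a" "p k = b"
      "z = (1 / (l b - l a)) *\<^sub>R path_integral l p 0 k" by (auto simp: path_means_def)
    obtain q where "stratified_path P l Fm Fp k p q"
      by (rule stratified_path_exists[OF p(1)]) (use p a b ab in auto)
    then interpret R: stratified_path P l Fm Fp k p q .
    have "z = R.path_mean" using p by (simp add: R.path_mean_def)
    moreover have "\<forall>i<k. simple_star (R.edge i) (R.block i)"
      using simp R.edgeD(1) by (simp add: R.edge_def R.block_def)
    ultimately show "simple_star {z} (monotone_path_polytope P l)"
      using R.simple_star_path_mean(2) by simp
  qed
qed

end

section \<open>Equivalence of the conditions\<close>

context stratified_polytope
begin

lemma triangles_count_iff_simple_star:
  assumes e: "directed_edge P l v w"
  shows "int (card (monotone_triangles P l v w)) = aff_dim (Fm w \<inter> Fp v) - 1 \<longleftrightarrow>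
    simple_star (closed_segment v w) (Fm w \<inter> Fp v)"
proof -
  note I = edge_face_interval[OF e]
  have "polytope (Fm w \<inter> Fp v)" using I(2) polytope face_of_polytope_polytope by blast
  then show ?thesis
    using simple_star_iff_card_covers[OF _ I(1)] directed_edgeD(5)[OF e]
    by (simp add: monotone_triangles_eq_covers[OF e])
qed

text \<open>\<open>v\<close> and \<open>w\<close> are the bottom and the top of the interval, so
  \<open>simple_star_if_edges_simple\<close> applies to it as a polytope. By transitivity an edge
  \<open>a\<close>, \<open>b\<close> of the interval has the same face
  \<open>Fm b \<inter> Fp a\<close> there as in \<open>P\<close>.\<close>

lemma simple_star_in_interval:
  assumes simp: "\<And>a b. directed_edge P l a b \<Longrightarrow> simple_star (closed_segment a b) (Fm b \<inter> Fp a)"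
    and F: "F face_of P" "F \<subseteq> Fp v \<inter> Fm w"
    and v: "v \<in> vertices P" "v \<in> F" and w: "w \<in> vertices P" "w \<in> F"
  shows "simple_star F (Fp v \<inter> Fm w)"
proof -
  let ?Q = "Fp v \<inter> Fm w"
  have Q: "?Q face_of P" using Fp_face Fm_face v w by (auto intro: face_of_Int)
  interpret Q: stratified_polytope ?Q l "\<lambda>x. Fm x \<inter> ?Q" "\<lambda>x. Fp x \<inter> ?Q"
    by (rule stratified_face[OF Q])
  show ?thesis
  proof (rule Q.simple_star_if_edges_simple)
    show "F face_of ?Q" using F by (simp add: face_of_face[OF Q])
    have "v \<in> vertices ?Q" "w \<in> vertices ?Q" using v w F(2) vertices_face[OF Q] by auto
    then show "Q.bot v" "Q.top w"
      using Fp_ge[OF v(1)] Fm_le[OF w(1)] by (auto simp: Q.bot_def Q.top_def)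
    fix a b assume "directed_edge ?Q l a b"
    then have e: "directed_edge P l a b" "a \<in> ?Q" "b \<in> ?Q" by (auto simp: directed_edge_face[OF Q])
    note V = directed_edgeD[OF e(1)]
    have "(Fm b \<inter> ?Q) \<inter> (Fp a \<inter> ?Q) = Fm b \<inter> Fp a"
      using Fm_trans[OF V(2) w(1)] Fp_trans[OF V(1) v(1)] e(2,3) by auto
    then show "simple_star (closed_segment a b) ((Fm b \<inter> ?Q) \<inter> (Fp a \<inter> ?Q))"
      using simp[OF e(1)] by simp
  qed (use v w in auto)
qed

end

section \<open>The closures of the strata\<close>

lemma face_subset_F_minus:
  assumes "G face_of P" "is_arg_max l (\<lambda>x. x \<in> G) v"
  shows "G \<subseteq> F_minus P l v"
proof -
  have "rel_interior G \<subseteq> O_minus P l v" using assms by (auto simp: O_minus_def)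
  then have "closure (rel_interior G) \<subseteq> F_minus P l v" unfolding F_minus_def by (rule closure_mono)
  then show ?thesis
    using convex_closure_rel_interior[OF face_of_imp_convex[OF assms(1)]] closure_subset[of G] by auto
qed

lemma face_subset_F_plus:
  assumes "G face_of P" "is_arg_min l (\<lambda>x. x \<in> G) v"
  shows "G \<subseteq> F_plus P l v"
proof -
  have "rel_interior G \<subseteq> O_plus P l v" using assms by (auto simp: O_plus_def)
  then have "closure (rel_interior G) \<subseteq> F_plus P l v" unfolding F_plus_def by (rule closure_mono)
  then show ?thesis
    using convex_closure_rel_interior[OF face_of_imp_convex[OF assms(1)]] closure_subset[of G] by auto
qed

lemma F_minus_le:
  assumes "linear l" "x \<in> F_minus P l v"
  shows "l x \<le> l v"
proof -
  have "O_minus P l v \<subseteq> {x. l x \<le> l v}"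
    using rel_interior_subset by (fastforce simp: O_minus_def is_arg_max_def not_less)
  moreover have "closed {x. l x \<le> l v}"
    by (intro closed_Collect_le continuous_intros linear_continuous_on)
      (use assms(1) linear_conv_bounded_linear in blast)
  ultimately have "F_minus P l v \<subseteq> {x. l x \<le> l v}" unfolding F_minus_def by (rule closure_minimal)
  then show ?thesis using assms(2) by auto
qed

lemma F_plus_ge:
  assumes "linear l" "x \<in> F_plus P l v"
  shows "l v \<le> l x"
proof -
  have "O_plus P l v \<subseteq> {x. l v \<le> l x}"
    using rel_interior_subset by (fastforce simp: O_plus_def is_arg_min_def not_less)
  moreover have "closed {x. l v \<le> l x}"
    by (intro closed_Collect_le continuous_intros linear_continuous_on)
      (use assms(1) linear_conv_bounded_linear in blast)
  ultimately have "F_plus P l v \<subseteq> {x. l v \<le> l x}" unfolding F_plus_def by (rule closure_minimal)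
  then show ?thesis using assms(2) by auto
qed

lemma linear_on_segment:
  fixes l :: "'a::euclidean_space \<Rightarrow> real"
  assumes "linear l" "l v \<le> l w" "x \<in> closed_segment v w"
  shows "l v \<le> l x" "l x \<le> l w"
proof -
  obtain u where u: "x = (1 - u) *\<^sub>R v + u *\<^sub>R w" "0 \<le> u" "u \<le> 1"
    using assms(3) by (auto simp: closed_segment_def)
  have x: "l x = (1 - u) * l v + u * l w"
    unfolding u(1) by (simp only: linear_add[OF assms(1)] linear_cmul[OF assms(1)] real_scaleR_def)
  have "u * l v \<le> u * l w" "(1 - u) * l v \<le> (1 - u) * l w"
    using assms(2) u by (auto intro: mult_left_mono)
  then show "l v \<le> l x" "l x \<le> l w" unfolding x by (simp_all add: algebra_simps)
qed

lemma directed_edge_arg: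
  assumes "linear l" "directed_edge P l v w"
  shows "is_arg_min l (\<lambda>x. x \<in> closed_segment v w) v" "is_arg_max l (\<lambda>x. x \<in> closed_segment v w) w"
  using linear_on_segment[OF assms(1), of v w] assms(2)
  by (force simp: is_arg_min_def is_arg_max_def directed_edge_def not_less)+

text \<open>Transitivity comes from the stratification: \<open>u\<close> lies in its own stratum
  through the face \<open>{u}\<close>, so \<open>u \<in> F_minus P l v\<close> makes that stratum
  meet \<open>F_minus P l v\<close>, and the resulting inclusion passes to closures.\<close>

lemma stratified_polytope_F:
  assumes P: "polytope P" and l: "linear l"
    and edges: "\<And>e. e edge_of P \<Longrightarrow> \<not> l constant_on e"
    and Fm: "\<And>v. v extreme_point_of P \<Longrightarrow> F_minus P l v face_of P"
    and Fp: "\<And>v. v extreme_point_of P \<Longrightarrow> F_plus P l v face_of P"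
    and strat: "O_minus_stratification P l"
  shows "stratified_polytope P l (F_minus P l) (F_plus P l)"
proof unfold_locales
  fix v w assume e: "closed_segment v w edge_of P"
  show "l v \<noteq> l w"
  proof
    assume "l v = l w"
    then have "l x = l v" if "x \<in> closed_segment v w" for x
      using linear_on_segment[OF l _ that] by force
    then show False using edges[OF e] unfolding constant_on_def by blast
  qed
next
  fix v assume "v \<in> vertices P"
  then have v: "v extreme_point_of P" and vf: "{v} face_of P"
    by (auto simp: vertices_def face_of_singleton)
  show "F_minus P l v face_of P" "F_plus P l v face_of P" by (rule Fm[OF v], rule Fp[OF v])
  show "v \<in> F_minus P l v" using face_subset_F_minus[OF vf] by (auto simp: is_arg_max_def)
  show "v \<in> F_plus P l v" using face_subset_F_plus[OF vf] by (auto simp: is_arg_min_def)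
  show "l x \<le> l v" if "x \<in> F_minus P l v" for x by (rule F_minus_le[OF l that])
  show "l v \<le> l x" if "x \<in> F_plus P l v" for x by (rule F_plus_ge[OF l that])
next
  fix v w assume e: "directed_edge P l v w"
  then have f: "closed_segment v w face_of P" by (auto simp: directed_edge_def edge_of_def)
  show "v \<in> F_minus P l w" using face_subset_F_minus[OF f directed_edge_arg(2)[OF l e]] by auto
  show "w \<in> F_plus P l v" using face_subset_F_plus[OF f directed_edge_arg(1)[OF l e]] by auto
next
  fix u v assume uv: "u \<in> vertices P" "v \<in> vertices P" "u \<in> F_minus P l v"
  then have "{u} face_of P" by (simp add: vertices_def face_of_singleton)
  then have "rel_interior {u} \<subseteq> O_minus P l u" by (auto simp: O_minus_def is_arg_max_def)
  then have "u \<in> O_minus P l u" by simp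
  then have "O_minus P l u \<subseteq> F_minus P l v"
    using strat uv by (auto simp: O_minus_stratification_def vertices_def)
  then show "F_minus P l u \<subseteq> F_minus P l v"
    unfolding F_minus_def[of P l u] by (rule closure_minimal) (simp add: F_minus_def)
qed (use P l in \<open>auto simp: linear_add linear_cmul\<close>)

text \<open>A polytope with at most one point is its own monotone path polytope, so this settles the
  case of the theorem without two distinct extremal vertices.\<close>

lemma simple_polytope_subsingleton:
  assumes "P \<subseteq> {p}"
  shows "simple_polytope P"
proof -
  have "P = {} \<or> P = {p}" using assms by auto
  then have P: "polytope P" by (auto simp: polytope_empty polytope_sing)
  have "simple_star {v} P" if v: "v extreme_point_of P" for v
  proof -
    have f: "{v} face_of P" using v by (simp add: face_of_singleton)
    then have Pv: "P = {v}" using assms face_of_imp_subset by blast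
    have "covers {v} P = {}"
    proof -
      have "aff_dim G \<le> 0" if "G face_of P" for G
        using aff_dim_subset[OF face_of_imp_subset[OF that]] Pv by simp
      then show ?thesis by (force simp: covers_def)
    qed
    then show ?thesis using simple_star_iff_card_covers[OF P f] Pv by simp
  qed
  then show ?thesis using P by (simp add: simple_polytope_def)
qed

theorem theorem3p20:
  fixes P :: "'a::euclidean_space set" and l :: "'a \<Rightarrow> real"
  assumes "polytope P"
    and "linear l"
    and "\<And>e. e edge_of P \<Longrightarrow> \<not> l constant_on e"
    and "\<And>v. v extreme_point_of P \<Longrightarrow> F_minus P l v face_of P"
    and "\<And>v. v extreme_point_of P \<Longrightarrow> F_plus P l v face_of P"
    and "O_minus_stratification P l"
  defines "S1 \<equiv> simple_polytope (monotone_path_polytope P l)"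
    and "S2 \<equiv> (\<forall>v w. directed_edge P l v w \<longrightarrow>
      int (card (monotone_triangles P l v w)) = aff_dim (F_minus P l w \<inter> F_plus P l v) - 1)"
    and "S3 \<equiv> (\<forall>v w. directed_edge P l v w \<longrightarrow>
      simple_star (closed_segment v w) (F_minus P l w \<inter> F_plus P l v))"
    and "S4 \<equiv> (\<forall>F v w. F face_of P \<and> aff_dim F > 0 \<and>
      minimal_vertex l F v \<and> maximal_vertex l F w \<longrightarrow>
      simple_star F (F_plus P l v \<inter> F_minus P l w))"
  shows "(S1 \<longleftrightarrow> S2) \<and> (S2 \<longleftrightarrow> S3) \<and> (S3 \<longleftrightarrow> S4)"
proof -
  interpret stratified_polytope P l "F_minus P l" "F_plus P l"
    by (rule stratified_polytope_F) (use assms in auto)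
  have "S2 \<longleftrightarrow> S3" unfolding S2_def S3_def using triangles_count_iff_simple_star by blast
  moreover have "S1 \<longleftrightarrow> S3"
  proof (cases "\<exists>x. P \<subseteq> {x}")
    case True
    then obtain x where x: "P \<subseteq> {x}" by blast
    have S1 using simple_polytope_subsingleton[OF x] True by (simp add: S1_def monotone_path_polytope_def)
    moreover have "\<not> directed_edge P l v w" for v w
      using directed_edgeD[of v w] x vertices_subset[of P] by auto
    ultimately show ?thesis by (simp add: S3_def)
  next
    case False
    then have "P \<noteq> {}" by auto
    then obtain a b where ab: "bot a" "top b" using top_exists bot_exists by metis
    have "a \<noteq> b"
    proof
      assume eq: "a = b"
      have "x = a" if "x \<in> P" for x
        using bot_unique[OF ab(1) that] ab(2) that by (simp add: eq top_def)
      then show False using False by blast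
    qed
    then show ?thesis unfolding S1_def S3_def by (rule simple_monotone_path_polytope_iff[OF ab])
  qed
  moreover have "S3 \<longleftrightarrow> S4"
  proof
    assume S3
    then have simp: "simple_star (closed_segment a b) (F_minus P l b \<inter> F_plus P l a)"
      if "directed_edge P l a b" for a b using that by (simp add: S3_def)
    show S4
      unfolding S4_def minimal_vertex_def maximal_vertex_def
    proof clarify
      fix F v w
      assume F: "F face_of P" and v: "v extreme_point_of F" "is_arg_min l (\<lambda>x. x \<in> F) v"
        and w: "w extreme_point_of F" "is_arg_max l (\<lambda>x. x \<in> F) w"
      have "F \<subseteq> F_plus P l v \<inter> F_minus P l w"
        using face_subset_F_plus[OF F v(2)] face_subset_F_minus[OF F w(2)] by blast
      moreover have "v \<in> vertices P" "v \<in> F" "w \<in> vertices P" "w \<in> F"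
        using v(1) w(1) by (auto simp: vertices_def extreme_point_of_face[OF F])
      ultimately show "simple_star F (F_plus P l v \<inter> F_minus P l w)"
        using simple_star_in_interval[OF simp F] by blast
    qed
  next
    assume S4
    show S3
      unfolding S3_def
    proof (intro allI impI)
      fix v w assume e: "directed_edge P l v w"
      \<comment> \<open>An edge is itself a face of positive dimension, with its two ends as minimal
        and maximal vertex.\<close>
      have "minimal_vertex l (closed_segment v w) v" "maximal_vertex l (closed_segment v w) w"
        using directed_edge_arg[OF linear e]
        by (auto simp: minimal_vertex_def maximal_vertex_def extreme_point_of_segment)
      then have "simple_star (closed_segment v w) (F_plus P l v \<inter> F_minus P l w)"
        using \<open>S4\<close> directed_edgeD(4,5)[OF e] unfolding S4_def by (metis zero_less_one)
      then show "simple_star (closed_segment v w) (F_minus P l w \<inter> F_plus P l v)"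
        by (simp add: Int_commute)
    qed
  qed
  ultimately show ?thesis by blast
qed

end
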